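(* Let $0<\alpha<1$, let $\Lambda(\beta)$, $U(x;\beta)$ ($\beta>0$) be the explicit functions defined in the context, let $m(\beta)$ be the Morse index of $U(\,\cdot\,;\beta)$, and let $\beta_1>0$ be the unique positive root of $\sqrt{1-e^{-\beta}}\,\operatorname{arctanh}\sqrt{1-e^{-\beta}}=1$. Then there exists a constant $\beta_2$ such that $\beta_2>\beta_1$ and the following hold: (i) if $0<\beta<\beta_1$, then $m(\beta)=0$ and $U(x;\beta)$ is nondegenerate; (ii) if $\beta=\beta_1$, then $m(\beta)=0$ and $U(x;\beta)$ is degenerate; (iii) if $\beta_1<\beta<\beta_2$, then $m(\beta)=1$ and $U(x;\beta)$ is nondegenerate; (iv) if $\beta=\beta_2$, then $m(\beta)=1$ and $U(x;\beta)$ is degenerate; (v) if $\beta>\beta_2$, then $m(\beta)=2$ and $U(x;\beta)$ is nondegenerate. Moreover, there exists an unbounded connected set $\mathcal{C}\subset(0,\infty)\times C^1_0[-1,1]$ which emanates from $(\Lambda(\beta_2),U(\,\cdot\,;\beta_2))$. For each point $(\lambda,u)\in\mathcal{C}$, $u$ is a positive non-even solution of $$u''+\lambda h(x,\alpha)e^u=0,\quad x\in(-1,1),\qquad u(-1)=u(1)=0,$$ and satisfies $$\Lambda(\|u\|_\infty)\le\lambda<4\Lambda(\|u\|_\infty),$$ and there exists a sequence $\{(\lambda_n,u_n)\}\subset\mathcal{C}$ such that $\lambda_n\to0$ and $\|u_n\|_\infty\to\infty$.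
   Context: Fix $0<\alpha<1$. Let $h(x,\alpha)=0$ for $|x|<\alpha$ and $h(x,\alpha)=1$ for $\alpha\le|x|\le1$. For $\lambda>0$, a solution of the boundary value problem $u''+\lambda h(x,\alpha)e^u=0$ on $(-1,1)$, $u(-1)=u(1)=0$, is a function $u\in C^2([-1,1]\setminus\{-\alpha,\alpha\})\cap C^1[-1,1]$ with $u(\pm1)=0$ satisfying the equation on $(-1,1)\setminus\{-\alpha,\alpha\}$. It is positive if $u>0$ on $(-1,1)$. Put $\|u\|_\infty=\sup_{x\in[-1,1]}|u(x)|$. $C^1_0[-1,1]$ is the Banach space of $C^1$ functions on $[-1,1]$ vanishing at $\pm1$, with the $C^1$ norm. Let $w(x)=\log(1-\tanh^2(x/\sqrt2))$ (the solution of $w''+e^w=0$, $w(0)=w'(0)=0$), $\eta(\beta)=\sqrt2\,\operatorname{arctanh}\sqrt{1-e^{-\beta}}$ (the inverse of $x\mapsto -w(x)$ on $[0,\infty)$), and for $\beta>0$ $$\Lambda(\beta)=(1-\alpha)^{-2}e^{-\beta}[\eta(\beta)]^2,\qquad U(x;\beta)=\begin{cases}\beta,&|x|<\alpha,\\ w\!\left(\eta(\beta)\frac{|x|-\alpha}{1-\alpha}\right)+\beta,&\alpha\le|x|\le1.\end{cases}$$ $U(\,\cdot\,;\beta)$ is a positive even solution of the problem with $\lambda=\Lambda(\beta)$. Consider the eigenvalue problem $$\phi''+\Lambda(\beta)h(x,\alpha)e^{U(x;\beta)}\phi+\mu\phi=0,\quad x\in(-1,1),\qquad \phi(-1)=\phi(1)=0,$$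 with eigenfunctions $\phi\in C^1[-1,1]$ that are $C^2$ off $\{\pm\alpha\}$ and satisfy the equation off $\{\pm\alpha\}$. The Morse index $m(\beta)$ of $U(\,\cdot\,;\beta)$ is the number of negative eigenvalues $\mu$ of this problem; $U(x;\beta)$ is degenerate if $\mu=0$ is an eigenvalue, and nondegenerate otherwise. "$\mathcal{C}$ emanates from a point $P$" means that $P$ belongs to the closure of $\mathcal{C}$ in $\mathbb{R}\times C^1_0[-1,1]$ ($P$ itself need not belong to $\mathcal{C}$). *)

theory Defs
  imports "HOL-Analysis.Analysis" "HOL-Library.Extended_Nat"
begin

text \<open>Derivatives are taken within \<open>S\<close>, hence are one-sided at the end points of an interval.\<close>

definition C1_on :: "real set \<Rightarrow> (real \<Rightarrow> real) \<Rightarrow> bool" where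
  "C1_on S f \<longleftrightarrow>
    (\<exists>f'. (\<forall>x\<in>S. (f has_real_derivative f' x) (at x within S)) \<and> continuous_on S f')"

definition C2_on :: "real set \<Rightarrow> (real \<Rightarrow> real) \<Rightarrow> bool" where
  "C2_on S f \<longleftrightarrow>
    (\<exists>f'. (\<forall>x\<in>S. (f has_real_derivative f' x) (at x within S)) \<and> C1_on S f')"

definition sup_norm :: "(real \<Rightarrow> real) \<Rightarrow> real" where
  "sup_norm u = (SUP x\<in>{-1..1}. \<bar>u x\<bar>)"

abbreviation deriv_I :: "(real \<Rightarrow> real) \<Rightarrow> real \<Rightarrow> real" where
  "deriv_I u x \<equiv> vector_derivative u (at x within {-1..1})"

lemma C1_on_deriv_I:
  assumes "C1_on {-1..1} u"
  shows "\<And>x. x \<in> {-1..1} \<Longrightarrow> (u has_real_derivative deriv_I u x) (at x within {-1..1})"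
    and "continuous_on {-1..1} (deriv_I u)"
proof -
  obtain u' where u': "\<And>x. x \<in> {-1..1} \<Longrightarrow> (u has_real_derivative u' x) (at x within {-1..1})"
    and c: "continuous_on {-1..1} u'"
    using assms unfolding C1_on_def by blast
  have eq: "deriv_I u x = u' x" if "x \<in> {-1..1}" for x
    using that u'[OF that]
    by (intro vector_derivative_within_closed_interval)
      (auto simp: has_real_derivative_iff_has_vector_derivative)
  show "\<And>x. x \<in> {-1..1} \<Longrightarrow> (u has_real_derivative deriv_I u x) (at x within {-1..1})"
    using u' eq by simp
  show "continuous_on {-1..1} (deriv_I u)"
    using c by (rule continuous_on_eq) (simp add: eq)
qed

lemma deriv_I_eq:
  "x \<in> {-1..1} \<Longrightarrow> (u has_real_derivative d) (at x within {-1..1}) \<Longrightarrow> deriv_I u x = d"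
  by (intro vector_derivative_within_closed_interval)
      (auto simp: has_real_derivative_iff_has_vector_derivative)

lemma C1_on_continuous: "C1_on S u \<Longrightarrow> continuous_on S u"
  unfolding C1_on_def by (auto intro: DERIV_continuous_on)

lemma C1_on_add: "C1_on S u \<Longrightarrow> C1_on S v \<Longrightarrow> C1_on S (\<lambda>x. u x + v x)"
  unfolding C1_on_def
  apply clarify
  subgoal for f g by (rule exI[of _ "\<lambda>x. f x + g x"]) (auto intro!: derivative_intros continuous_intros)
  done

lemma C1_on_cmult: "C1_on S u \<Longrightarrow> C1_on S (\<lambda>x. c * u x)"
  unfolding C1_on_def
  apply clarify
  subgoal for f by (rule exI[of _ "\<lambda>x. c * f x"]) (auto intro!: derivative_eq_intros continuous_intros)
  done

lemma C1_on_const: "C1_on S (\<lambda>x. c)"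
  unfolding C1_on_def by (rule exI[of _ "\<lambda>x. 0"]) auto

lemma sup_norm_bdd: "continuous_on {-1..1::real} u \<Longrightarrow> bdd_above ((\<lambda>x. \<bar>u x :: real\<bar>) ` {-1..1})"
  by (rule bounded_imp_bdd_above, rule compact_imp_bounded, rule compact_continuous_image)
    (auto intro: continuous_intros)

lemma sup_norm_upper: "continuous_on {-1..1} u \<Longrightarrow> x \<in> {-1..1} \<Longrightarrow> \<bar>u x\<bar> \<le> sup_norm u"
  unfolding sup_norm_def by (intro cSUP_upper sup_norm_bdd)

lemma sup_norm_least: "(\<And>x. x \<in> {-1..1} \<Longrightarrow> \<bar>u x\<bar> \<le> B) \<Longrightarrow> sup_norm u \<le> B"
  unfolding sup_norm_def by (intro cSUP_least) auto

lemma sup_norm_nonneg: "continuous_on {-1..1} u \<Longrightarrow> 0 \<le> sup_norm u"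
  using sup_norm_upper[of u 0] by (simp add: order_trans[OF abs_ge_zero])

lemma sup_norm_cong: "(\<And>x. x \<in> {-1..1} \<Longrightarrow> u x = v x) \<Longrightarrow> sup_norm u = sup_norm v"
  unfolding sup_norm_def by auto

lemma sup_norm_add:
  assumes "continuous_on {-1..1} u" "continuous_on {-1..1} v"
  shows "sup_norm (\<lambda>x. u x + v x) \<le> sup_norm u + sup_norm v"
proof (rule sup_norm_least)
  fix x :: real assume "x \<in> {-1..1}"
  with sup_norm_upper[OF assms(1), of x] sup_norm_upper[OF assms(2), of x]
  show "\<bar>u x + v x\<bar> \<le> sup_norm u + sup_norm v" by simp
qed

lemma sup_norm_cmult_le:
  assumes "continuous_on {-1..1} u"
  shows "sup_norm (\<lambda>x. c * u x) \<le> \<bar>c\<bar> * sup_norm u"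
  using sup_norm_upper[OF assms]
  by (intro sup_norm_least) (auto simp: abs_mult intro!: mult_left_mono)

lemma sup_norm_cmult:
  assumes "continuous_on {-1..1} u"
  shows "sup_norm (\<lambda>x. c * u x) = \<bar>c\<bar> * sup_norm u"
proof (cases "c = 0")
  case True
  then show ?thesis by (simp add: sup_norm_def)
next
  case False
  have "sup_norm (\<lambda>x. inverse c * (c * u x)) \<le> \<bar>inverse c\<bar> * sup_norm (\<lambda>x. c * u x)"
    by (intro sup_norm_cmult_le continuous_intros assms)
  also have "(\<lambda>x. inverse c * (c * u x)) = u"
    using False by (simp add: fun_eq_iff)
  finally have "\<bar>c\<bar> * sup_norm u \<le> sup_norm (\<lambda>x. c * u x)"
    using False by (simp add: field_simps)
  with sup_norm_cmult_le[OF assms, of c] show ?thesis by simp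
qed

text \<open>A function on \<open>[-1,1]\<close> is represented by its extension by \<open>0\<close> to the real line.\<close>

typedef C10 = "{u :: real \<Rightarrow> real. C1_on {-1..1} u \<and> u (-1) = 0 \<and> u 1 = 0 \<and>
    (\<forall>x. x \<notin> {-1..1} \<longrightarrow> u x = 0)}"
  morphisms fun_of Abs_C10
  by (rule exI[of _ "\<lambda>_. 0"]) (simp add: C1_on_const)

setup_lifting type_definition_C10

lemma fun_of_C1: "C1_on {-1..1} (fun_of u)"
  and fun_of_m1: "fun_of u (-1) = 0"
  and fun_of_1: "fun_of u 1 = 0"
  and fun_of_out: "x \<notin> {-1..1} \<Longrightarrow> fun_of u x = 0"
  using fun_of[of u] by auto

lemma fun_of_cont: "continuous_on {-1..1} (fun_of u)"
  by (intro C1_on_continuous fun_of_C1)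

lemmas fun_of_deriv = C1_on_deriv_I[OF fun_of_C1]

lemma C10_eqI: "(\<And>x. fun_of u x = fun_of v x) \<Longrightarrow> u = v"
  by (metis fun_of_inject ext)

instantiation C10 :: real_vector
begin

lift_definition zero_C10 :: C10 is "\<lambda>_. 0"
  by (simp add: C1_on_const)

lift_definition plus_C10 :: "C10 \<Rightarrow> C10 \<Rightarrow> C10" is "\<lambda>u v x. u x + v x"
  by (simp add: C1_on_add)

lift_definition scaleR_C10 :: "real \<Rightarrow> C10 \<Rightarrow> C10" is "\<lambda>c u x. c * u x"
  by (simp add: C1_on_cmult)

lift_definition uminus_C10 :: "C10 \<Rightarrow> C10" is "\<lambda>u x. - u x"
  using C1_on_cmult[of _ _ "-1"] by simp

lift_definition minus_C10 :: "C10 \<Rightarrow> C10 \<Rightarrow> C10" is "\<lambda>u v x. u x - v x"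
  subgoal for u v using C1_on_add[OF _ C1_on_cmult[of _ v "-1"], of _ u] by simp
  done

instance
  by standard (transfer; simp add: fun_eq_iff algebra_simps)+

end

lemmas fun_of_simps [simp] =
  zero_C10.rep_eq plus_C10.rep_eq scaleR_C10.rep_eq uminus_C10.rep_eq minus_C10.rep_eq

lemma deriv_I_plus: "x \<in> {-1..1} \<Longrightarrow>
    deriv_I (fun_of (u + v)) x = deriv_I (fun_of u) x + deriv_I (fun_of v) x"
  using fun_of_deriv(1)[of x] by (intro deriv_I_eq) (auto intro!: derivative_intros)

lemma deriv_I_scaleR: "x \<in> {-1..1} \<Longrightarrow>
    deriv_I (fun_of (c *\<^sub>R u)) x = c * deriv_I (fun_of u) x"
  using fun_of_deriv(1)[of x] by (intro deriv_I_eq) (auto intro!: derivative_eq_intros)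

instantiation C10 :: real_normed_vector
begin

definition norm_C10 :: "C10 \<Rightarrow> real" where
  "norm_C10 u = sup_norm (fun_of u) + sup_norm (deriv_I (fun_of u))"

definition dist_C10 :: "C10 \<Rightarrow> C10 \<Rightarrow> real" where
  "dist_C10 u v = norm (u - v)"

definition sgn_C10 :: "C10 \<Rightarrow> C10" where
  "sgn_C10 u = u /\<^sub>R norm u"

definition uniformity_C10 :: "(C10 \<times> C10) filter" where
  "uniformity_C10 = (INF e\<in>{0<..}. principal {(u, v). dist u v < e})"

definition open_C10 :: "C10 set \<Rightarrow> bool" where
  "open_C10 A = (\<forall>u\<in>A. \<forall>\<^sub>F (u', v) in uniformity. u' = u \<longrightarrow> v \<in> A)"

instance
proof
  fix u v :: C10 and c :: real
  show "norm u = 0 \<longleftrightarrow> u = 0"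
  proof
    assume "norm u = 0"
    with sup_norm_nonneg[OF fun_of_cont, of u] sup_norm_nonneg[OF fun_of_deriv(2), of u]
    have "sup_norm (fun_of u) = 0"
      by (simp add: norm_C10_def)
    then have "fun_of u x = 0" for x
      using sup_norm_upper[OF fun_of_cont, of x u] fun_of_out[of x u]
      by (cases "x \<in> {-1..1}") auto
    then show "u = 0"
      by (intro C10_eqI) simp
  next
    assume "u = 0"
    have "sup_norm (deriv_I (fun_of (0::C10))) = sup_norm (\<lambda>_. 0)"
      by (intro sup_norm_cong deriv_I_eq) auto
    with \<open>u = 0\<close> show "norm u = 0"
      by (simp add: norm_C10_def sup_norm_def)
  qed
  have "sup_norm (deriv_I (fun_of (u + v))) =
      sup_norm (\<lambda>x. deriv_I (fun_of u) x + deriv_I (fun_of v) x)"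
    by (intro sup_norm_cong deriv_I_plus)
  then show "norm (u + v) \<le> norm u + norm v"
    using sup_norm_add[OF fun_of_cont fun_of_cont, of u v]
      sup_norm_add[OF fun_of_deriv(2) fun_of_deriv(2), of u v]
    by (simp add: norm_C10_def plus_C10.rep_eq)
  have "sup_norm (deriv_I (fun_of (c *\<^sub>R u))) = sup_norm (\<lambda>x. c * deriv_I (fun_of u) x)"
    by (intro sup_norm_cong deriv_I_scaleR)
  then show "norm (c *\<^sub>R u) = \<bar>c\<bar> * norm u"
    using sup_norm_cmult[OF fun_of_cont, of c u] sup_norm_cmult[OF fun_of_deriv(2), of c u]
    by (simp add: norm_C10_def scaleR_C10.rep_eq algebra_simps)
qed (simp_all add: dist_C10_def sgn_C10_def uniformity_C10_def open_C10_def)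

end

lemma norm_C10_ge:
  assumes "x \<in> {-1..1}"
  shows "\<bar>fun_of u x\<bar> \<le> norm u" "\<bar>deriv_I (fun_of u) x\<bar> \<le> norm u"
  using sup_norm_upper[OF fun_of_cont assms, of u] sup_norm_upper[OF fun_of_deriv(2) assms, of u]
    sup_norm_nonneg[OF fun_of_cont, of u] sup_norm_nonneg[OF fun_of_deriv(2), of u]
  by (simp_all add: norm_C10_def)

lemma deriv_I_minus: "x \<in> {-1..1} \<Longrightarrow>
    deriv_I (fun_of (u - v)) x = deriv_I (fun_of u) x - deriv_I (fun_of v) x"
  using fun_of_deriv(1)[of x] by (intro deriv_I_eq) (auto intro!: derivative_intros)

instance C10 :: banach
proof
  fix X :: "nat \<Rightarrow> C10"
  assume X: "Cauchy X"
  let ?I = "{-1..1::real}"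
  have "uniformly_Cauchy_on ?I (\<lambda>n. fun_of (X n))"
    unfolding uniformly_Cauchy_on_def
  proof clarify
    fix e :: real assume "e > 0"
    then obtain M where M: "\<And>m n. m \<ge> M \<Longrightarrow> n \<ge> M \<Longrightarrow> norm (X m - X n) < e"
      using CauchyD[OF X] by metis
    show "\<exists>M. \<forall>x\<in>?I. \<forall>m\<ge>M. \<forall>n\<ge>M. dist (fun_of (X m) x) (fun_of (X n) x) < e"
    proof (intro exI[of _ M] ballI allI impI)
      fix x m n assume x: "x \<in> ?I" and "M \<le> m" "M \<le> n"
      then have "norm (X m - X n) < e" using M by blast
      with norm_C10_ge(1)[OF x, of "X m - X n"]
      show "dist (fun_of (X m) x) (fun_of (X n) x) < e"
        by (simp add: dist_real_def)
    qed
  qed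
  then obtain f where f: "uniform_limit ?I (\<lambda>n. fun_of (X n)) f sequentially"
    using Cauchy_uniformly_convergent uniformly_convergent_on_def by blast
  have "uniformly_Cauchy_on ?I (\<lambda>n. deriv_I (fun_of (X n)))"
    unfolding uniformly_Cauchy_on_def
  proof clarify
    fix e :: real assume "e > 0"
    then obtain M where M: "\<And>m n. m \<ge> M \<Longrightarrow> n \<ge> M \<Longrightarrow> norm (X m - X n) < e"
      using CauchyD[OF X] by metis
    show "\<exists>M. \<forall>x\<in>?I. \<forall>m\<ge>M. \<forall>n\<ge>M.
        dist (deriv_I (fun_of (X m)) x) (deriv_I (fun_of (X n)) x) < e"
    proof (intro exI[of _ M] ballI allI impI)
      fix x m n assume x: "x \<in> ?I" and "M \<le> m" "M \<le> n"
      then have "norm (X m - X n) < e" using M by blast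
      with norm_C10_ge(2)[OF x, of "X m - X n"] deriv_I_minus[OF x, of "X m" "X n"]
      show "dist (deriv_I (fun_of (X m)) x) (deriv_I (fun_of (X n)) x) < e"
        by (simp add: dist_real_def del: fun_of_simps)
    qed
  qed
  then obtain g where g: "uniform_limit ?I (\<lambda>n. deriv_I (fun_of (X n))) g sequentially"
    using Cauchy_uniformly_convergent uniformly_convergent_on_def by blast
  have gc: "continuous_on ?I g"
    by (rule uniform_limit_theorem[OF _ g]) (auto intro!: always_eventually fun_of_deriv(2))
  have lim: "(\<lambda>n. fun_of (X n) x) \<longlonglongrightarrow> f x" if "x \<in> ?I" for x
    using tendsto_uniform_limitI[OF f that] .
  have "\<exists>h. \<forall>x\<in>?I. (\<lambda>n. fun_of (X n) x) \<longlonglongrightarrow> h x \<and>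
      (h has_derivative (\<lambda>t. t * g x)) (at x within ?I)"
  proof (rule has_derivative_sequence[where f' = "\<lambda>n x t. t * deriv_I (fun_of (X n)) x"])
    show "convex ?I" by simp
    show "(fun_of (X n) has_derivative (\<lambda>t. t * deriv_I (fun_of (X n)) x)) (at x within ?I)"
      if "x \<in> ?I" for n x
      using fun_of_deriv(1)[OF that, of "X n"]
      by (simp add: has_field_derivative_def mult_commute_abs)
    show "\<forall>\<^sub>F n in sequentially. \<forall>x\<in>?I. \<forall>h.
        norm (h * deriv_I (fun_of (X n)) x - h * g x) \<le> e * norm h" if "e > 0" for e :: real
      using uniform_limitD[OF g that]
    proof eventually_elim
      case (elim n)
      show ?case
      proof (intro ballI allI)
        fix x h :: real assume "x \<in> ?I"
        with elim have "\<bar>deriv_I (fun_of (X n)) x - g x\<bar> \<le> e"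
          by (auto simp: dist_real_def intro: less_imp_le)
        then have "\<bar>h\<bar> * \<bar>deriv_I (fun_of (X n)) x - g x\<bar> \<le> \<bar>h\<bar> * e"
          by (intro mult_left_mono) auto
        then show "norm (h * deriv_I (fun_of (X n)) x - h * g x) \<le> e * norm h"
          by (simp add: abs_mult[symmetric] algebra_simps)
      qed
    qed
    show "(1::real) \<in> ?I" by simp
    show "(\<lambda>n. fun_of (X n) 1) \<longlonglongrightarrow> f 1" by (rule lim) simp
  qed
  then obtain h where h: "\<And>x. x \<in> ?I \<Longrightarrow> (\<lambda>n. fun_of (X n) x) \<longlonglongrightarrow> h x"
    "\<And>x. x \<in> ?I \<Longrightarrow> (h has_derivative (\<lambda>t. t * g x)) (at x within ?I)"
    by blast
  have hf: "h x = f x" if "x \<in> ?I" for x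
    using LIMSEQ_unique[OF h(1)[OF that] lim[OF that]] .
  define k where "k x = (if x \<in> ?I then f x else 0)" for x
  have kd: "(k has_real_derivative g x) (at x within ?I)" if x: "x \<in> ?I" for x
  proof -
    have "(h has_real_derivative g x) (at x within ?I)"
      using h(2)[OF x] by (simp add: has_field_derivative_def mult_commute_abs)
    then show ?thesis
      by (rule has_field_derivative_transform_within[where d = 1]) (use x hf in \<open>auto simp: k_def\<close>)
  qed
  have k0: "k (-1) = 0" "k 1 = 0"
    using lim[of "-1"] lim[of 1] by (simp_all add: k_def fun_of_m1 fun_of_1 LIMSEQ_const_iff)
  have kmem: "C1_on ?I k \<and> k (-1) = 0 \<and> k 1 = 0 \<and> (\<forall>x. x \<notin> ?I \<longrightarrow> k x = 0)"
  proof (intro conjI allI impI)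
    show "C1_on ?I k"
      unfolding C1_on_def using kd gc by blast
  qed (use k0 in \<open>auto simp: k_def\<close>)
  define L where "L = Abs_C10 k"
  have L: "fun_of L = k"
    unfolding L_def using kmem by (intro Abs_C10_inverse) simp
  have dL: "deriv_I (fun_of L) x = g x" if "x \<in> ?I" for x
    unfolding L by (rule deriv_I_eq[OF that kd[OF that]])
  have "X \<longlonglongrightarrow> L"
  proof (rule LIMSEQ_I)
    fix r :: real assume "r > 0"
    then have r: "r / 4 > 0" by simp
    have "\<forall>\<^sub>F n in sequentially. norm (X n - L) < r"
      using uniform_limitD[OF f r] uniform_limitD[OF g r]
    proof eventually_elim
      case (elim n)
      have "sup_norm (fun_of (X n - L)) \<le> r / 4"
        using elim(1) by (intro sup_norm_least) (force simp: L k_def dist_real_def)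
      moreover have "sup_norm (deriv_I (fun_of (X n - L))) \<le> r / 4"
      proof (rule sup_norm_least)
        fix x assume x: "x \<in> ?I"
        with elim(2) show "\<bar>deriv_I (fun_of (X n - L)) x\<bar> \<le> r / 4"
          unfolding deriv_I_minus[OF x] dL[OF x] by (force simp: dist_real_def)
      qed
      ultimately show ?case
        using \<open>r > 0\<close> by (simp add: norm_C10_def)
    qed
    then show "\<exists>no. \<forall>n\<ge>no. norm (X n - L) < r"
      by (simp add: eventually_sequentially)
  qed
  then show "convergent X"
    by (auto simp: convergent_def)
qed

definition h :: "real \<Rightarrow> real \<Rightarrow> real" where
  "h x \<alpha> = (if \<bar>x\<bar> < \<alpha> then 0 else 1)"

text \<open>On the open set \<open>{-1<..<1} - {-\<alpha>, \<alpha>}\<close> the two-sided second derivative exists by \<open>C2_on\<close>.\<close>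

definition is_solution :: "real \<Rightarrow> real \<Rightarrow> (real \<Rightarrow> real) \<Rightarrow> bool" where
  "is_solution \<alpha> l u \<longleftrightarrow>
     C2_on ({-1..1} - {-\<alpha>, \<alpha>}) u \<and> C1_on {-1..1} u \<and> u (-1) = 0 \<and> u 1 = 0 \<and>
     (\<forall>x\<in>{-1<..<1} - {-\<alpha>, \<alpha>}. deriv (deriv u) x + l * h x \<alpha> * exp (u x) = 0)"

definition is_positive :: "(real \<Rightarrow> real) \<Rightarrow> bool" where
  "is_positive u \<longleftrightarrow> (\<forall>x\<in>{-1<..<1}. u x > 0)"

definition is_even :: "(real \<Rightarrow> real) \<Rightarrow> bool" where
  "is_even u \<longleftrightarrow> (\<forall>x\<in>{-1..1}. u (- x) = u x)"

definition w :: "real \<Rightarrow> real" where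
  "w x = ln (1 - (tanh (x / sqrt 2))\<^sup>2)"

definition \<eta> :: "real \<Rightarrow> real" where
  "\<eta> \<beta> = sqrt 2 * artanh (sqrt (1 - exp (- \<beta>)))"

definition \<Lambda> :: "real \<Rightarrow> real \<Rightarrow> real" where
  "\<Lambda> \<alpha> \<beta> = exp (- \<beta>) * (\<eta> \<beta>)\<^sup>2 / (1 - \<alpha>)\<^sup>2"

definition U :: "real \<Rightarrow> real \<Rightarrow> real \<Rightarrow> real" where
  "U \<alpha> \<beta> x =
     (if \<bar>x\<bar> < \<alpha> then \<beta>
      else if \<bar>x\<bar> \<le> 1 then w (\<eta> \<beta> * (\<bar>x\<bar> - \<alpha>) / (1 - \<alpha>)) + \<beta>
      else 0)"

definition U_C10 :: "real \<Rightarrow> real \<Rightarrow> C10" where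
  "U_C10 \<alpha> \<beta> = Abs_C10 (U \<alpha> \<beta>)"

lemma w_0: "w 0 = 0"
  by (simp add: w_def)

lemma tanh_sq_less_1: "(tanh (x::real))\<^sup>2 < 1"
  using tanh_real_bounds[of x] by (simp add: abs_square_less_1 abs_less_iff)

lemma w_deriv: "(w has_real_derivative - sqrt 2 * tanh (x / sqrt 2)) (at x)"
proof -
  define r :: real where "r = sqrt 2"
  have r: "r \<noteq> 0" "r * r = 2" by (simp_all add: r_def)
  define T where "T = tanh (x / r)"
  have "((\<lambda>x. 1 - (tanh (x / r))\<^sup>2) has_real_derivative (1 - T\<^sup>2) * (- r * T)) (at x)"
    unfolding T_def by (auto intro!: derivative_eq_intros simp: r)
  moreover have "1 - T\<^sup>2 > 0"
    using tanh_sq_less_1 by (simp add: T_def)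
  ultimately have "((\<lambda>x. ln (1 - (tanh (x / r))\<^sup>2)) has_real_derivative
      1 / (1 - T\<^sup>2) * ((1 - T\<^sup>2) * (- r * T))) (at x)"
    unfolding T_def by (intro DERIV_chain2[OF DERIV_ln_divide]) simp_all
  with \<open>1 - T\<^sup>2 > 0\<close> show ?thesis
    by (simp add: w_def[abs_def] r_def T_def)
qed

lemma tanh_artanh_real:
  assumes "\<bar>y::real\<bar> < 1"
  shows "tanh (artanh y) = y"
proof -
  have "exp (- 2 * artanh y) = (1 - y) / (1 + y)"
    using assms by (simp add: artanh_def exp_minus)
  then have "tanh (artanh y) = (1 - (1 - y) / (1 + y)) / (1 + (1 - y) / (1 + y))"
    unfolding tanh_real_altdef by simp
  also have "1 - (1 - y) / (1 + y) = 2 * y / (1 + y)"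
    using assms by (simp add: field_simps)
  also have "1 + (1 - y) / (1 + y) = 2 / (1 + y)"
    using assms by (simp add: field_simps)
  finally show ?thesis
    using assms by simp
qed

lemma w_\<eta>:
  assumes "\<beta> > 0"
  shows "w (\<eta> \<beta>) = - \<beta>"
proof -
  have "0 < 1 - exp (- \<beta>)" "1 - exp (- \<beta>) < 1" using assms by auto
  then show ?thesis
    by (simp add: w_def \<eta>_def tanh_artanh_real)
qed

lemma w_pos_part_deriv:
  assumes "c \<ge> 0"
  shows "((\<lambda>y. w (c * max 0 y)) has_real_derivative
      c * (- sqrt 2 * tanh (c * max 0 y / sqrt 2))) (at y)"
proof -
  have "((\<lambda>y. if y \<in> {0..} then w (c * y) else 0) has_vector_derivative
     (if y \<in> {0..} then c * (- sqrt 2 * tanh (c * y / sqrt 2)) else 0)) (at y within UNIV)"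
  proof (rule has_vector_derivative_If_within_closures[where T = "{..0}"])
    show "((\<lambda>y. w (c * y)) has_vector_derivative c * (- sqrt 2 * tanh (c * y / sqrt 2)))
        (at y within {0..} \<union> (closure {0..} \<inter> closure {..0}))"
      unfolding has_real_derivative_iff_has_vector_derivative[symmetric]
      by (rule DERIV_subset[where s = UNIV])
        (auto intro!: DERIV_cong[OF DERIV_chain2[OF w_deriv, where g = "\<lambda>y. c * y" and Db = c]]
          derivative_eq_intros)
  qed (auto simp: w_0)
  moreover have "(\<lambda>y. if y \<in> {0..} then w (c * y) else 0) = (\<lambda>y. w (c * max 0 y))"
    by (auto simp: fun_eq_iff w_0 max_def)
  moreover have "(if y \<in> {0..} then c * (- sqrt 2 * tanh (c * y / sqrt 2)) else 0) =
      c * (- sqrt 2 * tanh (c * max 0 y / sqrt 2))"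
    by (auto simp: max_def)
  ultimately show ?thesis
    by (simp add: has_real_derivative_iff_has_vector_derivative)
qed

lemma \<eta>_pos: "\<beta> > 0 \<Longrightarrow> \<eta> \<beta> > 0"
  by (auto simp: \<eta>_def artanh_def intro!: mult_pos_pos ln_gt_zero)

lemma fun_of_U_C10:
  assumes "0 < \<alpha>" "\<alpha> < 1" "\<beta> > 0"
  shows "fun_of (U_C10 \<alpha> \<beta>) = U \<alpha> \<beta>"
  unfolding U_C10_def
proof (rule Abs_C10_inverse, intro CollectI conjI allI impI)
  let ?I = "{-1..1::real}"
  define c where "c = \<eta> \<beta> / (1 - \<alpha>)"
  have c: "c \<ge> 0" using \<eta>_pos[of \<beta>] assms by (simp add: c_def)
  define V where "V y = w (c * max 0 y)" for y
  define V' where "V' y = c * (- sqrt 2 * tanh (c * max 0 y / sqrt 2))" for y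
  have V: "(V has_real_derivative V' y) (at y)" for y
    unfolding V_def V'_def by (rule w_pos_part_deriv[OF c])
  have V'c: "continuous_on UNIV V'"
    unfolding V'_def by (intro continuous_intros) auto
  have eq: "V (x - \<alpha>) + V (- x - \<alpha>) + \<beta> = U \<alpha> \<beta> x" if "x \<in> ?I" for x
    using that assms by (auto simp: U_def V_def w_0 c_def max_def abs_if algebra_simps)
  show "C1_on ?I (U \<alpha> \<beta>)"
    unfolding C1_on_def
  proof (intro exI conjI ballI)
    fix x assume x: "x \<in> ?I"
    have "((\<lambda>x. V (x - \<alpha>) + V (- x - \<alpha>) + \<beta>) has_real_derivative V' (x - \<alpha>) - V' (- x - \<alpha>))
        (at x within ?I)"
      by (auto intro!: derivative_eq_intros DERIV_chain2[OF V])
    then show "(U \<alpha> \<beta> has_real_derivative V' (x - \<alpha>) - V' (- x - \<alpha>)) (at x within ?I)"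
      by (rule has_field_derivative_transform_within[where d = 1]) (use x eq in auto)
  next
    show "continuous_on ?I (\<lambda>x. V' (x - \<alpha>) - V' (- x - \<alpha>))"
      by (intro continuous_intros continuous_on_compose2[OF V'c]) auto
  qed
qed (use assms w_\<eta>[of \<beta>] in \<open>auto simp: U_def\<close>)

definition is_eigenvalue :: "real \<Rightarrow> real \<Rightarrow> real \<Rightarrow> bool" where
  "is_eigenvalue \<alpha> \<beta> \<mu> \<longleftrightarrow>
     (\<exists>\<phi>. C2_on ({-1..1} - {-\<alpha>, \<alpha>}) \<phi> \<and> C1_on {-1..1} \<phi> \<and> \<phi> (-1) = 0 \<and> \<phi> 1 = 0 \<and>
       (\<exists>x\<in>{-1..1}. \<phi> x \<noteq> 0) \<and>
       (\<forall>x\<in>{-1<..<1} - {-\<alpha>, \<alpha>}.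
          deriv (deriv \<phi>) x + \<Lambda> \<alpha> \<beta> * h x \<alpha> * exp (U \<alpha> \<beta> x) * \<phi> x + \<mu> * \<phi> x = 0))"

text \<open>The value is infinite if there are infinitely many negative eigenvalues, so that an
  equation \<open>morse_index \<alpha> \<beta> = 0\<close> cannot hold for the trivial reason that \<open>card\<close> of an
  infinite set is \<open>0\<close>.\<close>

definition morse_index :: "real \<Rightarrow> real \<Rightarrow> enat" where
  "morse_index \<alpha> \<beta> =
     (let E = {\<mu>. \<mu> < 0 \<and> is_eigenvalue \<alpha> \<beta> \<mu>} in if finite E then enat (card E) else \<infinity>)"

definition degenerate :: "real \<Rightarrow> real \<Rightarrow> bool" where
  "degenerate \<alpha> \<beta> \<longleftrightarrow> is_eigenvalue \<alpha> \<beta> 0"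

definition \<beta>\<^sub>1 :: real where
  "\<beta>\<^sub>1 = (THE \<beta>. \<beta> > 0 \<and> sqrt (1 - exp (- \<beta>)) * artanh (sqrt (1 - exp (- \<beta>))) = 1)"

lemma artanh_real_strict_mono:
  assumes "0 \<le> x" "x < y" "y < (1::real)"
  shows "artanh x < artanh y"
  using assms by (auto simp: artanh_def intro!: divide_strict_right_mono frac_less2 ln_less_cancel_iff[THEN iffD2])

lemma \<beta>\<^sub>1_ex1:
  "\<exists>!\<beta>::real. \<beta> > 0 \<and> sqrt (1 - exp (- \<beta>)) * artanh (sqrt (1 - exp (- \<beta>))) = 1"
proof (rule ex_ex1I)
  have "(artanh \<longlongrightarrow> (artanh 0 :: real)) (at 0)" by (intro tendsto_intros) auto
  define t :: real where "t = tanh 2"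
  have t: "0 < t" "t < 1" by (auto simp: t_def tanh_real_lt_1)
  have "exp (-4) \<le> (1/9 :: real)"
  proof -
    have "(9::real) \<le> (1 + 2) ^ 2" by simp
    also have "\<dots> \<le> exp 2 ^ 2" by (intro power_mono exp_ge_add_one_self) auto
    also have "\<dots> = exp 4" by (simp flip: exp_of_nat_mult)
    finally show ?thesis by (simp add: exp_minus field_simps)
  qed
  then have "1 * (1 + exp (-4)) \<le> 2 * (1 - exp (-4::real))" by simp
  then have "t * 2 \<ge> 1"
    unfolding t_def tanh_real_altdef by (simp add: field_simps add_pos_pos)
  then have ge: "t * artanh t \<ge> 1" by (simp add: t_def artanh_tanh_real)
  have "\<exists>s\<ge>0. s \<le> t \<and> s * artanh s = 1"
    by (rule IVT') (use t ge in \<open>auto intro!: continuous_intros\<close>)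
  then obtain s where s: "0 \<le> s" "s \<le> t" "s * artanh s = 1" by blast
  then have s0: "0 < s" "s < 1" using t by (cases "s = 0"; auto)+
  have "1 - s\<^sup>2 > 0" "1 - s\<^sup>2 < 1" using s0 by (auto simp: abs_square_less_1)
  then show "\<exists>\<beta>::real. \<beta> > 0 \<and> sqrt (1 - exp (- \<beta>)) * artanh (sqrt (1 - exp (- \<beta>))) = 1"
    using s s0 by (intro exI[of _ "- ln (1 - s\<^sup>2)"]) auto
next
  have less: "sqrt (1 - exp (- a)) * artanh (sqrt (1 - exp (- a))) <
      sqrt (1 - exp (- b)) * artanh (sqrt (1 - exp (- b)))" if "0 < a" "a < b" for a b :: real
  proof -
    have *: "0 < sqrt (1 - exp (- a))" "sqrt (1 - exp (- a)) < sqrt (1 - exp (- b))"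
      "sqrt (1 - exp (- b)) < 1"
      using that by auto
    then have "artanh (sqrt (1 - exp (- a))) < artanh (sqrt (1 - exp (- b)))"
      by (intro artanh_real_strict_mono) auto
    moreover have "artanh 0 < artanh (sqrt (1 - exp (- a)))"
      using * by (intro artanh_real_strict_mono) auto
    ultimately show ?thesis
      using * by (intro mult_strict_mono) auto
  qed
  fix a b :: real
  assume "a > 0 \<and> sqrt (1 - exp (- a)) * artanh (sqrt (1 - exp (- a))) = 1"
    and "b > 0 \<and> sqrt (1 - exp (- b)) * artanh (sqrt (1 - exp (- b))) = 1"
  then show "a = b"
    using less[of a b] less[of b a] by (cases a b rule: linorder_cases) auto
qed

end

theory Submission
  imports Defs
begin

text \<open>
  All solutions are explicit. On \<open>[\<alpha>,1]\<close> and on \<open>[-1,-\<alpha>]\<close> a positive solution is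
  \<open>c - 2 ln cosh\<close> of an affine function, and in between it is linear. With \<open>p\<close> determined by
  \<open>\<parallel>u\<parallel> = 2 ln (cosh p)\<close> and \<open>a\<close> measuring the slope in the middle, the solutions increasing on
  \<open>[-\<alpha>,\<alpha>]\<close> correspond to the zeros of one explicit function \<open>Z(p,a)\<close> with \<open>0 \<le> a < p\<close>;
  the even solutions are \<open>a = 0\<close>. For small \<open>a > 0\<close> the sign of \<open>Z\<close> is that of \<open>p - p\<^sub>2\<close>, while
  \<open>Z < 0\<close> near \<open>a = p\<close> and for small \<open>p\<close>. Hence the frontier of a suitable complementary component
  of a component of \<open>{Z > 0}\<close> is a connected set of zeros (by unicoherence of the plane) which starts
  at \<open>(p\<^sub>2,0)\<close> and meets every line \<open>p = const > p\<^sub>2\<close>; this is the branch. The bounds on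
  \<open>\<lambda>\<close> say just \<open>0 \<le> a < p\<close>.

  For the Morse index, an eigenfunction with eigenvalue \<open>-\<nu>\<^sup>2\<close> may be taken even or odd, so it is a
  multiple of \<open>cosh (\<nu> x)\<close> or \<open>sinh (\<nu> x)\<close> on \<open>[-\<alpha>,\<alpha>]\<close>. The problem becomes the Dirichlet problem on
  \<open>[\<alpha>,1]\<close> with \<open>y'(\<alpha>)/y(\<alpha>)\<close> equal to \<open>\<nu> tanh (\<nu> \<alpha>)\<close> or \<open>\<nu> coth (\<nu> \<alpha>)\<close>, both increasing in
  \<open>\<nu>\<close>. By Sturm comparison \<open>y'(\<alpha>)/y(\<alpha>)\<close> decreases in \<open>\<nu>\<close>, so each parity contributes at most one
  \<open>\<nu>\<close>, and the explicit solution for \<open>\<nu> = 0\<close> decides when it exists.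
\<close>

subsection \<open>Connected zero sets in the plane\<close>

text \<open>\<open>H\<close> contains, around each column over \<open>I\<close>, a box unbounded
  downwards. Boxes of nearby columns overlap, so the component of \<open>H\<close> met far down a
  column is locally constant in the column, hence constant on the connected set
  \<open>I\<close>.\<close>

lemma connected_vertical_end:
  fixes H :: "(real \<times> real) set" and I :: "real set"
  assumes I: "connected I" "x \<in> I" "y \<in> I"
    and box: "\<And>x. x \<in> I \<Longrightarrow> \<exists>e>0. \<exists>s0. \<forall>x' s. \<bar>x' - x\<bar> < e \<and> s \<le> s0 \<longrightarrow> (x', s) \<in> H"
  shows "\<exists>s0. \<forall>s t. s \<le> s0 \<and> t \<le> s0 \<longrightarrow> connected_component H (x, s) (y, t)"
proof -
  from box obtain e z where e: "\<And>x. x \<in> I \<Longrightarrow> e x > 0"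
    and z: "\<And>x x' s. x \<in> I \<Longrightarrow> \<bar>x' - x\<bar> < e x \<Longrightarrow> s \<le> z x \<Longrightarrow> (x', s) \<in> H"
    by metis
  define B where "B x = {x - e x<..<x + e x} \<times> {..z x}" for x
  have B: "connected (B x)" "x \<in> I \<Longrightarrow> B x \<subseteq> H" "x \<in> I \<Longrightarrow> s \<le> z x \<Longrightarrow> (x, s) \<in> B x" for x s
    using e[of x] z[of x]
    by (auto simp: B_def abs_less_iff intro!: connected_Times convex_connected)
  have cc: "connected_component H u v" if "u \<in> B x" "v \<in> B x" "x \<in> I" for u v x
    using that B[of x] connected_component_def by metis
  define g where "g x = connected_component_set H (x, z x)" for x
  have "g x = g y"
  proof (rule connected_local_const[OF I(1-3)], intro ballI)
    fix a assume a: "a \<in> I"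
    have "\<forall>\<^sub>F b in at a within I. b \<in> ball a (e a) \<and> b \<in> I"
      using e[OF a] by (intro eventually_conj eventually_at_ball) (auto simp: eventually_at_filter)
    then show "\<forall>\<^sub>F b in at a within I. g a = g b"
    proof eventually_elim
      case (elim b)
      then have *: "\<bar>b - a\<bar> < e a" "b \<in> I" by (auto simp: dist_real_def)
      then have "connected_component H (a, z a) (b, min (z a) (z b))"
        by (intro cc[of _ a] a) (use e[OF a] in \<open>auto simp: B_def abs_less_iff\<close>)
      moreover have "connected_component H (b, min (z a) (z b)) (b, z b)"
        by (intro cc[of _ b] * B) auto
      ultimately show ?case
        unfolding g_def using connected_component_eq_eq connected_component_trans
        by (metis connected_component_eq mem_Collect_eq)
    qed
  qed
  have inH: "(x, z x) \<in> H" "(y, z y) \<in> H" using B I by blast+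
  then have xy: "connected_component H (x, z x) (y, z y)"
    using \<open>g x = g y\<close> unfolding g_def
    by (metis connected_component_eq_eq)
  show ?thesis
  proof (intro exI[of _ "min (z x) (z y)"] allI impI)
    fix s t assume "s \<le> min (z x) (z y) \<and> t \<le> min (z x) (z y)"
    then have "connected_component H (x, s) (x, z x)" "connected_component H (y, z y) (y, t)"
      using cc[of _ x] cc[of _ y] I B(3) by auto
    with xy show "connected_component H (x, s) (y, t)"
      using connected_component_trans by metis
  qed
qed

text \<open>\<open>T\<close> is the closure of the component of the positive set containing the
  lower ends of all columns right of \<open>c\<close>, and \<open>Q\<close> the component of its
  complement containing the line \<open>x = l\<close>. The frontier of \<open>Q\<close> is the
  required set: it is connected by unicoherence, \<open>G\<close> vanishes on it, and it is met by
  every column right of \<open>c\<close> and by low horizontal segments across \<open>c\<close>,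
  since these run between \<open>T\<close> and \<open>Q\<close>.\<close>

lemma connected_zero_set:
  fixes G :: "real \<times> real \<Rightarrow> real" and c l :: real
  assumes cont: "continuous_on UNIV G" and lc: "l < c"
    and left: "\<And>s. G (l, s) < 0"
    and below_right: "\<And>x. x > c \<Longrightarrow> \<exists>e>0. \<exists>s0. \<forall>x' s. \<bar>x' - x\<bar> < e \<and> s \<le> s0 \<longrightarrow> G (x', s) > 0"
    and below_left: "\<And>x. x < c \<Longrightarrow> \<exists>e>0. \<exists>s0. \<forall>x' s. \<bar>x' - x\<bar> < e \<and> s \<le> s0 \<longrightarrow> G (x', s) < 0"
    and above: "\<And>x. \<exists>e>0. \<exists>s0. \<forall>x' s. \<bar>x' - x\<bar> < e \<and> s \<ge> s0 \<longrightarrow> G (x', s) < 0"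
  obtains K where "connected K" "\<And>z. z \<in> K \<Longrightarrow> G z = 0" "\<And>x. x > c \<Longrightarrow> \<exists>s. (x, s) \<in> K"
    "\<And>d s0. d > 0 \<Longrightarrow> \<exists>x s. (x, s) \<in> K \<and> \<bar>x - c\<bar> < d \<and> s \<le> s0"
proof -
  define P where "P = {z. G z > 0}"
  define N where "N = {z. G z < 0}"
  have oP: "open P" and oN: "open N"
    unfolding P_def N_def by (intro open_Collect_less cont continuous_on_const)+
  have Pend: "\<exists>s0. \<forall>s t. s \<le> s0 \<and> t \<le> s0 \<longrightarrow> connected_component P (x, s) (y, t)"
    if "x > c" "y > c" for x y
    using that by (intro connected_vertical_end[of "{c<..}"]) (auto simp: P_def below_right)
  have Nend: "\<exists>s0. \<forall>s t. s \<le> s0 \<and> t \<le> s0 \<longrightarrow> connected_component N (x, s) (y, t)"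
    if "x < c" "y < c" for x y
    using that by (intro connected_vertical_end[of "{..<c}"]) (auto simp: N_def below_left)
  have Ntop: "\<exists>s0. \<forall>s t. s \<ge> s0 \<and> t \<ge> s0 \<longrightarrow> connected_component N (x, s) (y, t)" for x y
  proof -
    \<comment> \<open>Reflection in the horizontal axis turns the upper ends into lower ends, to
      which \<open>connected_vertical_end\<close> applies.\<close>
    define r :: "real \<times> real \<Rightarrow> real \<times> real" where "r z = (fst z, - snd z)" for z
    have rr: "r (r z) = z" for z by (simp add: r_def)
    have "\<exists>s0. \<forall>s t. s \<le> s0 \<and> t \<le> s0 \<longrightarrow> connected_component (r ` N) (x, s) (y, t)"
    proof (rule connected_vertical_end[of UNIV])
      fix x :: real
      obtain e s0 where *: "e > 0" "\<And>x' s. \<bar>x' - x\<bar> < e \<Longrightarrow> s \<ge> s0 \<Longrightarrow> G (x', s) < 0"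
        using above[of x] by blast
      show "\<exists>e>0. \<exists>s0. \<forall>x' s. \<bar>x' - x\<bar> < e \<and> s \<le> s0 \<longrightarrow> (x', s) \<in> r ` N"
      proof (rule exI[of _ e], rule conjI[OF *(1)], rule exI[of _ "-s0"], intro allI impI)
        fix x' s assume "\<bar>x' - x\<bar> < e \<and> s \<le> - s0"
        then have "(x', -s) \<in> N" using *(2) by (auto simp: N_def)
        then show "(x', s) \<in> r ` N" by (intro rev_image_eqI) (auto simp: r_def)
      qed
    qed auto
    then obtain s0 where s0: "\<And>s t. s \<le> s0 \<Longrightarrow> t \<le> s0 \<Longrightarrow> connected_component (r ` N) (x, s) (y, t)"
      by blast
    have "connected_component N (x, s) (y, t)" if st: "s \<ge> -s0" "t \<ge> -s0" for s t
    proof -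
      obtain T where T: "connected T" "T \<subseteq> r ` N" "(x, -s) \<in> T" "(y, -t) \<in> T"
        using s0[of "-s" "-t"] st unfolding connected_component_def by (auto simp: minus_le_iff)
      have "connected (r ` T)"
        by (intro connected_continuous_image T) (auto simp: r_def intro!: continuous_intros)
      moreover have "r ` T \<subseteq> N" using T(2) rr by force
      moreover have "(x, s) \<in> r ` T" "(y, t) \<in> r ` T"
        using T(3,4) by (force simp: r_def image_iff)+
      ultimately show ?thesis unfolding connected_component_def by blast
    qed
    then show ?thesis by (intro exI[of _ "-s0"]) auto
  qed
  have Nleft: "connected_component N (l, s) (l, t)" for s t
    unfolding connected_component_def
    by (rule exI[of _ "{l} \<times> UNIV"]) (auto simp: N_def left intro!: connected_Times)

  obtain s1 where s1: "\<And>s t. s \<le> s1 \<Longrightarrow> t \<le> s1 \<Longrightarrow> connected_component P (c+1, s) (c+1, t)"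
    using Pend[of "c+1" "c+1"] by auto
  define z1 where "z1 = (c + 1, s1)"
  have z1: "z1 \<in> P" using s1[of s1 s1] connected_component_in(1) unfolding z1_def by blast
  define T where "T = closure (connected_component_set P z1)"
  have Tc: "connected T" unfolding T_def by (intro connected_imp_connected_closure connected_connected_component)
  have TN: "T \<inter> N = {}"
  proof -
    have "T \<subseteq> closure P" unfolding T_def by (intro closure_mono connected_component_subset)
    moreover have "closure P \<inter> N = {}"
      using open_Int_closure_eq_empty[OF oN, of P] by (auto simp: P_def N_def)
    ultimately show ?thesis by blast
  qed
  \<comment> \<open>A point of \<open>T\<close> in \<open>P\<close> has an open component of
    \<open>P\<close> around it which meets that of \<open>z1\<close>; the two coincide, so the point
    is interior to \<open>T\<close>.\<close>
  have Tfr: "G z = 0" if "z \<in> T" "z \<notin> interior T" for z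
  proof (rule ccontr)
    assume "G z \<noteq> 0"
    with that TN have "z \<in> P" by (auto simp: N_def P_def)
    then have o: "open (connected_component_set P z)" "z \<in> connected_component_set P z"
      using oP open_connected_component by (auto simp: connected_component_refl)
    then have "connected_component_set P z \<inter> connected_component_set P z1 \<noteq> {}"
      using that(1) open_Int_closure_eq_empty[OF o(1)] unfolding T_def by blast
    then have "connected_component_set P z = connected_component_set P z1"
      by (meson connected_component_nonoverlap)
    then have "connected_component_set P z \<subseteq> T" unfolding T_def by (simp add: closure_subset)
    then show False using that(2) o interiorI by blast
  qed
  define Q where "Q = connected_component_set (- T) (l, 0)"
  have lT: "(l, 0) \<in> - T" using TN left[of 0] by (auto simp: N_def)
  have "Q \<in> components (- T)" unfolding Q_def using lT by (rule componentsI)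
  \<comment> \<open>Unicoherence: components of the complement of a connected set have connected
    frontier.\<close>
  then have Kc: "connected (frontier Q)" using connected_frontier_component_complement[OF Tc] by blast
  have oT: "open (- T)" unfolding T_def by auto
  then have oQ: "open Q" unfolding Q_def by (rule open_connected_component)
  have QT: "Q \<subseteq> - T" unfolding Q_def by (rule connected_component_subset)
  have zero: "G z = 0" if "z \<in> frontier Q" for z
  proof (rule Tfr)
    have zQ: "z \<in> closure Q" "z \<notin> Q" using that oQ by (auto simp: frontier_def interior_open)
    show "z \<in> T"
    proof (rule ccontr)
      assume "z \<notin> T"
      then have o: "open (connected_component_set (- T) z)" "z \<in> connected_component_set (- T) z"
        using oT open_connected_component by (auto simp: connected_component_refl)
      then have "connected_component_set (- T) z \<inter> Q \<noteq> {}"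
        using zQ(1) open_Int_closure_eq_empty[OF o(1)] by blast
      then have "connected_component_set (- T) z = Q" unfolding Q_def
        by (meson connected_component_nonoverlap)
      then show False using o zQ by blast
    qed
    show "z \<notin> interior T"
      using zQ QT open_Int_closure_eq_empty[of "interior T" Q] interior_subset[of T] by blast
  qed
  \<comment> \<open>\<open>N\<close> avoids \<open>T\<close>, so a component of \<open>N\<close>
    that meets \<open>Q\<close> lies in \<open>Q\<close>. This brings the lower ends left of
    \<open>c\<close> and all upper ends into \<open>Q\<close>.\<close>
  have NQ: "v \<in> Q" if "u \<in> Q" "connected_component N u v" for u v
  proof -
    have "N \<subseteq> - T" using TN by blast
    then have "connected_component (- T) u v"
      using that(2) connected_component_mono by (metis Collect_mem_eq mem_Collect_eq connected_component_of_subset)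
    with that(1) show ?thesis unfolding Q_def by (metis connected_component_trans mem_Collect_eq)
  qed
  have l0: "(l, 0) \<in> Q" unfolding Q_def using lT by (simp add: connected_component_refl)
  have lQ: "(l, s) \<in> Q" for s using NQ[OF l0 Nleft] .
  have PT: "\<exists>s0. \<forall>s\<le>s0. (x, s) \<in> T" if x: "x > c" for x
  proof -
    obtain s0 where s0: "\<And>s t. s \<le> s0 \<Longrightarrow> t \<le> s0 \<Longrightarrow> connected_component P (c+1, s) (x, t)"
      using Pend[of "c+1" x] x by auto
    have "(x, s) \<in> T" if "s \<le> min s0 s1" for s
    proof -
      have "connected_component P z1 (c+1, s)" "connected_component P (c+1, s) (x, s)"
        using s1[of s1 s] s0[of s s] that by (auto simp: z1_def)
      then have "connected_component P z1 (x, s)" by (rule connected_component_trans)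
      then show ?thesis unfolding T_def by (intro subsetD[OF closure_subset]) simp
    qed
    then show ?thesis by blast
  qed
  have BQ: "\<exists>s0. \<forall>s\<le>s0. (x, s) \<in> Q" if x: "x < c" for x
  proof -
    obtain s0 where s0: "\<And>s t. s \<le> s0 \<Longrightarrow> t \<le> s0 \<Longrightarrow> connected_component N (l, s) (x, t)"
      using Nend[of l x] x lc by auto
    then show ?thesis using NQ[OF lQ] by blast
  qed
  have AQ: "\<exists>s0. \<forall>s\<ge>s0. (x, s) \<in> Q" for x
  proof -
    obtain s0 where s0: "\<And>s t. s \<ge> s0 \<Longrightarrow> t \<ge> s0 \<Longrightarrow> connected_component N (l, s) (x, t)"
      using Ntop[of l x] by auto
    then show ?thesis using NQ[OF lQ] by blast
  qed
  show ?thesis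
  proof (rule that[of "frontier Q"])
    show "connected (frontier Q)" by (rule Kc)
    show "G z = 0" if "z \<in> frontier Q" for z using zero that .
    show "\<exists>s. (x, s) \<in> frontier Q" if x: "x > c" for x
    proof -
      obtain a b where "(x, a) \<in> T" "(x, b) \<in> Q" using PT[OF x] AQ[of x] by blast
      then have "({x} \<times> UNIV) \<inter> frontier Q \<noteq> {}"
        using QT by (intro connected_Int_frontier) (auto intro!: connected_Times)
      then show ?thesis by auto
    qed
    show "\<exists>x s. (x, s) \<in> frontier Q \<and> \<bar>x - c\<bar> < d \<and> s \<le> s0" if d: "d > 0" for d s0
    proof -
      obtain a where a: "\<And>s. s \<le> a \<Longrightarrow> (c + d/2, s) \<in> T" using PT[of "c + d/2"] d by auto
      obtain b where b: "\<And>s. s \<le> b \<Longrightarrow> (c - d/2, s) \<in> Q" using BQ[of "c - d/2"] d by auto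
      \<comment> \<open>Low enough for the segment at height \<open>s\<close> to start in
        \<open>Q\<close> left of \<open>c\<close> and to end in \<open>T\<close> right of
        \<open>c\<close>.\<close>
      define s where "s = min s0 (min a b)"
      have "s \<le> a" "s \<le> b" by (auto simp: s_def)
      then have "(c + d/2, s) \<in> ({c - d/2..c + d/2} \<times> {s}) - Q" "(c - d/2, s) \<in> ({c - d/2..c + d/2} \<times> {s}) \<inter> Q"
        using QT a[of s] b[of s] d \<open>s \<le> a\<close> \<open>s \<le> b\<close> by auto
      then have "({c - d/2..c + d/2} \<times> {s}) \<inter> frontier Q \<noteq> {}"
        by (intro connected_Int_frontier) (blast intro: connected_Times convex_connected[OF convex_real_interval(5)] connected_sing)+
      then obtain x where "x \<in> {c - d/2..c + d/2}" "(x, s) \<in> frontier Q" by blast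
      then show ?thesis using d by (intro exI[of _ x] exI[of _ s]) (auto simp: s_def abs_less_iff)
    qed
  qed
qed

subsection \<open>The function \<open>Z\<close>\<close>

text \<open>A positive solution increasing on \<open>[-\<alpha>,\<alpha>]\<close> is, on \<open>[\<alpha>,1]\<close> and \<open>[-1,-\<alpha>]\<close>,
  \<open>2 ln (cosh p) - 2 ln (cosh (A (x - \<alpha>) / (1 - \<alpha>) - a))\<close> and
  \<open>2 ln (cosh q) - 2 ln (cosh (B (x + \<alpha>) / (1 - \<alpha>) - b))\<close>, with \<open>A = p + a\<close> and \<open>B = q - b\<close>.
  Equality of the slopes at \<open>\<plusminus>\<alpha>\<close> and the linear behaviour between them express \<open>b\<close>, \<open>B\<close>, \<open>q\<close>
  by \<open>p\<close> and \<open>a\<close>; the one remaining condition, that both sides have the same \<open>\<lambda>\<close>, is \<open>br_Z = 0\<close>.\<close>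

definition br_y :: "real \<Rightarrow> real \<Rightarrow> real \<Rightarrow> real" where
  "br_y k p a = k * (p + a) * tanh a"

definition br_b :: "real \<Rightarrow> real \<Rightarrow> real \<Rightarrow> real" where
  "br_b k p a = arsinh (exp (br_y k p a) * sinh a)"

definition br_r :: "real \<Rightarrow> real \<Rightarrow> real \<Rightarrow> real" where
  "br_r k p a = exp (- br_y k p a) * cosh (br_b k p a) / cosh a"

definition br_q :: "real \<Rightarrow> real \<Rightarrow> real \<Rightarrow> real" where
  "br_q k p a = (p + a) * br_r k p a + br_b k p a"

definition br_Z :: "real \<Rightarrow> real \<Rightarrow> real \<Rightarrow> real" where
  "br_Z k p a = - br_y k p a + ln (cosh (br_b k p a)) - ln (cosh a) + ln (cosh p) - ln (cosh (br_q k p a))"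

lemma br_zero: "br_y k p 0 = 0" "br_b k p 0 = 0" "br_r k p 0 = 1" "br_q k p 0 = p" "br_Z k p 0 = 0"
  by (simp_all add: br_y_def br_b_def br_r_def br_q_def br_Z_def)

lemma br_r_tanh:
  assumes "a > 0"
  shows "br_r k p a = tanh a / tanh (br_b k p a)"
proof -
  have "exp (- br_y k p a) = sinh a / sinh (br_b k p a)"
    using assms by (simp add: br_b_def exp_minus field_simps)
  then show ?thesis
    by (simp add: br_r_def tanh_def)
qed

lemma br_b_ge:
  assumes "k > 0" "p > 0" "a > 0"
  shows "br_y k p a > 0" "br_b k p a > a"
proof -
  show y: "br_y k p a > 0" using assms by (simp add: br_y_def)
  have "sinh a < exp (br_y k p a) * sinh a"
    using y assms by simp
  then have "arsinh (sinh a) < arsinh (exp (br_y k p a) * sinh a)"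
    by (subst arsinh_less_iff_real)
  then show "br_b k p a > a" unfolding br_b_def arsinh_sinh_real .
qed

lemma br_continuous [continuous_intros]:
  assumes "continuous_on S f" "continuous_on S g"
  shows "continuous_on S (\<lambda>z. br_y k (f z) (g z))" "continuous_on S (\<lambda>z. br_b k (f z) (g z))"
    "continuous_on S (\<lambda>z. br_r k (f z) (g z))" "continuous_on S (\<lambda>z. br_q k (f z) (g z))"
    "continuous_on S (\<lambda>z. br_Z k (f z) (g z))"
proof -
  show y: "continuous_on S (\<lambda>z. br_y k (f z) (g z))"
    unfolding br_y_def by (intro continuous_intros assms) auto
  then show b: "continuous_on S (\<lambda>z. br_b k (f z) (g z))"
    unfolding br_b_def
    by (intro continuous_on_compose2[OF continuous_on_arsinh[of UNIV]] continuous_intros assms) auto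
  show r: "continuous_on S (\<lambda>z. br_r k (f z) (g z))"
    unfolding br_r_def by (intro continuous_intros assms y b) auto
  show q: "continuous_on S (\<lambda>z. br_q k (f z) (g z))"
    unfolding br_q_def by (intro continuous_intros assms b r)
  show "continuous_on S (\<lambda>z. br_Z k (f z) (g z))"
    unfolding br_Z_def by (intro continuous_intros assms b y q) auto
qed

text \<open>The primed functions are derivatives in \<open>a\<close> at fixed \<open>p\<close>. The
  construction of the branch uses the joint continuity of \<open>br_Z'\<close> and its sign at
  \<open>a = 0\<close>.\<close>

definition br_y' where "br_y' k p a = k * tanh a + k * (p + a) * (1 - (tanh a)\<^sup>2)"
definition br_b' where "br_b' k p a = exp (br_y k p a) * (br_y' k p a * sinh a + cosh a) / cosh (br_b k p a)"
definition br_r' where "br_r' k p a = br_r k p a * (- br_y' k p a + tanh (br_b k p a) * br_b' k p a - tanh a)"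
definition br_q' where "br_q' k p a = br_r k p a + (p + a) * br_r' k p a + br_b' k p a"
definition br_Z' where "br_Z' k p a = - br_y' k p a + tanh (br_b k p a) * br_b' k p a - tanh a
  - tanh (br_q k p a) * br_q' k p a"

lemma br_y_deriv: "(br_y k p has_real_derivative br_y' k p a) (at a)"
  unfolding br_y_def[abs_def] br_y'_def
  by (auto intro!: derivative_eq_intros simp: algebra_simps)

lemma br_b_deriv: "(br_b k p has_real_derivative br_b' k p a) (at a)"
proof -
  have "((\<lambda>a. exp (br_y k p a) * sinh a) has_real_derivative
      exp (br_y k p a) * (br_y' k p a * sinh a + cosh a)) (at a)"
    by (rule derivative_eq_intros br_y_deriv refl | simp)+ (simp add: algebra_simps)
  from DERIV_chain2[OF arsinh_real_has_field_derivative this] show ?thesis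
    by (simp add: br_b_def[abs_def] br_b'_def[unfolded br_b_def] cosh_arsinh_real)
qed

lemma br_r_deriv: "(br_r k p has_real_derivative br_r' k p a) (at a)"
  unfolding br_r_def[abs_def] br_r'_def[unfolded br_r_def]
  by (rule derivative_eq_intros br_y_deriv br_b_deriv refl | simp)+
    (simp add: field_simps tanh_def power2_eq_square)

lemma br_q_deriv: "(br_q k p has_real_derivative br_q' k p a) (at a)"
  unfolding br_q_def[abs_def] br_q'_def
  by (rule derivative_eq_intros br_r_deriv br_b_deriv refl | simp)+

lemma br_Z_deriv: "(br_Z k p has_real_derivative br_Z' k p a) (at a)"
  unfolding br_Z_def[abs_def] br_Z'_def
  by (rule derivative_eq_intros br_y_deriv br_b_deriv br_q_deriv refl | simp)+
    (simp add: tanh_def field_simps)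

lemma br_Z'_continuous: "continuous_on UNIV (\<lambda>z. br_Z' k (fst z) (snd z))"
proof -
  have y: "continuous_on UNIV (\<lambda>z. br_y' k (fst z) (snd z))"
    unfolding br_y'_def by (intro continuous_intros) auto
  have b: "continuous_on UNIV (\<lambda>z. br_b' k (fst z) (snd z))"
    unfolding br_b'_def by (intro continuous_intros y) auto
  have r: "continuous_on UNIV (\<lambda>z. br_r' k (fst z) (snd z))"
    unfolding br_r'_def by (intro continuous_intros y b) auto
  show ?thesis
    unfolding br_Z'_def br_q'_def by (intro continuous_intros y b r) auto
qed

text \<open>As \<open>br_Z\<close> vanishes at \<open>a = 0\<close>, this first-order coefficient
  decides the sign of \<open>br_Z\<close> for small \<open>a > 0\<close>.\<close>

lemma br_Z'_0: "br_Z' k p 0 = k * p * (p * tanh p - 1) - 2 * tanh p"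
  by (simp add: br_Z'_def br_y'_def br_b'_def br_r'_def br_q'_def br_zero algebra_simps)

text \<open>At \<open>a = p\<close> the terms \<open>ln (cosh a)\<close> and
  \<open>ln (cosh p)\<close> cancel, and \<open>q - b = 2 p r > 0\<close> makes the rest
  negative.\<close>

lemma br_Z_diag:
  assumes "k > 0" "p > 0"
  shows "br_Z k p p < 0"
proof -
  note b = br_b_ge[OF assms assms(2)]
  have "br_r k p p > 0" using assms b by (simp add: br_r_tanh)
  then have "br_q k p p > br_b k p p" using assms by (simp add: br_q_def)
  then have "cosh (br_b k p p) < cosh (br_q k p p)"
    using assms b by (intro cosh_real_strict_mono) auto
  then have "ln (cosh (br_b k p p)) < ln (cosh (br_q k p p))" using ln_less_cancel_iff cosh_real_pos by blast
  then show ?thesis unfolding br_Z_def using b(1) by linarith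
qed

text \<open>Here \<open>y\<close> is varied from \<open>0\<close> to \<open>br_y k p a\<close> with \<open>A = p + a\<close> fixed.\<close>

lemma br_Z_neg_small:
  assumes "k > 0" "0 < p" "p \<le> 1/2" "0 < a" "a \<le> p"
  shows "br_Z k p a < 0"
proof -
  define A where "A = p + a"
  define b where "b y = arsinh (exp y * sinh a)" for y
  define R where "R y = exp (- y) * cosh (b y) / cosh a" for y
  \<comment> \<open>At \<open>y = br_y k p a\<close>, \<open>F\<close> equals
    \<open>br_Z k p a + ln (cosh a) - ln (cosh p)\<close>.\<close>
  define F where "F y = - y + ln (cosh (b y)) - ln (cosh (A * R y + b y))" for y
  have sb: "sinh (b y) = exp y * sinh a" for y by (simp add: b_def)
  have cb: "cosh (b y) = sqrt ((exp y * sinh a)\<^sup>2 + 1)" for y by (simp add: b_def cosh_arsinh_real)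
  have db: "(b has_real_derivative tanh (b y)) (at y)" for y
    unfolding tanh_def sb cb unfolding b_def[abs_def]
    by (rule DERIV_cong[OF DERIV_chain2[OF arsinh_real_has_field_derivative, where Db = "exp y * sinh a"]])
      (auto intro!: derivative_eq_intros)
  have dR: "(R has_real_derivative R y * ((tanh (b y))\<^sup>2 - 1)) (at y)" for y
    unfolding R_def[abs_def]
    by (rule derivative_eq_intros db refl | simp)+ (simp add: field_simps tanh_def power2_eq_square)
  define F' where "F' y = - 1 + (tanh (b y))\<^sup>2 - tanh (A * R y + b y) * (A * (R y * ((tanh (b y))\<^sup>2 - 1)) + tanh (b y))" for y
  have dF: "(F has_real_derivative F' y) (at y)" for y
    unfolding F_def[abs_def] F'_def
    by (rule derivative_eq_intros db dR refl | simp)+ (simp add: field_simps tanh_def power2_eq_square)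
  have F'neg: "F' y < 0" if "y > 0" for y
  proof -
    have "sinh a < exp y * sinh a" using that assms by simp
    then have "arsinh (sinh a) < b y" unfolding b_def by (subst arsinh_less_iff_real)
    then have ba: "b y > a" unfolding arsinh_sinh_real .
    have "R y = tanh a / tanh (b y)"
      using assms by (simp add: R_def tanh_def sb exp_minus field_simps)
    moreover have "0 < tanh a" "tanh a < tanh (b y)" using ba assms by auto
    ultimately have R: "0 < R y" "R y < 1" by simp_all
    \<comment> \<open>Here \<open>p \<le> 1/2\<close> enters: with \<open>a \<le> p\<close> it
      bounds \<open>A = p + a\<close> by \<open>1\<close>.\<close>
    have A: "0 < A" "A \<le> 1" using assms by (auto simp: A_def)
    have "A * R y < 1" using A R mult_le_less_imp_less[of A 1 "R y" 1] by auto
    moreover have "0 < tanh (A * R y + b y)" "tanh (A * R y + b y) < 1"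
      using add_pos_pos[OF mult_pos_pos[OF A(1) R(1)], of "b y"] ba assms by (auto simp: tanh_real_lt_1)
    ultimately have 1: "tanh (A * R y + b y) * (A * R y) < 1"
      using A R mult_strict_mono[of "tanh (A * R y + b y)" 1 "A * R y" 1] by auto
    have "F' y = - ((1 - (tanh (b y))\<^sup>2) * (1 - tanh (A * R y + b y) * (A * R y))) - tanh (A * R y + b y) * tanh (b y)"
      by (simp add: F'_def algebra_simps)
    moreover have "(1 - (tanh (b y))\<^sup>2) * (1 - tanh (A * R y + b y) * (A * R y)) > 0"
      using 1 tanh_sq_less_1 by (intro mult_pos_pos) auto
    moreover have "tanh (A * R y + b y) * tanh (b y) > 0"
      using add_pos_pos[OF mult_pos_pos[OF A(1) R(1)], of "b y"] ba assms by (intro mult_pos_pos) auto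
    ultimately show ?thesis by linarith
  qed
  have y: "br_y k p a > 0" using br_b_ge assms by simp
  have "F (br_y k p a) < F 0"
  proof (rule DERIV_neg_imp_decreasing_open[OF y])
    show "\<exists>d. (F has_real_derivative d) (at x) \<and> d < 0" if "0 < x" for x
      using dF F'neg[OF that] by blast
    show "continuous_on {0..br_y k p a} F"
      by (rule DERIV_continuous_on[of _ _ F'], rule has_field_derivative_at_within, rule dF)
  qed
  also have "F 0 = ln (cosh a) - ln (cosh (A + a))"
    by (simp add: F_def R_def b_def arsinh_sinh_real)
  also have "\<dots> \<le> ln (cosh a) - ln (cosh p)"
    using assms cosh_real_nonneg_le_iff[of p "A + a"] by (simp add: A_def)
  finally show ?thesis
    by (simp add: F_def R_def b_def br_Z_def br_q_def br_r_def br_b_def A_def)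
qed

subsection \<open>Piecewise smooth functions\<close>

lemma has_real_derivative_glue:
  fixes f g f' g' :: "real \<Rightarrow> real"
  assumes f: "\<And>x. (f has_real_derivative f' x) (at x)"
    and g: "\<And>x. (g has_real_derivative g' x) (at x)"
    and eq: "f c = g c" "f' c = g' c"
  shows "((\<lambda>x. if x \<le> c then f x else g x) has_real_derivative (if x \<le> c then f' x else g' x)) (at x)"
proof -
  have "((\<lambda>x. if x \<in> {..c} then f x else g x) has_vector_derivative (if x \<in> {..c} then f' x else g' x))
      (at x within UNIV)"
    by (rule has_vector_derivative_If_within_closures[where T = "{c..}"])
      (use eq f g in \<open>auto simp: has_real_derivative_iff_has_vector_derivative[symmetric]
        intro: has_field_derivative_at_within\<close>)
  then show ?thesis
    by (simp add: has_real_derivative_iff_has_vector_derivative)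
qed

definition piece3 :: "real \<Rightarrow> (real \<Rightarrow> real) \<Rightarrow> (real \<Rightarrow> real) \<Rightarrow> (real \<Rightarrow> real) \<Rightarrow> real \<Rightarrow> real" where
  "piece3 \<alpha> l m r x = (if x \<le> -\<alpha> then l x else if x \<le> \<alpha> then m x else r x)"

lemma piece3_deriv:
  assumes "0 < \<alpha>"
    and "\<And>x. (l has_real_derivative l' x) (at x)" "\<And>x. (m has_real_derivative m' x) (at x)"
      "\<And>x. (r has_real_derivative r' x) (at x)"
    and "l (-\<alpha>) = m (-\<alpha>)" "l' (-\<alpha>) = m' (-\<alpha>)" "m \<alpha> = r \<alpha>" "m' \<alpha> = r' \<alpha>"
  shows "(piece3 \<alpha> l m r has_real_derivative piece3 \<alpha> l' m' r' x) (at x)"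
proof -
  let ?g = "\<lambda>x. if x \<le> \<alpha> then m x else r x" and ?g' = "\<lambda>x. if x \<le> \<alpha> then m' x else r' x"
  have "(?g has_real_derivative ?g' x) (at x)" for x
    by (rule has_real_derivative_glue) (use assms in auto)
  then have "((\<lambda>x. if x \<le> -\<alpha> then l x else ?g x) has_real_derivative (if x \<le> -\<alpha> then l' x else ?g' x)) (at x)"
    by (rule has_real_derivative_glue[OF assms(2)]) (use assms in auto)
  then show ?thesis unfolding piece3_def[abs_def] .
qed

lemma piece3_eventually:
  assumes "x \<notin> {-\<alpha>, \<alpha>}" "0 < \<alpha>"
  shows "\<forall>\<^sub>F y in nhds x. piece3 \<alpha> l m r y = (if x < -\<alpha> then l y else if x < \<alpha> then m y else r y)"
proof -
  consider "x < -\<alpha>" | "-\<alpha> < x" "x < \<alpha>" | "\<alpha> < x" using assms by fastforce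
  then show ?thesis
  proof cases
    case 1
    then have "\<forall>\<^sub>F y in nhds x. y \<in> {..<-\<alpha>}" by (intro eventually_nhds_in_open) auto
    then show ?thesis by eventually_elim (use 1 in \<open>auto simp: piece3_def\<close>)
  next
    case 2
    then have "\<forall>\<^sub>F y in nhds x. y \<in> {-\<alpha><..<\<alpha>}" by (intro eventually_nhds_in_open) auto
    then show ?thesis by eventually_elim (use 2 in \<open>auto simp: piece3_def\<close>)
  next
    case 3
    then have "\<forall>\<^sub>F y in nhds x. y \<in> {\<alpha><..}" by (intro eventually_nhds_in_open) auto
    then show ?thesis by eventually_elim (use 3 assms in \<open>auto simp: piece3_def\<close>)
  qed
qed

lemma piece3_deriv_off:
  assumes "x \<notin> {-\<alpha>, \<alpha>}" "0 < \<alpha>"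
    and "\<And>x. (l has_real_derivative l' x) (at x)" "\<And>x. (m has_real_derivative m' x) (at x)"
      "\<And>x. (r has_real_derivative r' x) (at x)"
  shows "(piece3 \<alpha> l m r has_real_derivative piece3 \<alpha> l' m' r' x) (at x)"
proof -
  have "((\<lambda>y. if x < -\<alpha> then l y else if x < \<alpha> then m y else r y) has_real_derivative
      (if x < -\<alpha> then l' x else if x < \<alpha> then m' x else r' x)) (at x)"
    using assms by auto
  then have "(piece3 \<alpha> l m r has_real_derivative (if x < -\<alpha> then l' x else if x < \<alpha> then m' x else r' x)) (at x)"
    by (subst DERIV_cong_ev[OF refl piece3_eventually refl]) (use assms in auto)
  then show ?thesis using assms(1,2) by (auto simp: piece3_def split: if_splits)
qed

lemma piece3_isCont_off:
  assumes "x \<notin> {-\<alpha>, \<alpha>}" "0 < \<alpha>" "isCont l x" "isCont m x" "isCont r x"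
  shows "isCont (piece3 \<alpha> l m r) x"
  using assms
  by (subst isCont_cong[OF piece3_eventually]; (cases "x < -\<alpha>"; cases "x < \<alpha>")?) simp_all

text \<open>Common frame for the solutions of the boundary value problem and for the eigenfunctions:
  value and slope match at \<open>-\<alpha>\<close> and \<open>\<alpha>\<close>, while the second
  derivative may jump there. The pieces live on the whole line, so all derivatives are
  two-sided.\<close>

locale piecewise =
  fixes \<alpha> :: real and l m r l' m' r' l'' m'' r'' :: "real \<Rightarrow> real"
  assumes pos: "0 < \<alpha>"
    and d1: "\<And>x. (l has_real_derivative l' x) (at x)" "\<And>x. (m has_real_derivative m' x) (at x)"
      "\<And>x. (r has_real_derivative r' x) (at x)"
    and d2: "\<And>x. (l' has_real_derivative l'' x) (at x)" "\<And>x. (m' has_real_derivative m'' x) (at x)"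
      "\<And>x. (r' has_real_derivative r'' x) (at x)"
    and cont: "\<And>x. isCont l'' x" "\<And>x. isCont m'' x" "\<And>x. isCont r'' x"
    and match: "l (-\<alpha>) = m (-\<alpha>)" "l' (-\<alpha>) = m' (-\<alpha>)" "m \<alpha> = r \<alpha>" "m' \<alpha> = r' \<alpha>"
begin

lemma deriv1: "(piece3 \<alpha> l m r has_real_derivative piece3 \<alpha> l' m' r' x) (at x)"
  by (rule piece3_deriv[OF pos d1 match])

lemma cont1: "continuous_on S (piece3 \<alpha> l' m' r')"
proof -
  \<comment> \<open>Each piece is evaluated at a clamped argument; on each of the three intervals
    the two idle pieces contribute boundary values that cancel by \<open>match\<close>.\<close>
  have "continuous_on UNIV (\<lambda>x. l' (min (-\<alpha>) x) + m' (max (-\<alpha>) (min \<alpha> x)) + r' (max \<alpha> x) - l' (-\<alpha>) - r' \<alpha>)"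
    by (intro continuous_intros continuous_on_compose2[OF DERIV_continuous_on[of UNIV l' l'']]
      continuous_on_compose2[OF DERIV_continuous_on[of UNIV m' m'']]
      continuous_on_compose2[OF DERIV_continuous_on[of UNIV r' r'']])
      (use d2 in auto)
  also have "(\<lambda>x. l' (min (-\<alpha>) x) + m' (max (-\<alpha>) (min \<alpha> x)) + r' (max \<alpha> x) - l' (-\<alpha>) - r' \<alpha>) = piece3 \<alpha> l' m' r'"
    using pos match by (auto simp: fun_eq_iff piece3_def min_def max_def)
  finally show ?thesis by (rule continuous_on_subset) auto
qed

lemma C1: "C1_on S (piece3 \<alpha> l m r)"
  unfolding C1_on_def
  using cont1 deriv1 has_field_derivative_at_within by blast

lemma deriv2: "x \<notin> {-\<alpha>, \<alpha>} \<Longrightarrow> (piece3 \<alpha> l' m' r' has_real_derivative piece3 \<alpha> l'' m'' r'' x) (at x)"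
  by (rule piece3_deriv_off[OF _ pos d2])

lemma C2: "C2_on (S - {-\<alpha>, \<alpha>}) (piece3 \<alpha> l m r)"
  unfolding C2_on_def C1_on_def
proof (rule exI[of _ "piece3 \<alpha> l' m' r'"], rule conjI[rotated], rule exI[of _ "piece3 \<alpha> l'' m'' r''"],
    intro conjI ballI)
  show "continuous_on (S - {-\<alpha>, \<alpha>}) (piece3 \<alpha> l'' m'' r'')"
    by (intro continuous_at_imp_continuous_on ballI piece3_isCont_off cont pos) auto
qed (auto intro!: has_field_derivative_at_within deriv1 deriv2)

lemma deriv_deriv:
  "x \<notin> {-\<alpha>, \<alpha>} \<Longrightarrow> deriv (deriv (piece3 \<alpha> l m r)) x = piece3 \<alpha> l'' m'' r'' x"
proof -
  have "deriv (piece3 \<alpha> l m r) = piece3 \<alpha> l' m' r'"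
    using DERIV_imp_deriv[OF deriv1] by auto
  then show "x \<notin> {-\<alpha>, \<alpha>} \<Longrightarrow> ?thesis" using DERIV_imp_deriv[OF deriv2] by simp
qed

end

section \<open>Transfer to functions cut off outside [-1,1] and to the C1 norm\<close>

lemma has_real_derivative_within_cong:
  fixes u v :: "real \<Rightarrow> real"
  assumes "\<And>x. x \<in> S \<Longrightarrow> u x = v x" "x \<in> S" "(u has_real_derivative d) (at x within S)"
  shows "(v has_real_derivative d) (at x within S)"
  by (rule has_field_derivative_transform_within[OF assms(3) zero_less_one assms(2)]) (simp add: assms(1))

lemma C1_on_cong: "(\<And>x. x \<in> S \<Longrightarrow> u x = v x) \<Longrightarrow> C1_on S u \<Longrightarrow> C1_on S v"
  unfolding C1_on_def using has_real_derivative_within_cong[of S u v] by blast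

lemma C2_on_cong: "(\<And>x. x \<in> S \<Longrightarrow> u x = v x) \<Longrightarrow> C2_on S u \<Longrightarrow> C2_on S v"
  unfolding C2_on_def using has_real_derivative_within_cong[of S u v] by blast

text \<open>Elements of \<open>C10\<close> are cut off outside \<open>[-1,1]\<close>, the explicit
  formulas are not. The iterated derivative in the equation is local in the open interval and
  ignores the difference.\<close>

lemma is_solution_cong:
  assumes eq: "\<And>x. x \<in> {-1..1} \<Longrightarrow> u x = v x" and u: "is_solution \<alpha> l u"
  shows "is_solution \<alpha> l v"
  unfolding is_solution_def
proof (intro conjI ballI)
  show "C2_on ({-1..1} - {-\<alpha>, \<alpha>}) v" "C1_on {-1..1} v" "v (-1) = 0" "v 1 = 0"
    using u eq[of 1] eq[of "-1"] C1_on_cong[of "{-1..1}" u v] C2_on_cong[of "{-1..1} - {-\<alpha>, \<alpha>}" u v] eq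
    by (auto simp: is_solution_def)
  fix x :: real assume x: "x \<in> {-1<..<1} - {-\<alpha>, \<alpha>}"
  have ev: "\<forall>\<^sub>F y in nhds z. u y = v y" if "z \<in> {-1<..<1}" for z
    using eventually_nhds_in_open[OF open_greaterThanLessThan that] by eventually_elim (auto intro!: eq)
  have "\<forall>\<^sub>F y in nhds x. deriv u y = deriv v y"
    using eventually_nhds_in_open[OF open_greaterThanLessThan, of x "-1" 1]
    by (rule eventually_mono) (use x in \<open>auto intro!: deriv_cong_ev ev\<close>)
  then have "deriv (deriv u) x = deriv (deriv v) x" by (intro deriv_cong_ev) auto
  moreover have "u x = v x" using x by (intro eq) auto
  moreover have "deriv (deriv u) x + l * h x \<alpha> * exp (u x) = 0"
    using u x unfolding is_solution_def by blast
  ultimately show "deriv (deriv v) x + l * h x \<alpha> * exp (v x) = 0" by simp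
qed

text \<open>By compactness of \<open>[-1,1]\<close>, joint continuity of values and slopes in the
  parameter and \<open>x\<close> is uniform in \<open>x\<close>, which is continuity in the C1
  norm.\<close>

lemma continuous_on_C10:
  fixes F :: "'a :: topological_space \<Rightarrow> C10" and f f' :: "'a \<times> real \<Rightarrow> real"
  assumes F: "\<And>t x. t \<in> S \<Longrightarrow> x \<in> {-1..1} \<Longrightarrow> fun_of (F t) x = f (t, x)"
    and d: "\<And>t x. t \<in> S \<Longrightarrow> x \<in> {-1..1} \<Longrightarrow> deriv_I (fun_of (F t)) x = f' (t, x)"
    and cf: "continuous_on (S \<times> {-1..1}) f" and cf': "continuous_on (S \<times> {-1..1}) f'"
  shows "continuous_on S F"
  unfolding continuous_on_def
proof (intro ballI tendstoI)
  fix t0 and e :: real assume t0: "t0 \<in> S" and e: "e > 0"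
  have e3: "e / 3 > 0" using e by simp
  obtain X where X: "t0 \<in> X" "open X" "\<forall>t\<in>X \<inter> S. \<forall>x\<in>{-1..1}. dist (f (t, x)) (f (t0, x)) \<le> e / 3"
    by (rule continuous_on_prod_compactE[OF cf compact_Icc t0 e3]) (rule that)
  obtain Y where Y: "t0 \<in> Y" "open Y" "\<forall>t\<in>Y \<inter> S. \<forall>x\<in>{-1..1}. dist (f' (t, x)) (f' (t0, x)) \<le> e / 3"
    by (rule continuous_on_prod_compactE[OF cf' compact_Icc t0 e3]) (rule that)
  have "\<forall>\<^sub>F t in at t0 within S. t \<in> S \<and> t \<in> X \<inter> Y"
    using X(1,2) Y(1,2) unfolding eventually_at_topological by (intro exI[of _ "X \<inter> Y"]) auto
  then show "\<forall>\<^sub>F t in at t0 within S. dist (F t) (F t0) < e"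
  proof eventually_elim
    case (elim t)
    have "sup_norm (fun_of (F t - F t0)) \<le> e / 3"
      using elim X(3) t0 F by (intro sup_norm_least) (auto simp: dist_real_def)
    moreover have "sup_norm (deriv_I (fun_of (F t - F t0))) \<le> e / 3"
      using elim Y(3) t0 d by (intro sup_norm_least) (auto simp: dist_real_def deriv_I_minus simp del: fun_of_simps)
    ultimately show ?case using e by (simp add: dist_C10_def norm_C10_def)
  qed
qed

subsection \<open>Solutions from zeros of \<open>Z\<close>\<close>

text \<open>Equality of the slopes at both ends of the middle interval, in a form free of division
  and hence valid also at \<open>a = 0\<close>, where the even solutions sit.\<close>

lemma br_r_tanh_eq: "br_r k p a * tanh (br_b k p a) = tanh a"
  by (simp add: br_r_def tanh_def exp_minus field_simps) (simp add: br_b_def)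

lemma one_minus_tanh_square: "1 - (tanh z)\<^sup>2 = 1 / (cosh (z::real))\<^sup>2"
proof -
  have "(tanh z)\<^sup>2 = ((cosh z)\<^sup>2 - 1) / (cosh z)\<^sup>2"
    by (simp add: tanh_def power_divide cosh_square_eq)
  then show ?thesis by (simp add: diff_divide_distrib)
qed

text \<open>Together with \<open>bump_deriv2\<close>: the second derivative is
  \<open>-2 s\<^sup>2 / cosh\<^sup>2\<close>, proportional to the exponential of the function, so
  such a bump solves the equation where \<open>h = 1\<close>, for a suitable \<lambda>.\<close>

lemma bump_deriv1:
  "((\<lambda>x. c - 2 * ln (cosh (s * (x - x0) - t))) has_real_derivative - (2 * s * tanh (s * (x - x0) - t))) (at x)"
  by (rule derivative_eq_intros refl | simp)+ (simp add: tanh_def)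

lemma bump_deriv2:
  "((\<lambda>x. - (2 * s * tanh (s * (x - x0) - t))) has_real_derivative
      - (2 * s\<^sup>2 * (1 - (tanh (s * (x - x0) - t))\<^sup>2))) (at x)"
  by (rule derivative_eq_intros refl | simp)+ (simp add: power2_eq_square)

text \<open>The constant for which \<open>u(\<alpha>) - u(-\<alpha>) = 2 br_y\<close>.\<close>

definition br_k :: "real \<Rightarrow> real" where "br_k \<alpha> = 2 * \<alpha> / (1 - \<alpha>)"

text \<open>\<open>br_sl\<close> and \<open>br_sr\<close> are the rates
  \<open>B / (1 - \<alpha>)\<close> and \<open>A / (1 - \<alpha>)\<close> of the affine arguments of
  \<open>cosh\<close> on the left and right outer intervals.\<close>

definition br_sl :: "real \<Rightarrow> real \<Rightarrow> real \<Rightarrow> real" where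
  "br_sl \<alpha> p a = (p + a) * br_r (br_k \<alpha>) p a / (1 - \<alpha>)"

definition br_sr :: "real \<Rightarrow> real \<Rightarrow> real \<Rightarrow> real" where
  "br_sr \<alpha> p a = (p + a) / (1 - \<alpha>)"

definition br_left :: "real \<Rightarrow> real \<Rightarrow> real \<Rightarrow> real \<Rightarrow> real" where
  "br_left \<alpha> p a x = 2 * ln (cosh (br_q (br_k \<alpha>) p a)) - 2 * ln (cosh (br_sl \<alpha> p a * (x - - \<alpha>) - br_b (br_k \<alpha>) p a))"

definition br_right :: "real \<Rightarrow> real \<Rightarrow> real \<Rightarrow> real \<Rightarrow> real" where
  "br_right \<alpha> p a x = 2 * ln (cosh p) - 2 * ln (cosh (br_sr \<alpha> p a * (x - \<alpha>) - a))"

definition br_mid :: "real \<Rightarrow> real \<Rightarrow> real \<Rightarrow> real \<Rightarrow> real" where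
  "br_mid \<alpha> p a x = 2 * ln (cosh p) - 2 * ln (cosh a) + 2 * br_sr \<alpha> p a * tanh a * (x - \<alpha>)"

definition br_left' :: "real \<Rightarrow> real \<Rightarrow> real \<Rightarrow> real \<Rightarrow> real" where
  "br_left' \<alpha> p a x = - (2 * br_sl \<alpha> p a * tanh (br_sl \<alpha> p a * (x - - \<alpha>) - br_b (br_k \<alpha>) p a))"

definition br_right' :: "real \<Rightarrow> real \<Rightarrow> real \<Rightarrow> real \<Rightarrow> real" where
  "br_right' \<alpha> p a x = - (2 * br_sr \<alpha> p a * tanh (br_sr \<alpha> p a * (x - \<alpha>) - a))"

definition br_u :: "real \<Rightarrow> real \<Rightarrow> real \<Rightarrow> real \<Rightarrow> real" where
  "br_u \<alpha> p a = piece3 \<alpha> (br_left \<alpha> p a) (br_mid \<alpha> p a) (br_right \<alpha> p a)"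

definition br_u' :: "real \<Rightarrow> real \<Rightarrow> real \<Rightarrow> real \<Rightarrow> real" where
  "br_u' \<alpha> p a = piece3 \<alpha> (br_left' \<alpha> p a) (\<lambda>x. 2 * br_sr \<alpha> p a * tanh a) (br_right' \<alpha> p a)"

definition br_C10 :: "real \<Rightarrow> real \<Rightarrow> real \<Rightarrow> C10" where
  "br_C10 \<alpha> p a = Abs_C10 (\<lambda>x. if x \<in> {-1..1} then br_u \<alpha> p a x else 0)"

text \<open>Read off on \<open>[\<alpha>,1]\<close>, where
  \<open>u'' = -2 sr\<^sup>2 / cosh\<^sup>2\<close> and
  \<open>exp u = (cosh p)\<^sup>2 / cosh\<^sup>2\<close> with the same argument.\<close>

definition br_lam :: "real \<Rightarrow> real \<Rightarrow> real \<Rightarrow> real" where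
  "br_lam \<alpha> p a = 2 * (br_sr \<alpha> p a)\<^sup>2 / (cosh p)\<^sup>2"

locale branch_point =
  fixes \<alpha> p a :: real
  assumes \<alpha>: "0 < \<alpha>" "\<alpha> < 1" and p: "0 < p" and a: "0 \<le> a" "a < p"
    and Z: "br_Z (br_k \<alpha>) p a = 0"
begin

abbreviation "y \<equiv> br_y (br_k \<alpha>) p a"
abbreviation "b \<equiv> br_b (br_k \<alpha>) p a"
abbreviation "q \<equiv> br_q (br_k \<alpha>) p a"
abbreviation "r \<equiv> br_r (br_k \<alpha>) p a"
abbreviation "sl \<equiv> br_sl \<alpha> p a"
abbreviation "sr \<equiv> br_sr \<alpha> p a"

lemma k_pos: "br_k \<alpha> > 0" using \<alpha> by (simp add: br_k_def)

lemma b_nonneg: "b \<ge> 0"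
proof -
  have "sinh b \<ge> 0" using a by (simp add: br_b_def)
  then show ?thesis by simp
qed
lemma r_pos: "r > 0" by (simp add: br_r_def)
lemma sr_pos: "sr > 0" using p a \<alpha> by (simp add: br_sr_def)
lemma sl_eq: "sl = sr * r" by (simp add: br_sl_def br_sr_def)
lemma sl_pos: "sl > 0" using sr_pos r_pos by (simp add: sl_eq)

lemma y_eq: "2 * sr * tanh a * (2 * \<alpha>) = 2 * y"
  by (simp add: br_sr_def br_y_def br_k_def)

lemma Z_eq: "ln (cosh q) - ln (cosh b) = ln (cosh p) - ln (cosh a) - y"
  using Z by (simp add: br_Z_def)

text \<open>The exponential form of \<open>br_Z = 0\<close>. It gives
  \<open>sl / cosh q = sr / cosh p\<close>, so that the equation holds on the left with the same
  \<lambda> as on the right.\<close>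

lemma cosh_q: "cosh q = r * cosh p"
proof -
  have "cosh q = exp (ln (cosh q))" by simp
  also have "ln (cosh q) = - y + ln (cosh b) - ln (cosh a) + ln (cosh p)" using Z by (simp add: br_Z_def)
  also have "exp \<dots> = r * cosh p" by (simp add: exp_add exp_diff br_r_def exp_minus divide_inverse)
  finally show ?thesis .
qed

sublocale piecewise \<alpha> "br_left \<alpha> p a" "br_mid \<alpha> p a" "br_right \<alpha> p a"
  "br_left' \<alpha> p a" "\<lambda>x. 2 * sr * tanh a" "br_right' \<alpha> p a"
  "\<lambda>x. - (2 * sl\<^sup>2 * (1 - (tanh (sl * (x - - \<alpha>) - b))\<^sup>2))" "\<lambda>x. 0"
  "\<lambda>x. - (2 * sr\<^sup>2 * (1 - (tanh (sr * (x - \<alpha>) - a))\<^sup>2))"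
proof
  show "(br_left \<alpha> p a has_real_derivative br_left' \<alpha> p a x) (at x)" for x
    unfolding br_left_def[abs_def] br_left'_def by (rule bump_deriv1)
  show "(br_right \<alpha> p a has_real_derivative br_right' \<alpha> p a x) (at x)" for x
    unfolding br_right_def[abs_def] br_right'_def by (rule bump_deriv1)
  show "(br_mid \<alpha> p a has_real_derivative 2 * sr * tanh a) (at x)" for x
    unfolding br_mid_def[abs_def] by (auto intro!: derivative_eq_intros)
  show "(br_left' \<alpha> p a has_real_derivative - (2 * sl\<^sup>2 * (1 - (tanh (sl * (x - - \<alpha>) - b))\<^sup>2))) (at x)" for x
    unfolding br_left'_def[abs_def] by (rule bump_deriv2)
  show "(br_right' \<alpha> p a has_real_derivative - (2 * sr\<^sup>2 * (1 - (tanh (sr * (x - \<alpha>) - a))\<^sup>2))) (at x)" for x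
    unfolding br_right'_def[abs_def] by (rule bump_deriv2)
  \<comment> \<open>The middle piece rises by \<open>2 * y\<close>; that the left bump meets its
    lower end is the condition \<open>br_Z = 0\<close>.\<close>
  show "br_left \<alpha> p a (- \<alpha>) = br_mid \<alpha> p a (- \<alpha>)"
    using Z_eq y_eq by (simp add: br_left_def br_mid_def algebra_simps)
  show "br_left' \<alpha> p a (- \<alpha>) = 2 * sr * tanh a"
    using br_r_tanh_eq[of "br_k \<alpha>" p a] by (simp add: br_left'_def sl_eq)
  show "br_mid \<alpha> p a \<alpha> = br_right \<alpha> p a \<alpha>" "2 * sr * tanh a = br_right' \<alpha> p a \<alpha>"
    by (simp_all add: br_mid_def br_right_def br_right'_def)
qed (use \<alpha> in \<open>auto intro!: continuous_intros\<close>)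

lemma u_1: "br_u \<alpha> p a 1 = 0"
proof -
  have "sr * (1 - \<alpha>) - a = p" using \<alpha> by (simp add: br_sr_def)
  then show ?thesis using \<alpha> by (simp add: br_u_def piece3_def br_right_def)
qed

lemma u_m1: "br_u \<alpha> p a (-1) = 0"
proof -
  have "sl * (-1 - - \<alpha>) = - ((p + a) * r)" using \<alpha> by (simp add: br_sl_def field_simps)
  then have "sl * (-1 - - \<alpha>) - b = - q" by (simp add: br_q_def)
  then show ?thesis using \<alpha> by (simp add: br_u_def piece3_def br_left_def)
qed

lemma fun_of_br: "fun_of (br_C10 \<alpha> p a) = (\<lambda>x. if x \<in> {-1..1} then br_u \<alpha> p a x else 0)"
  unfolding br_C10_def
proof (rule Abs_C10_inverse, intro CollectI conjI allI impI)
  show "C1_on {-1..1} (\<lambda>x. if x \<in> {-1..1} then br_u \<alpha> p a x else 0)"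
    by (rule C1_on_cong[OF _ C1]) (simp add: br_u_def)
qed (use u_1 u_m1 in auto)

lemma exp_bump: "exp (2 * ln (cosh c) - 2 * ln (cosh z)) = (cosh c)\<^sup>2 * (1 - (tanh z)\<^sup>2)" for c z :: real
  by (simp add: one_minus_tanh_square exp_diff exp_double)

lemma is_solution: "is_solution \<alpha> (br_lam \<alpha> p a) (fun_of (br_C10 \<alpha> p a))"
proof (rule is_solution_cong[of "br_u \<alpha> p a"])
  show "is_solution \<alpha> (br_lam \<alpha> p a) (br_u \<alpha> p a)"
    unfolding is_solution_def
  proof (intro conjI ballI)
    show "C2_on ({-1..1} - {-\<alpha>, \<alpha>}) (br_u \<alpha> p a)" "C1_on {-1..1} (br_u \<alpha> p a)"
      unfolding br_u_def by (rule C2 C1)+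
    fix x assume x: "x \<in> {-1<..<1} - {-\<alpha>, \<alpha>}"
    consider "x < -\<alpha>" | "-\<alpha> < x" "x < \<alpha>" | "\<alpha> < x" using x by fastforce
    then show "deriv (deriv (br_u \<alpha> p a)) x + br_lam \<alpha> p a * h x \<alpha> * exp (br_u \<alpha> p a x) = 0"
    proof cases
      case 1
      then have "h x \<alpha> = 1" by (simp add: h_def)
      moreover have "br_lam \<alpha> p a * exp (br_u \<alpha> p a x) = 2 * sl\<^sup>2 * (1 - (tanh (sl * (x - - \<alpha>) - b))\<^sup>2)"
      proof -
        have "br_u \<alpha> p a x = 2 * ln (cosh q) - 2 * ln (cosh (sl * (x - - \<alpha>) - b))"
          using 1 by (simp add: br_u_def piece3_def br_left_def)
        then have e: "exp (br_u \<alpha> p a x) = (r * cosh p)\<^sup>2 * (1 - (tanh (sl * (x - - \<alpha>) - b))\<^sup>2)"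
          by (simp only: exp_bump cosh_q[symmetric])
        show ?thesis unfolding e br_lam_def sl_eq by (simp add: power_mult_distrib)
      qed
      ultimately show ?thesis using 1 x unfolding br_u_def by (subst deriv_deriv) (auto simp: piece3_def)
    next
      case 2
      then have "h x \<alpha> = 0" by (auto simp: h_def)
      then show ?thesis using 2 x unfolding br_u_def by (subst deriv_deriv) (auto simp: piece3_def)
    next
      case 3
      then have "h x \<alpha> = 1" by (simp add: h_def)
      moreover have "br_lam \<alpha> p a * exp (br_u \<alpha> p a x) = 2 * sr\<^sup>2 * (1 - (tanh (sr * (x - \<alpha>) - a))\<^sup>2)"
        using 3 \<alpha> by (simp add: br_u_def piece3_def br_right_def exp_bump br_lam_def)
      ultimately show ?thesis using 3 x \<alpha> unfolding br_u_def by (subst deriv_deriv) (auto simp: piece3_def)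
    qed
  qed (auto simp: u_1 u_m1)
qed (simp add: fun_of_br)

text \<open>The rise over the middle interval, positive for \<open>a > 0\<close>, is what rules out
  evenness.\<close>

lemma u_sym_diff: "br_u \<alpha> p a \<alpha> - br_u \<alpha> p a (-\<alpha>) = 2 * y"
  using match \<alpha> y_eq by (simp add: br_u_def piece3_def) (simp add: br_mid_def algebra_simps)

text \<open>The argument of \<open>cosh\<close> runs from \<open>-a\<close> up to \<open>p\<close>,
  and \<open>a < p\<close> keeps its modulus below \<open>p\<close> before
  \<open>x = 1\<close>.\<close>

lemma right_pos: "\<alpha> \<le> x \<Longrightarrow> x < 1 \<Longrightarrow> br_right \<alpha> p a x > 0"
proof -
  assume x: "\<alpha> \<le> x" "x < 1"
  have "sr * (x - \<alpha>) - a < sr * (1 - \<alpha>) - a" using sr_pos x by simp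
  also have "\<dots> = p" using \<alpha> by (simp add: br_sr_def)
  finally have "\<bar>sr * (x - \<alpha>) - a\<bar> < p"
    using mult_nonneg_nonneg[of sr "x - \<alpha>"] sr_pos x a p by linarith
  then have "cosh \<bar>sr * (x - \<alpha>) - a\<bar> < cosh p"
    by (subst cosh_real_nonneg_less_iff) auto
  then show ?thesis by (simp add: br_right_def)
qed

text \<open>The argument of \<open>cosh\<close> stays in \<open>(-q, -b]\<close> with
  \<open>b \<ge> 0\<close>, so the left bump is still on its rising side.\<close>

lemma left_bounds: "-1 < x \<Longrightarrow> x \<le> -\<alpha> \<Longrightarrow> br_left \<alpha> p a x > 0 \<and> br_left \<alpha> p a x \<le> br_left \<alpha> p a (-\<alpha>)"
proof -
  assume x: "-1 < x" "x \<le> -\<alpha>"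
  have "sl * (x - - \<alpha>) > sl * (-1 - - \<alpha>)" using sl_pos x by simp
  moreover have "sl * (-1 - - \<alpha>) - b = - q" using \<alpha> by (simp add: br_sl_def br_q_def field_simps)
  ultimately have 1: "sl * (x - - \<alpha>) - b > - q" by linarith
  have 2: "sl * (x - - \<alpha>) - b \<le> - b" using sl_pos x mult_nonneg_nonpos[of sl "x - - \<alpha>"] by simp
  then have 3: "\<bar>sl * (x - - \<alpha>) - b\<bar> = - (sl * (x - - \<alpha>) - b)" using b_nonneg by simp
  have "cosh \<bar>sl * (x - - \<alpha>) - b\<bar> < cosh q" "cosh b \<le> cosh \<bar>sl * (x - - \<alpha>) - b\<bar>"
    using 1 2 b_nonneg unfolding 3
    by (subst cosh_real_nonneg_less_iff cosh_real_nonneg_le_iff; linarith)+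
  then show ?thesis by (simp add: br_left_def)
qed

lemma mid_between: "-\<alpha> \<le> x \<Longrightarrow> x \<le> \<alpha> \<Longrightarrow> br_mid \<alpha> p a (-\<alpha>) \<le> br_mid \<alpha> p a x \<and> br_mid \<alpha> p a x \<le> br_mid \<alpha> p a \<alpha>"
  using sr_pos a by (auto simp only: br_mid_def intro!: add_left_mono mult_left_mono mult_nonneg_nonneg) auto

lemma u_pos: "-1 < x \<Longrightarrow> x < 1 \<Longrightarrow> br_u \<alpha> p a x > 0"
  using right_pos[of x] left_bounds[of x] left_bounds[of "-\<alpha>"] mid_between[of x] match \<alpha>
  by (auto simp: br_u_def piece3_def split: if_splits)

lemma u_le: "-1 \<le> x \<Longrightarrow> x \<le> 1 \<Longrightarrow> br_u \<alpha> p a x \<le> 2 * ln (cosh p)"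
proof -
  assume x: "-1 \<le> x" "x \<le> 1"
  have R: "br_right \<alpha> p a z \<le> 2 * ln (cosh p)" for z
    by (simp add: br_right_def cosh_real_ge_1)
  have "0 \<le> ln (cosh p)" by (simp add: cosh_real_ge_1)
  then show ?thesis
    using R[of x] R[of \<alpha>] left_bounds[of x] mid_between[of x] mid_between[of "-\<alpha>"] match \<alpha> x u_m1
    by (cases "x = -1") (auto simp: br_u_def piece3_def split: if_splits)
qed

lemma sup_norm_br: "sup_norm (fun_of (br_C10 \<alpha> p a)) = 2 * ln (cosh p)"
proof (rule antisym)
  show "sup_norm (fun_of (br_C10 \<alpha> p a)) \<le> 2 * ln (cosh p)"
  proof (rule sup_norm_least)
    fix x :: real assume x: "x \<in> {-1..1}"
    have "br_u \<alpha> p a x \<ge> 0" using u_pos[of x] u_1 u_m1 x by (cases "x = 1"; cases "x = -1") auto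
    then show "\<bar>fun_of (br_C10 \<alpha> p a) x\<bar> \<le> 2 * ln (cosh p)" using u_le[of x] x by (simp add: fun_of_br)
  qed
  \<comment> \<open>The peak of the right bump, where the argument of \<open>cosh\<close> is zero;
    \<open>a < p\<close> places it before \<open>1\<close>.\<close>
  define x where "x = \<alpha> + a / sr"
  have "a / sr < 1 - \<alpha>" using a p \<alpha> by (simp add: br_sr_def field_simps)
  then have x: "\<alpha> \<le> x" "x \<le> 1" using a sr_pos by (auto simp: x_def)
  have "br_right \<alpha> p a x = 2 * ln (cosh p)" using sr_pos by (simp add: br_right_def x_def)
  then have "br_u \<alpha> p a x = 2 * ln (cosh p)" using x \<alpha> match by (auto simp: br_u_def piece3_def)
  then show "2 * ln (cosh p) \<le> sup_norm (fun_of (br_C10 \<alpha> p a))"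
    using sup_norm_upper[OF fun_of_cont, of x "br_C10 \<alpha> p a"] x \<alpha> by (simp add: fun_of_br)
qed

lemma positive: "is_positive (fun_of (br_C10 \<alpha> p a))"
  using u_pos by (auto simp: is_positive_def fun_of_br)

lemma not_even: "a > 0 \<Longrightarrow> \<not> is_even (fun_of (br_C10 \<alpha> p a))"
proof
  assume "a > 0" "is_even (fun_of (br_C10 \<alpha> p a))"
  then have "br_u \<alpha> p a (-\<alpha>) = br_u \<alpha> p a \<alpha>" using \<alpha> by (auto simp: is_even_def fun_of_br split: if_splits)
  moreover have "y > 0" using \<open>a > 0\<close> p k_pos by (simp add: br_y_def)
  ultimately show False using u_sym_diff by simp
qed

lemma deriv_I_br: "x \<in> {-1..1} \<Longrightarrow> deriv_I (fun_of (br_C10 \<alpha> p a)) x = br_u' \<alpha> p a x"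
  unfolding br_u'_def
  by (rule deriv_I_eq, assumption, rule has_real_derivative_within_cong[OF _ _ has_field_derivative_at_within[OF deriv1]])
    (auto simp: fun_of_br br_u_def)

text \<open>Free of case distinctions, so that joint continuity in \<open>p\<close>,
  \<open>a\<close> and \<open>x\<close> can be read off; \<open>u'_clamp\<close> serves the
  derivative in the same way.\<close>

lemma u_clamp: "br_u \<alpha> p a x = br_left \<alpha> p a (min (-\<alpha>) x) + br_mid \<alpha> p a (max (-\<alpha>) (min \<alpha> x))
    + br_right \<alpha> p a (max \<alpha> x) - br_mid \<alpha> p a (-\<alpha>) - br_mid \<alpha> p a \<alpha>"
  using match \<alpha> by (auto simp: br_u_def piece3_def min_def max_def)

lemma u'_clamp: "br_u' \<alpha> p a x = br_left' \<alpha> p a (min (-\<alpha>) x) + br_right' \<alpha> p a (max \<alpha> x) - 2 * sr * tanh a"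
  using match \<alpha> by (auto simp: br_u'_def piece3_def min_def max_def)

end

section \<open>The even solutions under the substitution
  \<open>\<beta> = 2 * ln (cosh p)\<close>\<close>

lemma artanh_beta:
  assumes "p > 0"
  shows "sqrt (1 - exp (- (2 * ln (cosh p)))) = tanh p"
proof -
  have "exp (- (2 * ln (cosh p))) = 1 / (cosh p)\<^sup>2"
    by (simp add: exp_minus exp_double inverse_eq_divide)
  also have "\<dots> = 1 - (tanh p)\<^sup>2"
    using one_minus_tanh_square[of p] by simp
  finally show ?thesis using assms by simp
qed

lemma \<eta>_beta: "p > 0 \<Longrightarrow> \<eta> (2 * ln (cosh p)) = sqrt 2 * p"
  by (simp add: \<eta>_def artanh_beta artanh_tanh_real)

lemma \<Lambda>_beta: "p > 0 \<Longrightarrow> \<Lambda> \<alpha> (2 * ln (cosh p)) = 2 * (p / (1 - \<alpha>))\<^sup>2 / (cosh p)\<^sup>2"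
  by (simp add: \<Lambda>_def \<eta>_beta exp_minus exp_double power_mult_distrib power_divide field_simps)

lemma branch_point_0: "0 < \<alpha> \<Longrightarrow> \<alpha> < 1 \<Longrightarrow> 0 < p \<Longrightarrow> branch_point \<alpha> p 0"
  by unfold_locales (auto simp: br_zero)

lemma br_C10_0:
  assumes "0 < \<alpha>" "\<alpha> < 1" "0 < p"
  shows "br_C10 \<alpha> p 0 = U_C10 \<alpha> (2 * ln (cosh p))"
proof (rule C10_eqI)
  interpret branch_point \<alpha> p 0 by (rule branch_point_0[OF assms])
  have pos: "2 * ln (cosh p) > 0" using cosh_real_nonneg_less_iff[of 0 p] assms by simp
  have w: "w (sqrt 2 * z) = - 2 * ln (cosh z)" for z
    by (simp add: w_def one_minus_tanh_square ln_div ln_realpow)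
  have wd: "w (sqrt 2 * p * z / (1 - \<alpha>)) = - 2 * ln (cosh (p / (1 - \<alpha>) * z))" for z
    using w[of "p / (1 - \<alpha>) * z"] by (simp add: mult.assoc)
  fix x
  consider "x < -1" | "-1 \<le> x" "x \<le> -\<alpha>" | "-\<alpha> < x" "x < \<alpha>" | "\<alpha> \<le> x" "x \<le> 1" | "1 < x"
    by linarith
  then show "fun_of (br_C10 \<alpha> p 0) x = fun_of (U_C10 \<alpha> (2 * ln (cosh p))) x"
  proof cases
    case 2
    have "cosh (p / (1 - \<alpha>) * (- x - \<alpha>)) = cosh (p / (1 - \<alpha>) * (x - - \<alpha>))"
    proof -
      have "- x - \<alpha> = - (x - - \<alpha>)" by simp
      then show ?thesis by (simp only: mult_minus_right cosh_minus)
    qed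
    then show ?thesis
      using 2 assms by (simp add: fun_of_br fun_of_U_C10[OF assms(1,2) pos] U_def br_u_def piece3_def \<eta>_beta wd
          br_left_def br_zero br_sl_def)
  next
    case 4
    then have "br_u \<alpha> p 0 x = br_right \<alpha> p 0 x" using assms match by (auto simp: br_u_def piece3_def)
    then show ?thesis
      using 4 assms by (simp add: fun_of_br fun_of_U_C10[OF assms(1,2) pos] U_def \<eta>_beta wd br_right_def br_sr_def)
  qed (use assms in \<open>auto simp: fun_of_br fun_of_U_C10[OF assms(1,2) pos] U_def br_u_def piece3_def br_mid_def\<close>)
qed

lemma br_lam_0: "p > 0 \<Longrightarrow> br_lam \<alpha> p 0 = \<Lambda> \<alpha> (2 * ln (cosh p))"
  by (simp add: \<Lambda>_beta br_lam_def br_sr_def)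

text \<open>For \<open>0 \<le> a < p\<close>, the rate \<open>(p + a) / (1 - \<alpha>)\<close> is at
  least \<open>p / (1 - \<alpha>)\<close> and less than its double; squaring gives the factors
  \<open>1\<close> and \<open>4\<close>.\<close>

lemma br_lam_bounds:
  assumes "0 < \<alpha>" "\<alpha> < 1" "0 < p" "0 \<le> a" "a < p"
  shows "\<Lambda> \<alpha> (2 * ln (cosh p)) \<le> br_lam \<alpha> p a" "br_lam \<alpha> p a < 4 * \<Lambda> \<alpha> (2 * ln (cosh p))"
proof -
  have "(p / (1 - \<alpha>))\<^sup>2 \<le> (br_sr \<alpha> p a)\<^sup>2"
    using assms by (intro power_mono) (auto simp: br_sr_def divide_right_mono)
  then show "\<Lambda> \<alpha> (2 * ln (cosh p)) \<le> br_lam \<alpha> p a"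
    using assms by (simp add: \<Lambda>_beta br_lam_def divide_right_mono)
  have "(br_sr \<alpha> p a)\<^sup>2 < (2 * (p / (1 - \<alpha>)))\<^sup>2"
    using assms by (intro power_strict_mono) (auto simp: br_sr_def divide_strict_right_mono)
  also have "\<dots> = 4 * (p / (1 - \<alpha>))\<^sup>2" by (simp only: power_mult_distrib) simp
  finally show "br_lam \<alpha> p a < 4 * \<Lambda> \<alpha> (2 * ln (cosh p))"
    using assms by (simp add: \<Lambda>_beta br_lam_def divide_strict_right_mono)
qed

lemma br_continuous_on:
  assumes \<alpha>: "0 < \<alpha>" "\<alpha> < 1"
  shows "continuous_on {z. branch_point \<alpha> (fst z) (snd z)} (\<lambda>z. (br_lam \<alpha> (fst z) (snd z), br_C10 \<alpha> (fst z) (snd z)))"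
    (is "continuous_on ?S _")
proof (intro continuous_on_Pair)
  show "continuous_on ?S (\<lambda>z. br_lam \<alpha> (fst z) (snd z))"
    unfolding br_lam_def br_sr_def by (intro continuous_intros) (use \<alpha> in auto)
  let ?f = "\<lambda>w. let p = fst (fst w); a = snd (fst w); x = snd w in
    br_left \<alpha> p a (min (-\<alpha>) x) + br_mid \<alpha> p a (max (-\<alpha>) (min \<alpha> x))
    + br_right \<alpha> p a (max \<alpha> x) - br_mid \<alpha> p a (-\<alpha>) - br_mid \<alpha> p a \<alpha>"
  let ?f' = "\<lambda>w. let p = fst (fst w); a = snd (fst w); x = snd w in
    br_left' \<alpha> p a (min (-\<alpha>) x) + br_right' \<alpha> p a (max \<alpha> x) - 2 * br_sr \<alpha> p a * tanh a"
  show "continuous_on ?S (\<lambda>z. br_C10 \<alpha> (fst z) (snd z))"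
  proof (rule continuous_on_C10[where f = ?f and f' = ?f'])
    show "fun_of (br_C10 \<alpha> (fst t) (snd t)) x = ?f (t, x)" if "t \<in> ?S" "x \<in> {-1..1}" for t x
      using that branch_point.fun_of_br branch_point.u_clamp by (simp add: Let_def)
    show "deriv_I (fun_of (br_C10 \<alpha> (fst t) (snd t))) x = ?f' (t, x)" if "t \<in> ?S" "x \<in> {-1..1}" for t x
      using that branch_point.deriv_I_br branch_point.u'_clamp by (simp add: Let_def)
    show "continuous_on (?S \<times> {-1..1}) ?f"
      unfolding Let_def br_left_def br_right_def br_mid_def br_sl_def br_sr_def
      by (intro continuous_intros) (use \<alpha> in auto)
    show "continuous_on (?S \<times> {-1..1}) ?f'"
      unfolding Let_def br_left'_def br_right'_def br_sl_def br_sr_def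
      by (intro continuous_intros) (use \<alpha> in auto)
  qed
qed

subsection \<open>The branch of non-even solutions\<close>

lemma open_prod_box:
  fixes f :: "real \<times> real \<Rightarrow> real"
  assumes "continuous_on UNIV f" "f (x0, y0) > 0"
  obtains d where "d > 0" "\<And>x y. \<bar>x - x0\<bar> < d \<Longrightarrow> \<bar>y - y0\<bar> < d \<Longrightarrow> f (x, y) > 0"
proof -
  have "open {z. f z > 0}" by (intro open_Collect_less assms continuous_on_const)
  then obtain A B where AB: "open A" "open B" "x0 \<in> A" "y0 \<in> B" "A \<times> B \<subseteq> {z. f z > 0}"
    by (rule open_prod_elim[of _ "(x0, y0)"]) (use assms(2) in auto)
  obtain e1 e2 where e: "e1 > 0" "ball x0 e1 \<subseteq> A" "e2 > 0" "ball y0 e2 \<subseteq> B"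
    using AB open_contains_ball by metis
  show ?thesis
  proof (rule that[of "min e1 e2"])
    fix x y assume "\<bar>x - x0\<bar> < min e1 e2" "\<bar>y - y0\<bar> < min e1 e2"
    then have "x \<in> A" "y \<in> B" using e by (auto simp: dist_real_def abs_minus_commute subset_eq)
    then show "f (x, y) > 0" using AB(5) by auto
  qed (use e in auto)
qed

text \<open>By joint continuity \<open>\<sigma> * br_Z'\<close> stays positive in a box around
  \<open>(p0, 0)\<close>, and \<open>br_Z\<close> vanishes at \<open>a = 0\<close>; monotonicity in
  \<open>a\<close> does the rest. The factor \<open>\<sigma>\<close> lets one statement serve both
  signs.\<close>

lemma br_Z_sign:
  assumes "\<sigma> * br_Z' k p0 0 > 0"
  obtains d where "d > 0" "\<And>p a. \<bar>p - p0\<bar> < d \<Longrightarrow> 0 < a \<Longrightarrow> a < d \<Longrightarrow> \<sigma> * br_Z k p a > 0"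
proof -
  have "continuous_on UNIV (\<lambda>z. \<sigma> * br_Z' k (fst z) (snd z))"
    by (intro continuous_intros br_Z'_continuous)
  then obtain d where d: "d > 0" "\<And>p a. \<bar>p - p0\<bar> < d \<Longrightarrow> \<bar>a\<bar> < d \<Longrightarrow> \<sigma> * br_Z' k p a > 0"
    using open_prod_box[of "\<lambda>z. \<sigma> * br_Z' k (fst z) (snd z)" p0 0] assms by auto
  show ?thesis
  proof (rule that[OF d(1)])
    fix p a assume pa: "\<bar>p - p0\<bar> < d" "0 < a" "a < d"
    have D: "((\<lambda>a. \<sigma> * br_Z k p a) has_real_derivative \<sigma> * br_Z' k p a) (at a)" for a
      by (intro DERIV_cmult br_Z_deriv)
    have "\<sigma> * br_Z k p 0 < \<sigma> * br_Z k p a"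
      by (rule DERIV_pos_imp_increasing[OF pa(2)]) (use D d(2)[OF pa(1)] pa in fastforce)
    then show "\<sigma> * br_Z k p a > 0" by (simp add: br_zero)
  qed
qed

text \<open>The logistic function turns a height \<open>s\<close> on the real line into the ratio
  \<open>a / p\<close> in \<open>(0,1)\<close>; the lower end corresponds to \<open>a = 0\<close>,
  the upper to \<open>a = p\<close>.\<close>

definition sigm :: "real \<Rightarrow> real" where "sigm s = 1 / (1 + exp (- s))"

lemma sigm: "0 < sigm s" "sigm s < 1" "sigm s \<le> exp s" "1 - sigm s \<le> exp (- s)"
proof -
  show "0 < sigm s" "sigm s < 1"
    by (simp_all add: sigm_def add_pos_pos)
  have "sigm s \<le> 1 / exp (- s)" unfolding sigm_def by (intro divide_left_mono) (auto simp: add_pos_pos)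
  then show "sigm s \<le> exp s" by (simp add: exp_minus inverse_eq_divide)
  have "1 + exp (- s) \<noteq> 0" using exp_gt_zero[of "- s"] by linarith
  then have "1 - sigm s = exp (- s) / (1 + exp (- s))" by (simp add: sigm_def field_simps)
  also have "\<dots> \<le> exp (- s) / 1" by (intro divide_left_mono) (auto simp: add_pos_pos)
  finally show "1 - sigm s \<le> exp (- s)" by simp
qed

lemma sigm_continuous: "continuous_on UNIV sigm"
  unfolding sigm_def[abs_def] by (intro continuous_intros) (auto simp: add_nonneg_eq_0_iff)

text \<open>\<open>connected_zero_set\<close> is applied to \<open>br_Z\<close> read on the plane;
  the connected set of zeros is then carried by a continuous map to pairs of parameter and
  solution.\<close>

lemma branch_exists:
  assumes \<alpha>: "0 < \<alpha>" "\<alpha> < 1" and p2: "1/2 < p2"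
    and below: "\<And>p. 0 < p \<Longrightarrow> p < p2 \<Longrightarrow> br_Z' (br_k \<alpha>) p 0 < 0"
    and above: "\<And>p. p2 < p \<Longrightarrow> br_Z' (br_k \<alpha>) p 0 > 0"
  shows "\<exists>C :: (real \<times> C10) set.
       C \<subseteq> {0<..} \<times> UNIV \<and> connected C \<and> \<not> bounded C \<and>
       (\<Lambda> \<alpha> (2 * ln (cosh p2)), U_C10 \<alpha> (2 * ln (cosh p2))) \<in> closure C \<and>
       (\<forall>(l, u) \<in> C.
          is_solution \<alpha> l (fun_of u) \<and> is_positive (fun_of u) \<and> \<not> is_even (fun_of u) \<and>
          \<Lambda> \<alpha> (sup_norm (fun_of u)) \<le> l \<and> l < 4 * \<Lambda> \<alpha> (sup_norm (fun_of u))) \<and>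
       (\<exists>(k :: nat \<Rightarrow> real) (v :: nat \<Rightarrow> C10).
          (\<forall>n. (k n, v n) \<in> C) \<and> k \<longlonglongrightarrow> 0 \<and>
          filterlim (\<lambda>n. sup_norm (fun_of (v n))) at_top sequentially)"
proof -
  define k where "k = br_k \<alpha>"
  have k: "k > 0" using \<alpha> by (simp add: k_def br_k_def)
  \<comment> \<open>\<open>(x, s) \<mapsto> (P x, P x * sigm s)\<close> maps the plane to the strip \<open>0 < a < p\<close>; where it fails to be
    injective, \<open>p = 1/2\<close> and \<open>Z\<close> is negative.\<close>
  define P :: "real \<Rightarrow> real" where "P x = max x (1/2)" for x
  have P: "P x > 0" "P x \<ge> 1/2" "\<bar>P x - P y\<bar> \<le> \<bar>x - y\<bar>" for x y by (auto simp: P_def)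
  define G where "G z = br_Z k (P (fst z)) (P (fst z) * sigm (snd z))" for z
  have Gc: "continuous_on UNIV G"
    unfolding G_def P_def
    by (intro continuous_intros continuous_on_compose2[OF sigm_continuous]) auto
  have bottom: "\<exists>e>0. \<exists>s0. \<forall>x' s. \<bar>x' - x\<bar> < e \<and> s \<le> s0 \<longrightarrow> \<sigma> * G (x', s) > 0"
    if sgn: "\<sigma> * br_Z' k (P x) 0 > 0" for \<sigma> x :: real
  proof -
    obtain d where d: "d > 0" "\<And>p a. \<bar>p - P x\<bar> < d \<Longrightarrow> 0 < a \<Longrightarrow> a < d \<Longrightarrow> \<sigma> * br_Z k p a > 0"
      using br_Z_sign[OF sgn] by metis
    \<comment> \<open>For \<open>s\<close> up to the logarithm chosen here,
      \<open>sigm s \<le> d / (P x + d)\<close>, which with \<open>P x' < P x + d\<close> gives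
      \<open>a < d\<close>.\<close>
    show ?thesis
    proof (rule exI[of _ d], rule conjI[OF d(1)], rule exI[of _ "ln (d / (P x + d))"], intro allI impI)
      fix x' s assume *: "\<bar>x' - x\<bar> < d \<and> s \<le> ln (d / (P x + d))"
      then have 1: "\<bar>P x' - P x\<bar> < d" using P(3)[of x' x] by simp
      have pos: "0 < d / (P x + d)" using d P(1)[of x] by simp
      have "exp s \<le> exp (ln (d / (P x + d)))" using * by simp
      also have "\<dots> = d / (P x + d)" using pos by simp
      finally have "sigm s \<le> d / (P x + d)" using sigm(3)[of s] by simp
      then have "P x' * sigm s \<le> P x' * (d / (P x + d))" using P(1)[of x'] by (intro mult_left_mono) auto
      also have "\<dots> < (P x + d) * (d / (P x + d))" using 1 pos by (intro mult_strict_right_mono) auto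
      also have "\<dots> = d" using d P(1)[of x] by simp
      finally show "\<sigma> * G (x', s) > 0"
        using d(2)[OF 1, of "P x' * sigm s"] P(1) sigm(1) by (simp add: G_def)
    qed
  qed
  have top: "\<exists>e>0. \<exists>s0. \<forall>x' s. \<bar>x' - x\<bar> < e \<and> s \<ge> s0 \<longrightarrow> G (x', s) < 0" for x
  proof -
    have "continuous_on UNIV (\<lambda>z. - br_Z k (fst z) (snd z))"
      by (intro continuous_intros)
    moreover have "- br_Z k (P x) (P x) > 0" using br_Z_diag[OF k P(1)] by simp
    ultimately obtain d where d: "d > 0"
        "\<And>p a. \<bar>p - P x\<bar> < d \<Longrightarrow> \<bar>a - P x\<bar> < d \<Longrightarrow> - br_Z k p a > 0"
      using open_prod_box[of "\<lambda>z. - br_Z k (fst z) (snd z)" "P x" "P x"] by auto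
    \<comment> \<open>Half of \<open>d\<close> is spent on moving \<open>p\<close> and half on
      \<open>p - a\<close>, so that \<open>(p, a)\<close> stays in the box around the diagonal
      point.\<close>
    show ?thesis
    proof (rule exI[of _ "d/2"], rule conjI, use d in simp,
        rule exI[of _ "- ln (d / 2 / (P x + d))"], intro allI impI)
      fix x' s assume *: "\<bar>x' - x\<bar> < d/2 \<and> s \<ge> - ln (d / 2 / (P x + d))"
      then have 1: "\<bar>P x' - P x\<bar> < d/2" using P(3)[of x' x] by simp
      have pos: "0 < d / 2 / (P x + d)" using d P(1)[of x] by simp
      have "exp (- s) \<le> exp (ln (d / 2 / (P x + d)))" unfolding exp_le_cancel_iff using * by linarith
      also have "\<dots> = d / 2 / (P x + d)" using pos by simp
      finally have "1 - sigm s \<le> d / 2 / (P x + d)" using sigm(4)[of s] by simp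
      then have "P x' * (1 - sigm s) \<le> P x' * (d / 2 / (P x + d))" using P(1)[of x'] by (intro mult_left_mono) auto
      also have "\<dots> < (P x + d) * (d / 2 / (P x + d))"
        using 1 pos d(1) by (intro mult_strict_right_mono) linarith+
      also have "\<dots> = d / 2"
        using d(1) P(1)[of x] nonzero_mult_div_cancel_left[of "P x + d" "d / 2"]
        by (simp only: times_divide_eq_right[symmetric])
      finally have "P x' - P x' * sigm s < d / 2" by (simp add: algebra_simps)
      moreover have "P x' * sigm s < P x'" using P(1)[of x'] sigm(2)[of s] by simp
      ultimately have "\<bar>P x' * sigm s - P x\<bar> < d" using 1 by linarith
      then show "G (x', s) < 0" using d(2)[of "P x'" "P x' * sigm s"] 1 d(1) by (simp add: G_def)
    qed
  qed
  obtain K where K: "connected K" "\<And>z. z \<in> K \<Longrightarrow> G z = 0" "\<And>x. x > p2 \<Longrightarrow> \<exists>s. (x, s) \<in> K"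
    "\<And>d s0. d > 0 \<Longrightarrow> \<exists>x s. (x, s) \<in> K \<and> \<bar>x - p2\<bar> < d \<and> s \<le> s0"
  proof (rule connected_zero_set[OF Gc, of 0 p2])
    show "0 < p2" using p2 by simp
    \<comment> \<open>The line \<open>x = 0\<close> is read at \<open>p = 1/2\<close>, the largest
      \<open>p\<close> that \<open>br_Z_neg_small\<close> covers.\<close>
    show "G (0, s) < 0" for s
      using sigm[of s] by (auto simp: G_def P_def intro!: br_Z_neg_small k)
    show "\<exists>e>0. \<exists>s0. \<forall>x' s. \<bar>x' - x\<bar> < e \<and> s \<le> s0 \<longrightarrow> 0 < G (x', s)" if "x > p2" for x
    proof -
      have "P x = x" using that p2 by (simp add: P_def)
      then show ?thesis using bottom[of 1 x] above[OF that] by (simp add: k_def)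
    qed
    show "\<exists>e>0. \<exists>s0. \<forall>x' s. \<bar>x' - x\<bar> < e \<and> s \<le> s0 \<longrightarrow> G (x', s) < 0" if "x < p2" for x
    proof -
      have "P x < p2" using that p2 by (simp add: P_def)
      then show ?thesis using bottom[of "-1" x] below[OF P(1)] by (simp add: k_def)
    qed
  qed (use top that in auto)
  \<comment> \<open>\<open>\<theta>\<close> returns from the plane to \<open>(p, a)\<close>.
    \<open>\<Phi>\<close> sends \<open>(p, a)\<close> to parameter and solution; its domain of
    continuity \<open>S\<close> also contains the points with \<open>a = 0\<close>, which
    \<open>\<theta>\<close> does not reach.\<close>
  define \<theta> where "\<theta> z = (P (fst z), P (fst z) * sigm (snd z))" for z
  define \<Phi> where "\<Phi> z = (br_lam \<alpha> (fst z) (snd z), br_C10 \<alpha> (fst z) (snd z))" for z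
  define C where "C = (\<lambda>z. \<Phi> (\<theta> z)) ` K"
  define S where "S = {z. branch_point \<alpha> (fst z) (snd z)}"
  have cS: "continuous_on S \<Phi>" unfolding S_def \<Phi>_def by (rule br_continuous_on[OF \<alpha>])
  have \<theta>S: "\<theta> z \<in> S" if "z \<in> K" for z
    unfolding S_def \<theta>_def using K(2)[OF that] \<alpha> P(1) sigm
    by (auto simp: branch_point_def G_def k_def less_imp_le)
  have \<theta>c: "continuous_on A \<theta>" for A
    unfolding \<theta>_def P_def
    by (intro continuous_intros continuous_on_compose2[OF sigm_continuous]) auto
  have C_prop: "l > 0 \<and> is_solution \<alpha> l (fun_of u) \<and> is_positive (fun_of u) \<and> \<not> is_even (fun_of u) \<and>
      \<Lambda> \<alpha> (sup_norm (fun_of u)) \<le> l \<and> l < 4 * \<Lambda> \<alpha> (sup_norm (fun_of u))"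
    if "(l, u) \<in> C" for l u
  proof -
    obtain z where z: "z \<in> K" "(l, u) = \<Phi> (\<theta> z)" using \<open>(l, u) \<in> C\<close> unfolding C_def by blast
    define p a where "p = fst (\<theta> z)" and "a = snd (\<theta> z)"
    interpret branch_point \<alpha> p a using \<theta>S[OF z(1)] by (simp add: S_def p_def a_def)
    have a0: "a > 0" using P(1) sigm(1) by (simp add: a_def \<theta>_def)
    have lu: "l = br_lam \<alpha> p a" "u = br_C10 \<alpha> p a" using z(2) by (auto simp: \<Phi>_def p_def a_def)
    have "l > 0" using sr_pos by (simp add: lu br_lam_def)
    then show ?thesis
      using is_solution positive not_even[OF a0] br_lam_bounds[OF \<alpha> p a] by (simp add: lu sup_norm_br)
  qed
  \<comment> \<open>From \<open>a < p\<close> and \<open>cosh x \<ge> exp x / 2\<close>: along the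
    branch the parameter decays as \<open>p\<close> grows.\<close>
  have pt: "\<exists>l u. (l, u) \<in> C \<and> sup_norm (fun_of u) = 2 * ln (cosh x) \<and> 0 \<le> l \<and> l \<le> 32 / (1 - \<alpha>)\<^sup>2 * (x / exp x)\<^sup>2"
    if x: "x > p2" for x
  proof -
    obtain s where s: "(x, s) \<in> K" using K(3)[OF x] by blast
    have Px: "P x = x" using x p2 by (simp add: P_def)
    have \<theta>x: "\<theta> (x, s) = (x, x * sigm s)" by (simp add: \<theta>_def Px)
    interpret branch_point \<alpha> x "x * sigm s" using \<theta>S[OF s] by (simp add: S_def \<theta>x)
    have "br_lam \<alpha> x (x * sigm s) = 2 * (br_sr \<alpha> x (x * sigm s) / cosh x)\<^sup>2"
      by (simp add: br_lam_def power_divide)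
    also have "\<dots> \<le> 2 * ((2 * x / (1 - \<alpha>)) / (exp x / 2))\<^sup>2"
    proof (intro mult_left_mono power_mono frac_le)
      show "br_sr \<alpha> x (x * sigm s) \<le> 2 * x / (1 - \<alpha>)"
        unfolding br_sr_def using a p \<alpha> by (intro divide_right_mono) auto
      show "exp x / 2 \<le> cosh x" by (simp add: cosh_def)
    qed (use sr_pos p \<alpha> in auto)
    also have "\<dots> = 32 / (1 - \<alpha>)\<^sup>2 * (x / exp x)\<^sup>2"
      by (simp add: power_divide power_mult_distrib)
    finally have "br_lam \<alpha> x (x * sigm s) \<le> 32 / (1 - \<alpha>)\<^sup>2 * (x / exp x)\<^sup>2" .
    moreover have "(br_lam \<alpha> x (x * sigm s), br_C10 \<alpha> x (x * sigm s)) \<in> C"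
      unfolding C_def using s by (intro image_eqI[of _ _ "(x, s)"]) (simp_all add: \<Phi>_def \<theta>x)
    moreover have "br_lam \<alpha> x (x * sigm s) \<ge> 0" by (simp add: br_lam_def)
    ultimately show ?thesis using sup_norm_br by blast
  qed
  have lncosh: "2 * ln (cosh x) \<ge> 2 * x - 2 * ln 2" for x :: real
  proof -
    have "ln (exp x / 2) \<le> ln (cosh x)"
      using cosh_real_pos[of x] by (subst ln_le_cancel_iff) (simp_all add: cosh_def)
    then show ?thesis by (simp add: ln_div)
  qed
  \<comment> \<open>The summand \<open>1\<close> keeps the argument above \<open>p2\<close> at
    \<open>n = 0\<close> and outweighs \<open>ln 2\<close> in the lower bound for the norm.\<close>
  have xn: "p2 + 1 + real n > p2" for n by simp
  from pt[OF xn] obtain \<kappa> v where \<kappa>v: "\<And>n. (\<kappa> n, v n) \<in> C"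
    "\<And>n. sup_norm (fun_of (v n)) = 2 * ln (cosh (p2 + 1 + real n))" "\<And>n. 0 \<le> \<kappa> n"
    "\<And>n. \<kappa> n \<le> 32 / (1 - \<alpha>)\<^sup>2 * ((p2 + 1 + real n) / exp (p2 + 1 + real n))\<^sup>2"
    by metis
  have ft: "filterlim (\<lambda>n. p2 + 1 + real n) at_top sequentially"
    by (rule filterlim_tendsto_add_at_top[OF tendsto_const filterlim_real_sequentially])
  have \<kappa>0: "\<kappa> \<longlonglongrightarrow> 0"
  proof (rule tendsto_sandwich[OF _ _ tendsto_const])
    have "((\<lambda>n. (p2 + 1 + real n) ^ 1 / exp (p2 + 1 + real n)) \<longlongrightarrow> 0) sequentially"
      by (rule filterlim_compose[OF tendsto_power_div_exp_0 ft])
    then have "((\<lambda>n. 32 / (1 - \<alpha>)\<^sup>2 * ((p2 + 1 + real n) / exp (p2 + 1 + real n))\<^sup>2) \<longlongrightarrow> 32 / (1 - \<alpha>)\<^sup>2 * 0\<^sup>2) sequentially"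
      by (intro tendsto_intros) simp
    then show "((\<lambda>n. 32 / (1 - \<alpha>)\<^sup>2 * ((p2 + 1 + real n) / exp (p2 + 1 + real n))\<^sup>2) \<longlongrightarrow> 0) sequentially"
      by simp
  qed (use \<kappa>v in auto)
  have vinf: "filterlim (\<lambda>n. sup_norm (fun_of (v n))) at_top sequentially"
  proof (rule filterlim_at_top_mono[OF filterlim_real_sequentially])
    show "\<forall>\<^sub>F n in sequentially. real n \<le> sup_norm (fun_of (v n))"
    proof (intro always_eventually allI)
      fix n
      have "ln 2 \<le> (1::real)" using ln_le_minus_one[of "2::real"] by simp
      then show "real n \<le> sup_norm (fun_of (v n))"
        using lncosh[of "p2 + 1 + real n"] p2 by (simp add: \<kappa>v(2))
    qed
  qed
  have unb: "\<not> bounded C"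
  proof
    assume "bounded C"
    then obtain B where B: "\<And>z. z \<in> C \<Longrightarrow> norm z \<le> B" unfolding bounded_iff by blast
    have "sup_norm (fun_of (v n)) \<le> B" for n
    proof -
      have "sup_norm (fun_of (v n)) \<le> norm (v n)"
        using sup_norm_nonneg[OF fun_of_deriv(2), of "v n"] by (simp add: norm_C10_def)
      also have "\<dots> \<le> norm (\<kappa> n, v n)" by (rule norm_snd_le)
      finally show ?thesis using B[OF \<kappa>v(1)[of n]] by simp
    qed
    moreover have "\<forall>\<^sub>F n in sequentially. sup_norm (fun_of (v n)) > B"
      using vinf unfolding filterlim_at_top_dense by simp
    then obtain n where "sup_norm (fun_of (v n)) > B"
      using eventually_happens'[OF sequentially_bot] by blast
    ultimately show False by (simp add: not_less[symmetric])
  qed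
  have clos: "(\<Lambda> \<alpha> (2 * ln (cosh p2)), U_C10 \<alpha> (2 * ln (cosh p2))) \<in> closure C"
  proof -
    have p20: "p2 > 0" using p2 by simp
    have eq: "(\<Lambda> \<alpha> (2 * ln (cosh p2)), U_C10 \<alpha> (2 * ln (cosh p2))) = \<Phi> (p2, 0)"
      by (simp add: \<Phi>_def br_lam_0 br_C10_0 \<alpha> p20)
    \<comment> \<open>Points of \<open>K\<close> whose columns tend to \<open>p2\<close> and whose
      heights tend to minus infinity: \<open>\<theta>\<close> sends them towards
      \<open>(p2, 0)\<close>, where \<open>\<Phi>\<close> is continuous relative to
      \<open>S\<close>.\<close>
    have "\<exists>z. z \<in> K \<and> \<bar>fst z - p2\<bar> < inverse (real (Suc n)) \<and> snd z \<le> - real n" for n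
      using K(4)[of "inverse (real (Suc n))" "- real n"] by auto
    then obtain z where z: "\<And>n. z n \<in> K" "\<And>n. \<bar>fst (z n) - p2\<bar> < inverse (real (Suc n))"
        "\<And>n. snd (z n) \<le> - real n"
      by metis
    have "(\<lambda>n. fst (z n) - p2) \<longlonglongrightarrow> 0"
      by (rule LIMSEQ_norm_0) (use z(2) in \<open>simp add: inverse_eq_divide\<close>)
    then have f: "(\<lambda>n. fst (z n)) \<longlonglongrightarrow> p2" using LIM_zero_iff by blast
    have "(\<lambda>n. sigm (snd (z n))) \<longlonglongrightarrow> 0"
    proof (rule tendsto_sandwich[OF _ _ tendsto_const])
      show "(\<lambda>n. exp (- real n)) \<longlonglongrightarrow> 0"
        by (rule filterlim_compose[OF exp_at_bot])
          (simp add: filterlim_uminus_at_bot filterlim_real_sequentially)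
      show "\<forall>\<^sub>F n in sequentially. sigm (snd (z n)) \<le> exp (- real n)"
        using z(3) sigm(3) by (intro always_eventually allI) (meson exp_le_cancel_iff order_trans)
    qed (use sigm(1) in \<open>auto intro: always_eventually less_imp_le\<close>)
    moreover have "(\<lambda>n. P (fst (z n))) \<longlonglongrightarrow> P p2" unfolding P_def by (intro tendsto_intros f)
    moreover have "P p2 = p2" using p2 by (simp add: P_def)
    ultimately have "(\<lambda>n. \<theta> (z n)) \<longlonglongrightarrow> (p2, p2 * 0)" unfolding \<theta>_def by (intro tendsto_Pair tendsto_mult) auto
    then have "(\<lambda>n. \<theta> (z n)) \<longlonglongrightarrow> (p2, 0)" by simp
    moreover have "(p2, 0) \<in> S" using branch_point_0[OF \<alpha> p20] by (simp add: S_def)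
    ultimately have "(\<lambda>n. \<Phi> (\<theta> (z n))) \<longlonglongrightarrow> \<Phi> (p2, 0)"
      using continuous_on_tendsto_compose[OF cS, of "\<lambda>n. \<theta> (z n)" "(p2, 0)" sequentially] \<theta>S z(1) by simp
    then show ?thesis
      unfolding eq closure_sequential C_def
      by (intro exI[of _ "\<lambda>n. \<Phi> (\<theta> (z n))"] conjI allI imageI z(1))
  qed
  have "connected C" unfolding C_def
    by (intro connected_continuous_image K(1) continuous_on_compose2[OF cS \<theta>c]) (use \<theta>S in auto)
  moreover have "C \<subseteq> {0<..} \<times> UNIV" using C_prop by auto
  ultimately show ?thesis using unb clos \<kappa>v(1) \<kappa>0 vinf C_prop
    by (intro exI[of _ C] conjI exI[of _ \<kappa>] exI[of _ v]) auto
qed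

subsection \<open>The outer Dirichlet problem\<close>

text \<open>The energy \<open>E = y\<^sup>2 + y'\<^sup>2\<close> satisfies
  \<open>\<bar>E'\<bar> \<le> (1 + M) * E\<close>, so \<open>E\<close> times an exponential is
  monotone, and the zero data at either end force it to vanish.\<close>

lemma linear_ode_unique:
  fixes y y' Q :: "real \<Rightarrow> real"
  assumes c: "continuous_on {a..b} y" "continuous_on {a..b} y'"
    and d: "\<And>x. a < x \<Longrightarrow> x < b \<Longrightarrow> (y has_real_derivative y' x) (at x)"
      "\<And>x. a < x \<Longrightarrow> x < b \<Longrightarrow> (y' has_real_derivative Q x * y x) (at x)"
    and Q: "\<And>x. a < x \<Longrightarrow> x < b \<Longrightarrow> \<bar>Q x\<bar> \<le> M"
    and init: "(y a = 0 \<and> y' a = 0) \<or> (y b = 0 \<and> y' b = 0)"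
    and x: "a \<le> x" "x \<le> b"
  shows "y x = 0"
proof -
  define E where "E x = (y x)\<^sup>2 + (y' x)\<^sup>2" for x
  have E0: "E x \<ge> 0" for x by (simp add: E_def)
  have cE: "continuous_on {s..t} E" if "a \<le> s" "t \<le> b" for s t
    unfolding E_def by (rule continuous_on_subset[of "{a..b}"]) (use that in \<open>auto intro!: continuous_intros c\<close>)
  define E' where "E' x = 2 * y x * y' x + 2 * y' x * (Q x * y x)" for x
  have dE: "(E has_real_derivative E' x) (at x)" if "a < x" "x < b" for x
    unfolding E_def[abs_def] E'_def by (rule derivative_eq_intros d that refl | simp)+
  have bound: "\<bar>E' x\<bar> \<le> (1 + M) * E x" if "a < x" "x < b" for x
  proof -
    have "\<bar>E' x\<bar> = \<bar>1 + Q x\<bar> * \<bar>2 * y x * y' x\<bar>"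
      unfolding E'_def abs_mult[symmetric] by (rule arg_cong[of _ _ abs]) (simp add: algebra_simps)
    also have "\<dots> \<le> (1 + M) * E x"
    proof (rule mult_mono)
      show "\<bar>1 + Q x\<bar> \<le> 1 + M" using Q[OF that] by linarith
      show "\<bar>2 * y x * y' x\<bar> \<le> E x"
        using zero_le_power2[of "y x - y' x"] zero_le_power2[of "y x + y' x"]
        by (simp add: E_def power2_eq_square algebra_simps abs_le_iff)
    qed (use Q[OF that] in auto)
    finally show ?thesis .
  qed
  have "E x \<le> 0"
    using init
  proof
    assume i: "y a = 0 \<and> y' a = 0"
    have "E x * exp (- (1 + M) * x) \<le> E a * exp (- (1 + M) * a)"
    proof (rule DERIV_nonpos_imp_decreasing_open[OF x(1)])
      fix z assume z: "a < z" "z < x"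
      have "((\<lambda>x. E x * exp (- (1 + M) * x)) has_real_derivative
          (E' z - (1 + M) * E z) * exp (- (1 + M) * z)) (at z)"
        using z x by (auto intro!: derivative_eq_intros dE simp: algebra_simps)
      moreover have "(E' z - (1 + M) * E z) * exp (- (1 + M) * z) \<le> 0"
        using bound[of z] z x by (intro mult_nonpos_nonneg) auto
      ultimately show "\<exists>d. ((\<lambda>x. E x * exp (- (1 + M) * x)) has_real_derivative d) (at z) \<and> d \<le> 0"
        by blast
    qed (use x in \<open>intro continuous_intros cE; simp\<close>)
    also have "\<dots> = 0" using i by (simp add: E_def)
    finally show ?thesis by (simp add: mult_le_0_iff)
  next
    assume i: "y b = 0 \<and> y' b = 0"
    have "E x * exp ((1 + M) * x) \<le> E b * exp ((1 + M) * b)"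
    proof (rule DERIV_nonneg_imp_increasing_open[OF x(2)])
      fix z assume z: "x < z" "z < b"
      have "((\<lambda>x. E x * exp ((1 + M) * x)) has_real_derivative
          (E' z + (1 + M) * E z) * exp ((1 + M) * z)) (at z)"
        using z x by (auto intro!: derivative_eq_intros dE simp: algebra_simps)
      moreover have "(E' z + (1 + M) * E z) * exp ((1 + M) * z) \<ge> 0"
        using bound[of z] z x by (intro mult_nonneg_nonneg) auto
      ultimately show "\<exists>d. ((\<lambda>x. E x * exp ((1 + M) * x)) has_real_derivative d) (at z) \<and> d \<ge> 0"
        by blast
    qed (use x in \<open>intro continuous_intros cE; simp\<close>)
    also have "\<dots> = 0" using i by (simp add: E_def)
    finally show ?thesis by (simp add: mult_le_0_iff)
  qed
  then have "E x = 0" using E0[of x] by simp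
  then show ?thesis by (simp add: E_def add_nonneg_eq_0_iff)
qed

lemma DERIV_imp_continuous_on:
  fixes f f' :: "real \<Rightarrow> real"
  shows "(\<And>x. (f has_real_derivative f' x) (at x)) \<Longrightarrow> continuous_on S f"
  by (meson DERIV_isCont continuous_at_imp_continuous_on)

text \<open>The coefficient \<open>\<Lambda> exp U\<close> on the outer intervals, with
  \<open>P = p / (1 - \<alpha>)\<close> (see \<open>U_pot\<close>): a Poeschl-Teller well, whose
  linear equation has elementary solutions.\<close>

definition pot :: "real \<Rightarrow> real \<Rightarrow> real \<Rightarrow> real" where
  "pot \<alpha> P x = 2 * P\<^sup>2 * (1 - (tanh (P * (x - \<alpha>)))\<^sup>2)"

lemma pot_bounds: "0 \<le> pot \<alpha> P x" "pot \<alpha> P x \<le> 2 * P\<^sup>2"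
  using tanh_sq_less_1[of "P * (x - \<alpha>)"] mult_left_mono[of "1 - (tanh (P * (x - \<alpha>)))\<^sup>2" 1 "2 * P\<^sup>2"]
  by (auto simp: pot_def intro!: mult_nonneg_nonneg)

text \<open>The equation is required only in the open interval, since an eigenfunction need not
  satisfy it at \<open>\<alpha>\<close>; the normalisation \<open>y \<alpha> = 1\<close> makes
  \<open>g\<close> the logarithmic derivative there.\<close>

definition outer :: "real \<Rightarrow> real \<Rightarrow> real \<Rightarrow> real \<Rightarrow> (real \<Rightarrow> real) \<Rightarrow> (real \<Rightarrow> real) \<Rightarrow> bool" where
  "outer \<alpha> P \<nu> g y y' \<longleftrightarrow> continuous_on {\<alpha>..1} y \<and> continuous_on {\<alpha>..1} y' \<and>
     (\<forall>x. \<alpha> < x \<and> x < 1 \<longrightarrow> (y has_real_derivative y' x) (at x) \<and>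
        (y' has_real_derivative (\<nu>\<^sup>2 - pot \<alpha> P x) * y x) (at x)) \<and>
     y 1 = 0 \<and> y \<alpha> = 1 \<and> y' \<alpha> = g"

lemma outerD:
  assumes "outer \<alpha> P \<nu> g y y'"
  shows "continuous_on {\<alpha>..1} y" "continuous_on {\<alpha>..1} y'"
    "\<alpha> < x \<Longrightarrow> x < 1 \<Longrightarrow> (y has_real_derivative y' x) (at x)"
    "\<alpha> < x \<Longrightarrow> x < 1 \<Longrightarrow> (y' has_real_derivative (\<nu>\<^sup>2 - pot \<alpha> P x) * y x) (at x)"
    "y 1 = 0" "y \<alpha> = 1" "y' \<alpha> = g"
  using assms unfolding outer_def by auto

text \<open>\<open>tanh (P (x - \<alpha>))\<close> solves the equation for \<open>\<nu> = 0\<close> and is positive on \<open>(\<alpha>,1]\<close>.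
  For a solution \<open>y\<close>, the function \<open>y (y' th - y th') / th\<close> is nondecreasing and vanishes
  at the zeros of \<open>y\<close>.\<close>

lemma outer_nonzero:
  assumes y: "outer \<alpha> P \<nu> g y y'" and P: "P > 0" and x0: "\<alpha> < x0" "x0 < 1"
  shows "y x0 \<noteq> 0"
proof
  assume yx0: "y x0 = 0"
  note yD = outerD[OF y]
  define th where "th x = tanh (P * (x - \<alpha>))" for x
  define th' where "th' x = P * (1 - (th x)\<^sup>2)" for x
  have dth: "(th has_real_derivative th' x) (at x)" for x
    unfolding th_def[abs_def] th'_def by (auto intro!: derivative_eq_intros)
  have dth': "(th' has_real_derivative - pot \<alpha> P x * th x) (at x)" for x
    unfolding th'_def[abs_def] pot_def
    by (rule derivative_eq_intros dth refl | simp)+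
      (simp add: th'_def th_def algebra_simps power2_eq_square)
  have thpos: "th x > 0" if "\<alpha> < x" for x using that P by (simp add: th_def)
  define W where "W x = y' x * th x - y x * th' x" for x
  define F where "F x = y x * W x / th x" for x
  have dW: "(W has_real_derivative \<nu>\<^sup>2 * y x * th x) (at x)" if "\<alpha> < x" "x < 1" for x
    unfolding W_def[abs_def]
    by (rule derivative_eq_intros dth dth' yD(3,4) that refl | simp)+ (simp add: algebra_simps)
  have dF: "(F has_real_derivative (W x / th x)\<^sup>2 + \<nu>\<^sup>2 * (y x)\<^sup>2) (at x)" if "\<alpha> < x" "x < 1" for x
  proof -
    have "((\<lambda>x. y x * W x) has_real_derivative y' x * W x + \<nu>\<^sup>2 * y x * th x * y x) (at x)"
      by (rule DERIV_cong[OF DERIV_mult[OF yD(3)[OF that] dW[OF that]]]) simp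
    then have "((\<lambda>x. y x * W x / th x) has_real_derivative
        ((y' x * W x + \<nu>\<^sup>2 * y x * th x * y x) * th x - y x * W x * th' x) / (th x * th x)) (at x)"
      using that thpos[of x] by (intro DERIV_divide dth) auto
    moreover have "((y' x * W x + \<nu>\<^sup>2 * y x * th x * y x) * th x - y x * W x * th' x) / (th x * th x)
        = (W x / th x)\<^sup>2 + \<nu>\<^sup>2 * (y x)\<^sup>2"
      using thpos[OF that(1)] by (simp add: W_def field_simps power2_eq_square)
    ultimately show ?thesis by (simp add: F_def[abs_def])
  qed
  have cF: "continuous_on {x0..1} F"
  proof -
    have "continuous_on {\<alpha>..1} th" "continuous_on {\<alpha>..1} th'"
      by (rule DERIV_imp_continuous_on, rule dth dth')+
    then have "continuous_on {x0..1} th" "continuous_on {x0..1} th'" "continuous_on {x0..1} y" "continuous_on {x0..1} y'"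
      using yD(1,2) x0 by (auto elim!: continuous_on_subset)
    moreover have "\<forall>x\<in>{x0..1}. th x \<noteq> 0"
    proof
      fix x assume "x \<in> {x0..1}"
      then show "th x \<noteq> 0" using thpos[of x] x0 by simp
    qed
    ultimately show ?thesis unfolding F_def W_def by (intro continuous_intros)
  qed
  have Fmono: "F s \<le> F t" if "x0 \<le> s" "s \<le> t" "t \<le> 1" for s t
  proof (rule DERIV_nonneg_imp_increasing_open[OF that(2)])
    show "\<exists>d. (F has_real_derivative d) (at x) \<and> 0 \<le> d" if "s < x" "x < t" for x
      using dF[of x] that \<open>x0 \<le> s\<close> \<open>t \<le> 1\<close> x0 by (intro exI[of _ "(W x / th x)\<^sup>2 + \<nu>\<^sup>2 * (y x)\<^sup>2"]) auto
    show "continuous_on {s..t} F" using cF that by (auto elim!: continuous_on_subset)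
  qed
  \<comment> \<open>\<open>F\<close> is nondecreasing and zero at both ends, because
    \<open>y\<close> vanishes at \<open>x0\<close> and at \<open>1\<close>.\<close>
  have F0: "F x = 0" if "x0 \<le> x" "x \<le> 1" for x
    using Fmono[of x0 x] Fmono[of x 1] that yx0 yD(5) x0 by (simp add: F_def)
  have W0: "W x = 0" if "x0 < x" "x < 1" for x
  proof -
    have "(F has_real_derivative 0) (at x)"
      by (rule has_field_derivative_transform_within_open[of "\<lambda>_. 0" _ _ "{x0<..<1}"]) (use that F0 in auto)
    then have "(W x / th x)\<^sup>2 + \<nu>\<^sup>2 * (y x)\<^sup>2 = 0"
      using dF[of x] DERIV_unique that x0 by fastforce
    then have "W x / th x = 0" by (simp add: add_nonneg_eq_0_iff)
    then show ?thesis using thpos[of x] that x0 by auto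
  qed
  have y0: "y x = 0" if "x0 < x" "x < 1" for x
  proof -
    have "y x / th x = y x0 / th x0"
    proof (rule DERIV_isconst_end[OF that(1)])
      show "continuous_on {x0..x} (\<lambda>x. y x / th x)"
      proof (intro continuous_on_divide ballI)
        show "continuous_on {x0..x} y" using yD(1) x0 that by (auto elim!: continuous_on_subset)
        show "continuous_on {x0..x} th"
          by (rule DERIV_imp_continuous_on, rule dth)
        show "th z \<noteq> 0" if "z \<in> {x0..x}" for z using thpos[of z] that x0 by simp
      qed
      fix z assume z: "x0 < z" "z < x"
      have "((\<lambda>x. y x / th x) has_real_derivative W z / (th z * th z)) (at z)"
        unfolding W_def using z that x0 thpos[of z]
        by (intro DERIV_divide yD(3) dth) auto
      then show "((\<lambda>x. y x / th x) has_real_derivative 0) (at z)"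
        using W0[of z] z that by simp
    qed
    then show ?thesis using yx0 thpos[of x] that x0 by simp
  qed
  \<comment> \<open>An interior point where \<open>y\<close> and \<open>y'\<close> both vanish;
    uniqueness runs from there back to \<open>\<alpha>\<close>, against
    \<open>y \<alpha> = 1\<close>.\<close>
  define x1 where "x1 = (x0 + 1) / 2"
  have x1: "x0 < x1" "x1 < 1" using x0 by (auto simp: x1_def)
  have y'0: "y' x1 = 0"
  proof -
    have "(y has_real_derivative 0) (at x1)"
      by (rule has_field_derivative_transform_within_open[of "\<lambda>_. 0" _ _ "{x0<..<1}"]) (use x1 y0 in auto)
    then show ?thesis using yD(3)[of x1] DERIV_unique x0 x1 by fastforce
  qed
  have "y \<alpha> = 0"
  proof (rule linear_ode_unique[of \<alpha> x1 y y' "\<lambda>x. \<nu>\<^sup>2 - pot \<alpha> P x" "\<nu>\<^sup>2 + 2 * P\<^sup>2"])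
    show "continuous_on {\<alpha>..x1} y" "continuous_on {\<alpha>..x1} y'"
      using yD(1,2) x1 by (auto elim!: continuous_on_subset)
    show "\<bar>\<nu>\<^sup>2 - pot \<alpha> P x\<bar> \<le> \<nu>\<^sup>2 + 2 * P\<^sup>2" for x
      using pot_bounds[of \<alpha> P x] zero_le_power2[of \<nu>] zero_le_power2[of P] unfolding abs_le_iff by linarith
  qed (use x0 x1 y0 y'0 yD(3,4) in auto)
  then show False using yD(6) by simp
qed

lemma outer_pos:
  assumes y: "outer \<alpha> P \<nu> g y y'" and P: "P > 0" and x: "\<alpha> \<le> x" "x < 1"
  shows "y x > 0"
proof (rule ccontr)
  assume neg: "\<not> y x > 0"
  note yD = outerD[OF y]
  have "\<exists>z\<ge>\<alpha>. z \<le> x \<and> y z = 0"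
    by (rule IVT2') (use neg yD x in \<open>auto elim!: continuous_on_subset\<close>)
  then obtain z where "\<alpha> \<le> z" "z \<le> x" "y z = 0" by blast
  moreover have "z \<noteq> \<alpha>" using calculation yD(6) by auto
  ultimately show False using outer_nonzero[OF y P, of z] x by auto
qed

text \<open>The Wronskian \<open>W\<close> vanishes at \<open>1\<close>, equals
  \<open>g1 - g2\<close> at \<open>\<alpha>\<close>, and its derivative
  \<open>(\<nu>1\<^sup>2 - \<nu>2\<^sup>2) * (y1 x * y2 x)\<close> has a definite sign because outer
  solutions are positive. So \<open>g\<close> is determined by \<open>\<nu>\<close> and strictly
  decreasing in it.\<close>

lemma outer_compare:
  assumes y1: "outer \<alpha> P \<nu>1 g1 y1 y1'" and y2: "outer \<alpha> P \<nu>2 g2 y2 y2'" and P: "P > 0" and \<alpha>: "\<alpha> < 1"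
  shows "\<nu>1 = \<nu>2 \<Longrightarrow> g1 = g2" "0 \<le> \<nu>1 \<Longrightarrow> \<nu>1 < \<nu>2 \<Longrightarrow> g2 < g1"
proof -
  define W where "W x = y1' x * y2 x - y1 x * y2' x" for x
  have dW: "(W has_real_derivative (\<nu>1\<^sup>2 - \<nu>2\<^sup>2) * (y1 x * y2 x)) (at x)" if "\<alpha> < x" "x < 1" for x
    unfolding W_def[abs_def]
    by (rule derivative_eq_intros outerD(3,4)[OF y1] outerD(3,4)[OF y2] that refl | simp)+
      (simp add: algebra_simps)
  have cW: "continuous_on {\<alpha>..1} W"
    unfolding W_def by (intro continuous_intros outerD[OF y1] outerD[OF y2])
  have W: "W 1 = 0" "W \<alpha> = g1 - g2"
    using outerD(5-7)[OF y1] outerD(5-7)[OF y2] by (auto simp: W_def)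
  show "g1 = g2" if "\<nu>1 = \<nu>2"
    using DERIV_isconst_end[OF \<alpha> cW] dW that W by simp
  show "g2 < g1" if "0 \<le> \<nu>1" "\<nu>1 < \<nu>2"
  proof -
    have "W 1 < W \<alpha>"
    proof (rule DERIV_neg_imp_decreasing_open[OF \<alpha> _ cW])
      fix x assume x: "\<alpha> < x" "x < 1"
      have "\<nu>1\<^sup>2 - \<nu>2\<^sup>2 < 0" using that by (simp add: power_strict_mono)
      moreover have "y1 x * y2 x > 0" using outer_pos[OF y1 P] outer_pos[OF y2 P] x by simp
      ultimately have "(\<nu>1\<^sup>2 - \<nu>2\<^sup>2) * (y1 x * y2 x) < 0" by (rule mult_neg_pos)
      then show "\<exists>d. (W has_real_derivative d) (at x) \<and> d < 0" using dW[OF x] by blast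
    qed
    then show ?thesis using W by simp
  qed
qed

section \<open>Explicit solutions of the outer problem and existence by the intermediate value
  theorem\<close>

definition shc :: "real \<Rightarrow> real" where "shc x = (if x = 0 then 1 else sinh x / x)"

lemma shc_continuous: "continuous_on S shc"
proof (rule continuous_at_imp_continuous_on, intro ballI)
  fix x :: real
  show "isCont shc x"
  proof (cases "x = 0")
    case True
    have "(sinh has_real_derivative 1) (at (0::real))"
      by (rule DERIV_cong[OF has_field_derivative_sinh[OF DERIV_ident]]) auto
    then have "((\<lambda>h. sinh h / h) \<longlongrightarrow> (1::real)) (at 0)" by (simp add: DERIV_def)
    then have "(shc \<longlongrightarrow> 1) (at 0)"
      by (rule Lim_transform_eventually) (auto simp: shc_def eventually_at_filter)
    then show ?thesis using True by (simp add: isCont_def shc_def)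
  next
    case False
    then have "\<forall>\<^sub>F y in nhds x. y \<in> - {0}" by (intro eventually_nhds_in_open) auto
    then have "\<forall>\<^sub>F y in nhds x. shc y = sinh y / y" by eventually_elim (simp add: shc_def)
    then show ?thesis
      by (subst isCont_cong) (use False in \<open>auto intro!: continuous_intros\<close>)
  qed
qed

lemma shc_pos: "shc x > 0"
  by (cases x "0::real" rule: linorder_cases) (auto simp: shc_def divide_neg_neg)

text \<open>The whole-line form of \<open>outer\<close>: the explicit solutions have it, and
  \<open>piecewise\<close> needs it to assemble eigenfunctions.\<close>

definition global_outer :: "real \<Rightarrow> real \<Rightarrow> real \<Rightarrow> real \<Rightarrow> (real \<Rightarrow> real) \<Rightarrow> (real \<Rightarrow> real) \<Rightarrow> bool" where
  "global_outer \<alpha> P \<nu> g y y' \<longleftrightarrow>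
     (\<forall>x. (y has_real_derivative y' x) (at x) \<and> (y' has_real_derivative (\<nu>\<^sup>2 - pot \<alpha> P x) * y x) (at x)) \<and>
     y 1 = 0 \<and> y \<alpha> = 1 \<and> y' \<alpha> = g"

lemma global_outer_imp_outer: "global_outer \<alpha> P \<nu> g y y' \<Longrightarrow> outer \<alpha> P \<nu> g y y'"
  unfolding global_outer_def outer_def
  by (auto intro!: continuous_at_imp_continuous_on DERIV_isCont)

lemma global_outer_scaled:
  fixes f f' :: "real \<Rightarrow> real"
  assumes P: "P > 0"
    and d: "\<And>t. (f has_real_derivative f' t) (at t)"
      "\<And>t. (f' has_real_derivative (n\<^sup>2 - 2 * (1 - (tanh t)\<^sup>2)) * f t) (at t)"
    and bc: "f 0 = 1" "f' 0 = g / P" "f (P * (1 - \<alpha>)) = 0"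
  shows "\<exists>y y'. global_outer \<alpha> P (n * P) g y y'"
proof (rule exI[of _ "\<lambda>x. f (P * (x - \<alpha>))"], rule exI[of _ "\<lambda>x. P * f' (P * (x - \<alpha>))"])
  have 1: "((\<lambda>x. f (P * (x - \<alpha>))) has_real_derivative P * f' (P * (x - \<alpha>))) (at x)" for x
    by (rule DERIV_cong[OF DERIV_chain2[OF d(1), where Db = P]]) (auto intro!: derivative_eq_intros)
  have "((\<lambda>x. f' (P * (x - \<alpha>))) has_real_derivative
      (n\<^sup>2 - 2 * (1 - (tanh (P * (x - \<alpha>)))\<^sup>2)) * f (P * (x - \<alpha>)) * P) (at x)" for x
    by (rule DERIV_chain2[OF d(2), where Db = P]) (auto intro!: derivative_eq_intros)
  then have 2: "((\<lambda>x. P * f' (P * (x - \<alpha>))) has_real_derivative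
      ((n * P)\<^sup>2 - pot \<alpha> P x) * f (P * (x - \<alpha>))) (at x)" for x
    by (rule DERIV_cong[OF DERIV_cmult]) (simp add: pot_def power2_eq_square algebra_simps)
  show "global_outer \<alpha> P (n * P) g (\<lambda>x. f (P * (x - \<alpha>))) (\<lambda>x. P * f' (P * (x - \<alpha>)))"
    using 1 2 bc P by (simp add: global_outer_def)
qed

text \<open>For \<open>\<nu> = 0\<close> the functions \<open>tanh t\<close> and
  \<open>1 - t * tanh t\<close> of \<open>t = P * (x - \<alpha>)\<close> span the solutions; the
  condition at \<open>x = 1\<close> fixes the coefficient of the first.\<close>

lemma global_outer_0:
  assumes P: "P > 0" and \<alpha>: "\<alpha> < 1" and p: "p = P * (1 - \<alpha>)"
  shows "\<exists>y y'. global_outer \<alpha> P 0 (P * (p - 1 / tanh p)) y y'"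
proof -
  define c where "c = p - 1 / tanh p"
  have T: "tanh p \<noteq> 0" using P \<alpha> p by simp
  have "\<exists>y y'. global_outer \<alpha> P (0 * P) (P * c) y y'"
  proof (rule global_outer_scaled[OF P, where f = "\<lambda>t. 1 - t * tanh t + c * tanh t"
        and f' = "\<lambda>t. - tanh t - t * (1 - (tanh t)\<^sup>2) + c * (1 - (tanh t)\<^sup>2)"])
    show "((\<lambda>t. 1 - t * tanh t + c * tanh t) has_real_derivative
        - tanh t - t * (1 - (tanh t)\<^sup>2) + c * (1 - (tanh t)\<^sup>2)) (at t)" for t
      by (auto intro!: derivative_eq_intros simp: algebra_simps)
    show "((\<lambda>t. - tanh t - t * (1 - (tanh t)\<^sup>2) + c * (1 - (tanh t)\<^sup>2)) has_real_derivative
        (0\<^sup>2 - 2 * (1 - (tanh t)\<^sup>2)) * (1 - t * tanh t + c * tanh t)) (at t)" for t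
      by (rule derivative_eq_intros refl | simp)+ (simp add: algebra_simps power2_eq_square)
  qed (use T P in \<open>auto simp: c_def p[symmetric] field_simps\<close>)
  then show ?thesis by (simp add: c_def)
qed

text \<open>The ansatz combines \<open>e\<^bsup>nt\<^esup> (tanh t - n)\<close> and \<open>e\<^bsup>-nt\<^esup> (tanh t + n)\<close>, which solve
  \<open>f'' = (n\<^sup>2 - 2 sech\<^sup>2 t) f\<close> and are independent for \<open>0 < n < 1\<close>.\<close>

lemma global_outer_n:
  assumes P: "P > 0" and \<alpha>: "\<alpha> < 1" and p: "p = P * (1 - \<alpha>)" and n: "0 < n" "n < 1"
    and bc: "cosh (n * p) - tanh p * sinh (n * p) / n + g / P * ((tanh p * cosh (n * p) - n * sinh (n * p)) / (1 - n\<^sup>2)) = 0"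
  shows "\<exists>y y'. global_outer \<alpha> P (n * P) g y y'"
proof -
  have n2: "1 - n\<^sup>2 \<noteq> 0" using n by (simp add: power2_eq_1_iff)
  \<comment> \<open>At \<open>t = 0\<close> the ansatz has slope \<open>k * (1 - n\<^sup>2)\<close>,
    which has to be \<open>g / P\<close>.\<close>
  define k where "k = g / P / (1 - n\<^sup>2)"
  show ?thesis
  proof (rule global_outer_scaled[OF P,
      where f = "\<lambda>t. cosh (n * t) - tanh t * sinh (n * t) / n + k * (tanh t * cosh (n * t) - n * sinh (n * t))"
      and f' = "\<lambda>t. n * sinh (n * t) - (1 - (tanh t)\<^sup>2) * sinh (n * t) / n - tanh t * cosh (n * t)
        + k * ((1 - (tanh t)\<^sup>2) * cosh (n * t) + n * tanh t * sinh (n * t) - n\<^sup>2 * cosh (n * t))"])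
    fix t
    show "((\<lambda>t. cosh (n * t) - tanh t * sinh (n * t) / n + k * (tanh t * cosh (n * t) - n * sinh (n * t))) has_real_derivative
       n * sinh (n * t) - (1 - (tanh t)\<^sup>2) * sinh (n * t) / n - tanh t * cosh (n * t)
        + k * ((1 - (tanh t)\<^sup>2) * cosh (n * t) + n * tanh t * sinh (n * t) - n\<^sup>2 * cosh (n * t))) (at t)"
      using n by (auto intro!: derivative_eq_intros simp: field_simps power2_eq_square)
    show "((\<lambda>t. n * sinh (n * t) - (1 - (tanh t)\<^sup>2) * sinh (n * t) / n - tanh t * cosh (n * t)
        + k * ((1 - (tanh t)\<^sup>2) * cosh (n * t) + n * tanh t * sinh (n * t) - n\<^sup>2 * cosh (n * t))) has_real_derivative
        (n\<^sup>2 - 2 * (1 - (tanh t)\<^sup>2)) *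
        (cosh (n * t) - tanh t * sinh (n * t) / n + k * (tanh t * cosh (n * t) - n * sinh (n * t)))) (at t)"
      using n by (auto intro!: derivative_eq_intros simp: field_simps power2_eq_square)
    show "cosh (n * (P * (1 - \<alpha>))) - tanh (P * (1 - \<alpha>)) * sinh (n * (P * (1 - \<alpha>))) / n +
      k * (tanh (P * (1 - \<alpha>)) * cosh (n * (P * (1 - \<alpha>))) - n * sinh (n * (P * (1 - \<alpha>)))) = 0"
      using bc unfolding p[symmetric] k_def by simp
    have "k * (1 - n\<^sup>2) = g / P" using n2 by (simp add: k_def)
    then show "n * sinh (n * 0) - (1 - (tanh 0)\<^sup>2) * sinh (n * 0) / n - tanh 0 * cosh (n * 0)
        + k * ((1 - (tanh 0)\<^sup>2) * cosh (n * 0) + n * tanh 0 * sinh (n * 0) - n\<^sup>2 * cosh (n * 0)) = g / P"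
      by simp
  qed simp
qed

text \<open>With \<open>\<nu> = n * P\<close>, the equation \<open>H n = 0\<close> is the condition
  at \<open>1\<close> in \<open>global_outer_n\<close>. \<open>H 0 < 0\<close> comes from the bound
  on \<open>\<gamma> 0\<close>, and \<open>H\<close> is positive somewhere below
  \<open>n = 1\<close>, because \<open>K 1 = 1 / cosh p\<close> and the remaining term is
  nonnegative.\<close>

lemma outer_exists:
  assumes P: "P > 0" and \<alpha>: "\<alpha> < 1" and p: "p = P * (1 - \<alpha>)"
    and \<gamma>: "continuous_on UNIV \<gamma>" "\<And>\<nu>. \<nu> \<ge> 0 \<Longrightarrow> \<gamma> \<nu> \<ge> 0" "\<gamma> 0 < P * (p - 1 / tanh p)"
  shows "\<exists>\<nu>>0. \<exists>y y'. global_outer \<alpha> P \<nu> (\<gamma> \<nu>) y y'"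
proof -
  have pp: "p > 0" using P \<alpha> p by simp
  define T where "T = tanh p"
  have T: "0 < T" "T < 1" using pp by (auto simp: T_def tanh_real_lt_1)
  define K where "K n = cosh (n * p) - T * (p * shc (n * p))" for n
  define s where "s n = (T * cosh (n * p) - n * sinh (n * p)) / (1 - n\<^sup>2)" for n
  define H where "H n = K n + \<gamma> (n * P) / P * s n" for n
  have cK: "continuous_on S K" for S
    unfolding K_def by (intro continuous_intros continuous_on_compose2[OF shc_continuous[of UNIV]]) auto
  have "K 1 = 1 / cosh p"
    using pp cosh_square_eq[of p] by (simp add: K_def shc_def T_def tanh_def field_simps power2_eq_square)
  then have "K 1 > 0" by simp
  then have "\<forall>\<^sub>F n in at_left 1. K n > 0"
    using cK[of UNIV] by (intro order_tendstoD(1)[of K "K 1"])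
      (auto simp: continuous_on_eq_continuous_at isCont_def intro: filterlim_mono[OF _ order_refl at_le])
  moreover have "\<forall>\<^sub>F n in at_left (1::real). n \<in> {0<..<1}" by (rule eventually_at_left_real) simp
  ultimately have "\<forall>\<^sub>F n in at_left (1::real). K n > 0 \<and> n \<in> {0<..<1}" by eventually_elim simp
  \<comment> \<open>\<open>s\<close> has denominator \<open>1 - n\<^sup>2\<close>, so the search for
    a zero stops at some \<open>n1 < 1\<close>.\<close>
  then obtain n1 where n1: "K n1 > 0" "0 < n1" "n1 < 1"
    using eventually_happens'[of "at_left (1::real)"] by (auto simp: trivial_limit_at_left_real)
  have spos: "s n \<ge> 0" if "0 \<le> n" "n < 1" for n
  proof -
    have "n * tanh (n * p) \<le> 1 * T"
      using that pp T unfolding T_def by (intro mult_mono) (auto simp: mult_left_le_one_le)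
    then have "n * tanh (n * p) * cosh (n * p) \<le> T * cosh (n * p)" by (intro mult_right_mono) auto
    then have "n * sinh (n * p) \<le> T * cosh (n * p)" by (simp add: tanh_def)
    moreover have "1 - n\<^sup>2 > 0" using that by (simp add: abs_square_less_1)
    ultimately show ?thesis by (simp add: s_def)
  qed
  have "K n1 \<le> H n1"
    unfolding H_def using spos[of n1] n1 \<gamma>(2)[of "n1 * P"] P by simp
  then have H1: "H n1 > 0" using n1 by simp
  have "H 0 = 1 - T * p + \<gamma> 0 / P * T" by (simp add: H_def K_def s_def shc_def)
  also have "\<gamma> 0 / P * T < (P * (p - 1 / T)) / P * T"
    using \<gamma>(3) P T by (intro mult_strict_right_mono divide_strict_right_mono) (auto simp: T_def)
  also have "(P * (p - 1 / T)) / P * T = p * T - 1" using P T by (simp add: field_simps)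
  finally have H0: "H 0 < 0" by simp
  have "\<exists>n\<ge>0. n \<le> n1 \<and> H n = 0"
  proof (rule IVT')
    have "1 - n\<^sup>2 \<noteq> 0" if "n \<in> {0..n1}" for n using that n1 by (auto simp: power2_eq_1_iff)
    then show "continuous_on {0..n1} H"
      unfolding H_def s_def using P
      by (intro continuous_intros cK continuous_on_compose2[OF \<gamma>(1)]) auto
  qed (use H0 H1 n1 in auto)
  then obtain n where n: "0 \<le> n" "n \<le> n1" "H n = 0" by blast
  then have n0: "0 < n" "n < 1" using H0 n1 by (auto simp: less_le)
  have "\<exists>y y'. global_outer \<alpha> P (n * P) (\<gamma> (n * P)) y y'"
  proof (rule global_outer_n[OF P \<alpha> p n0])
    have "p * shc (n * p) = sinh (n * p) / n" using n0 pp by (simp add: shc_def)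
    then show "cosh (n * p) - tanh p * sinh (n * p) / n
        + \<gamma> (n * P) / P * ((tanh p * cosh (n * p) - n * sinh (n * p)) / (1 - n\<^sup>2)) = 0"
      using n(3) by (simp add: H_def K_def s_def T_def)
  qed
  then show ?thesis using n0 P by (intro exI[of _ "n * P"]) simp
qed

subsection \<open>Reduction of the eigenvalue problem\<close>

text \<open>Logarithmic derivatives at \<open>\<alpha>\<close> of \<open>cosh (\<nu> * x)\<close>
  and \<open>sinh (\<nu> * x)\<close>. The second is written with \<open>shc\<close> to include
  \<open>\<nu> = 0\<close>, where the odd solution is \<open>x\<close>.\<close>

definition \<gamma>\<^sub>e :: "real \<Rightarrow> real \<Rightarrow> real" where "\<gamma>\<^sub>e \<alpha> \<nu> = \<nu> * tanh (\<nu> * \<alpha>)"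
definition \<gamma>\<^sub>o :: "real \<Rightarrow> real \<Rightarrow> real" where "\<gamma>\<^sub>o \<alpha> \<nu> = cosh (\<nu> * \<alpha>) / (\<alpha> * shc (\<nu> * \<alpha>))"

lemma \<gamma>_0: "\<gamma>\<^sub>e \<alpha> 0 = 0" "\<gamma>\<^sub>o \<alpha> 0 = 1 / \<alpha>"
  by (simp_all add: \<gamma>\<^sub>e_def \<gamma>\<^sub>o_def shc_def)

lemma \<gamma>_nonneg: "\<alpha> > 0 \<Longrightarrow> \<nu> \<ge> 0 \<Longrightarrow> \<gamma>\<^sub>e \<alpha> \<nu> \<ge> 0" "\<alpha> > 0 \<Longrightarrow> \<gamma>\<^sub>o \<alpha> \<nu> \<ge> 0"
  using shc_pos[of "\<nu> * \<alpha>"] by (simp_all add: \<gamma>\<^sub>e_def \<gamma>\<^sub>o_def)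

lemma \<gamma>_continuous: "continuous_on UNIV (\<gamma>\<^sub>e \<alpha>)" "\<alpha> > 0 \<Longrightarrow> continuous_on UNIV (\<gamma>\<^sub>o \<alpha>)"
  unfolding \<gamma>\<^sub>e_def[abs_def] \<gamma>\<^sub>o_def[abs_def] using shc_pos
  by (intro continuous_intros continuous_on_compose2[OF shc_continuous[of UNIV]];
      simp add: less_imp_neq[symmetric])+

lemma \<gamma>\<^sub>e_mono: "\<alpha> > 0 \<Longrightarrow> 0 \<le> a \<Longrightarrow> a < b \<Longrightarrow> \<gamma>\<^sub>e \<alpha> a < \<gamma>\<^sub>e \<alpha> b"
  unfolding \<gamma>\<^sub>e_def by (intro mult_strict_mono) auto

lemma sinh_gt: "x > 0 \<Longrightarrow> x < sinh (x::real)"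
proof -
  assume x: "x > 0"
  have "sinh 0 - 0 < sinh x - x"
  proof (rule DERIV_pos_imp_increasing_open[OF x, where f = "\<lambda>x. sinh x - x"])
    fix z :: real assume z: "0 < z"
    have "((\<lambda>x. sinh x - x) has_real_derivative cosh z - 1) (at z)" by (auto intro!: derivative_eq_intros)
    moreover have "cosh z > 1" using cosh_real_nonneg_less_iff[of 0 z] z by simp
    ultimately show "\<exists>y. ((\<lambda>x. sinh x - x) has_real_derivative y) (at z) \<and> 0 < y"
      by (intro exI[of _ "cosh z - 1"]) auto
  qed (auto intro!: continuous_intros)
  then show ?thesis by simp
qed

lemma zcoth_gt_1:
  assumes "x > (0::real)"
  shows "sinh x < x * cosh x"
proof -
  have "sinh 0 - 0 * cosh 0 > sinh x - x * cosh x"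
  proof (rule DERIV_neg_imp_decreasing_open[OF assms, where f = "\<lambda>x. sinh x - x * cosh x"])
    fix z :: real assume z: "0 < z"
    have "((\<lambda>x. sinh x - x * cosh x) has_real_derivative - (z * sinh z)) (at z)" by (auto intro!: derivative_eq_intros)
    then show "\<exists>y. ((\<lambda>x. sinh x - x * cosh x) has_real_derivative y) (at z) \<and> y < 0"
      using z by (intro exI[of _ "- (z * sinh z)"]) auto
  qed (auto intro!: continuous_intros)
  then show ?thesis by simp
qed

text \<open>The derivative of \<open>z coth z\<close> is
  \<open>(sinh z * cosh z - z) / (sinh z)\<^sup>2\<close>, positive since \<open>sinh z > z\<close>
  and \<open>cosh z \<ge> 1\<close>.\<close>

lemma zcoth_mono:
  assumes "0 < x" "x < (y::real)"
  shows "x * cosh x / sinh x < y * cosh y / sinh y"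
proof (rule DERIV_pos_imp_increasing[OF assms(2)])
  fix z assume z: "x \<le> z"
  have s: "sinh z > 0" using z assms by simp
  have "((\<lambda>z. z * cosh z / sinh z) has_real_derivative
      ((cosh z + z * sinh z) * sinh z - z * cosh z * cosh z) / (sinh z * sinh z)) (at z)"
    using s by (auto intro!: derivative_eq_intros)
  moreover have "(cosh z + z * sinh z) * sinh z - z * cosh z * cosh z = sinh z * cosh z - z"
    using cosh_square_eq[of z] by (simp add: power2_eq_square algebra_simps)
  moreover have "z * 1 < sinh z * cosh z"
    using sinh_gt[of z] z assms by (intro mult_less_le_imp_less) (auto simp: cosh_real_ge_1)
  ultimately show "\<exists>d. ((\<lambda>z. z * cosh z / sinh z) has_real_derivative d) (at z) \<and> d > 0"
    using s by auto
qed

lemma \<gamma>\<^sub>o_eq: "\<alpha> > 0 \<Longrightarrow> \<nu> > 0 \<Longrightarrow> \<gamma>\<^sub>o \<alpha> \<nu> = (\<nu> * \<alpha>) * cosh (\<nu> * \<alpha>) / sinh (\<nu> * \<alpha>) / \<alpha>"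
  by (simp add: \<gamma>\<^sub>o_def shc_def)

lemma \<gamma>\<^sub>o_mono:
  assumes "\<alpha> > 0" "0 \<le> a" "a < b"
  shows "\<gamma>\<^sub>o \<alpha> a < \<gamma>\<^sub>o \<alpha> b"
proof (cases "a = 0")
  case True
  have "1 < (b * \<alpha>) * cosh (b * \<alpha>) / sinh (b * \<alpha>)"
    using zcoth_gt_1[of "b * \<alpha>"] assms by simp
  from divide_strict_right_mono[OF this assms(1)] show ?thesis
    using True assms by (simp add: \<gamma>_0 \<gamma>\<^sub>o_eq)
next
  case False
  then have "a * \<alpha> * cosh (a * \<alpha>) / sinh (a * \<alpha>) < b * \<alpha> * cosh (b * \<alpha>) / sinh (b * \<alpha>)"
    using assms by (intro zcoth_mono) auto
  from divide_strict_right_mono[OF this assms(1)] show ?thesis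
    using False assms by (simp add: \<gamma>\<^sub>o_eq)
qed

text \<open>From \<open>tanh < 1 < coth\<close>. It prevents an even and an odd eigenfunction from
  belonging to the same \<open>\<nu>\<close>.\<close>

lemma \<gamma>\<^sub>e_less_\<gamma>\<^sub>o:
  assumes "\<alpha> > 0" "0 \<le> \<nu>"
  shows "\<gamma>\<^sub>e \<alpha> \<nu> < \<gamma>\<^sub>o \<alpha> \<nu>"
proof (cases "\<nu> = 0")
  case False
  then have z: "\<nu> > 0" "tanh (\<nu> * \<alpha>) > 0" using assms by auto
  have "tanh (\<nu> * \<alpha>) < 1" by (rule tanh_real_lt_1)
  also have "1 < 1 / tanh (\<nu> * \<alpha>)" using z tanh_real_lt_1 by simp
  finally have "\<nu> * tanh (\<nu> * \<alpha>) < \<nu> * (1 / tanh (\<nu> * \<alpha>))" using z by (intro mult_strict_left_mono) auto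
  then show ?thesis using z assms by (simp add: \<gamma>\<^sub>e_def \<gamma>\<^sub>o_eq) (simp add: tanh_def)
qed (use assms in \<open>simp add: \<gamma>_0\<close>)

text \<open>The solution in the middle interval, of parity \<open>\<sigma>\<close> and normalised at
  \<open>\<alpha>\<close> like \<open>outer\<close>, so that the two can be joined.\<close>

definition core :: "real \<Rightarrow> real \<Rightarrow> real \<Rightarrow> real \<Rightarrow> (real \<Rightarrow> real) \<Rightarrow> (real \<Rightarrow> real) \<Rightarrow> bool" where
  "core \<alpha> \<nu> \<sigma> g e e' \<longleftrightarrow>
     (\<forall>x. (e has_real_derivative e' x) (at x) \<and> (e' has_real_derivative \<nu>\<^sup>2 * e x) (at x) \<and>
        e (- x) = \<sigma> * e x \<and> e' (- x) = - \<sigma> * e' x) \<and> e \<alpha> = 1 \<and> e' \<alpha> = g"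

lemma core_even: "core \<alpha> \<nu> 1 (\<gamma>\<^sub>e \<alpha> \<nu>) (\<lambda>x. cosh (\<nu> * x) / cosh (\<nu> * \<alpha>)) (\<lambda>x. \<nu> * sinh (\<nu> * x) / cosh (\<nu> * \<alpha>))"
  unfolding core_def
  by (auto intro!: derivative_eq_intros simp: \<gamma>\<^sub>e_def tanh_def power2_eq_square field_simps)

lemma x_shc_deriv: "((\<lambda>x. x * shc (\<nu> * x)) has_real_derivative cosh (\<nu> * x)) (at x)"
proof (cases "\<nu> = 0")
  case False
  then have "(\<lambda>x. x * shc (\<nu> * x)) = (\<lambda>x. sinh (\<nu> * x) / \<nu>)" by (auto simp: fun_eq_iff shc_def)
  then show ?thesis using False by (auto intro!: derivative_eq_intros)
qed (simp add: shc_def)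

lemma core_odd:
  assumes "\<alpha> > 0"
  shows "core \<alpha> \<nu> (-1) (\<gamma>\<^sub>o \<alpha> \<nu>) (\<lambda>x. x * shc (\<nu> * x) / (\<alpha> * shc (\<nu> * \<alpha>))) (\<lambda>x. cosh (\<nu> * x) / (\<alpha> * shc (\<nu> * \<alpha>)))"
proof -
  have c: "\<alpha> * shc (\<nu> * \<alpha>) \<noteq> 0" using assms shc_pos[of "\<nu> * \<alpha>"] by simp
  have e: "((\<lambda>x. x * shc (\<nu> * x) / (\<alpha> * shc (\<nu> * \<alpha>))) has_real_derivative cosh (\<nu> * x) / (\<alpha> * shc (\<nu> * \<alpha>))) (at x)" for x
    by (intro DERIV_cdivide x_shc_deriv)
  have "sinh (\<nu> * x) * \<nu> = \<nu>\<^sup>2 * (x * shc (\<nu> * x))" for x by (simp add: shc_def power2_eq_square)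
  moreover have "((\<lambda>x. cosh (\<nu> * x)) has_real_derivative sinh (\<nu> * x) * \<nu>) (at x)" for x
    by (auto intro!: derivative_eq_intros)
  ultimately have c': "((\<lambda>x. cosh (\<nu> * x)) has_real_derivative \<nu>\<^sup>2 * (x * shc (\<nu> * x))) (at x)" for x
    by metis
  have e': "((\<lambda>x. cosh (\<nu> * x) / (\<alpha> * shc (\<nu> * \<alpha>))) has_real_derivative
      \<nu>\<^sup>2 * (x * shc (\<nu> * x) / (\<alpha> * shc (\<nu> * \<alpha>)))) (at x)" for x
    by (rule DERIV_cong[OF DERIV_cdivide[OF c']]) simp
  have "shc (- x) = shc x" for x by (simp add: shc_def)
  then show ?thesis unfolding core_def using e e' c by (auto simp: \<gamma>\<^sub>o_def)
qed

lemma U_pot: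
  assumes "0 < \<alpha>" "\<alpha> < 1" "0 < p" "\<alpha> \<le> \<bar>x\<bar>" "\<bar>x\<bar> \<le> 1"
  shows "\<Lambda> \<alpha> (2 * ln (cosh p)) * exp (U \<alpha> (2 * ln (cosh p)) x) = pot \<alpha> (p / (1 - \<alpha>)) \<bar>x\<bar>"
proof -
  define z where "z = p / (1 - \<alpha>) * (\<bar>x\<bar> - \<alpha>)"
  have "\<eta> (2 * ln (cosh p)) * (\<bar>x\<bar> - \<alpha>) / (1 - \<alpha>) = sqrt 2 * z"
    using assms by (simp add: \<eta>_beta z_def)
  then have "U \<alpha> (2 * ln (cosh p)) x = w (sqrt 2 * z) + 2 * ln (cosh p)"
    using assms by (simp add: U_def)
  then have "exp (U \<alpha> (2 * ln (cosh p)) x) = (1 - (tanh z)\<^sup>2) * (cosh p)\<^sup>2"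
    using tanh_sq_less_1[of z] by (simp add: w_def exp_add exp_double)
  then show ?thesis using assms by (simp add: \<Lambda>_beta pot_def z_def)
qed

text \<open>The outer solution is reflected with the parity \<open>\<sigma>\<close> of
  \<open>e\<close>; both have value \<open>1\<close> and slope \<open>g\<close> at
  \<open>\<alpha>\<close>, so the three pieces join to a C1 function.\<close>

lemma eigenvalue_of_outer:
  assumes \<alpha>: "0 < \<alpha>" "\<alpha> < 1" and p: "0 < p"
    and y: "global_outer \<alpha> (p / (1 - \<alpha>)) \<nu> g y y'" and e: "core \<alpha> \<nu> \<sigma> g e e'"
  shows "is_eigenvalue \<alpha> (2 * ln (cosh p)) (- \<nu>\<^sup>2)"
proof -
  define P where "P = p / (1 - \<alpha>)"
  have yD: "(y has_real_derivative y' x) (at x)" "(y' has_real_derivative (\<nu>\<^sup>2 - pot \<alpha> P x) * y x) (at x)"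
     "y 1 = 0" "y \<alpha> = 1" "y' \<alpha> = g" for x
    using y by (auto simp: global_outer_def P_def)
  have eD: "(e has_real_derivative e' x) (at x)" "(e' has_real_derivative \<nu>\<^sup>2 * e x) (at x)"
     "e (- x) = \<sigma> * e x" "e' (- x) = - \<sigma> * e' x" "e \<alpha> = 1" "e' \<alpha> = g" for x
    using e by (auto simp: core_def)
  have potc: "isCont (pot \<alpha> P) x" for x
    unfolding pot_def[abs_def] by (intro continuous_intros) auto
  have neg: "((\<lambda>x. f (- x)) has_real_derivative - f' (- x)) (at x)"
    if "\<And>x. (f has_real_derivative f' x) (at x)" for f f' :: "real \<Rightarrow> real" and x
    using that[of "- x"] by (simp add: DERIV_mirror)
  interpret piecewise \<alpha> "\<lambda>x. \<sigma> * y (- x)" e y "\<lambda>x. - \<sigma> * y' (- x)" e' y'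
    "\<lambda>x. \<sigma> * ((\<nu>\<^sup>2 - pot \<alpha> P (- x)) * y (- x))" "\<lambda>x. \<nu>\<^sup>2 * e x" "\<lambda>x. (\<nu>\<^sup>2 - pot \<alpha> P x) * y x"
  proof
    show "((\<lambda>x. \<sigma> * y (- x)) has_real_derivative - \<sigma> * y' (- x)) (at x)" for x
      by (rule DERIV_cong[OF DERIV_cmult[OF neg[OF yD(1)]]]) simp
    show "((\<lambda>x. - \<sigma> * y' (- x)) has_real_derivative \<sigma> * ((\<nu>\<^sup>2 - pot \<alpha> P (- x)) * y (- x))) (at x)" for x
      by (rule DERIV_cong[OF DERIV_cmult[OF neg[OF yD(2)]]]) simp
    show "isCont (\<lambda>x. (\<nu>\<^sup>2 - pot \<alpha> P x) * y x) x" for x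
      by (intro continuous_intros potc DERIV_isCont[OF yD(1)])
    show "isCont (\<lambda>x. \<sigma> * ((\<nu>\<^sup>2 - pot \<alpha> P (- x)) * y (- x))) x" for x
      by (intro continuous_intros isCont_o2[OF _ potc] isCont_o2[OF _ DERIV_isCont[OF yD(1)]])
    show "isCont (\<lambda>x. \<nu>\<^sup>2 * e x) x" for x by (intro continuous_intros DERIV_isCont[OF eD(1)])
  qed (use \<alpha> yD eD in auto)
  define \<phi> where "\<phi> = piece3 \<alpha> (\<lambda>x. \<sigma> * y (- x)) e y"
  show ?thesis unfolding is_eigenvalue_def
  proof (rule exI[of _ \<phi>], intro conjI ballI)
    show "C2_on ({-1..1} - {-\<alpha>, \<alpha>}) \<phi>" "C1_on {-1..1} \<phi>" unfolding \<phi>_def by (rule C2 C1)+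
    show "\<phi> (- 1) = 0" "\<phi> 1 = 0" using \<alpha> yD by (auto simp: \<phi>_def piece3_def)
    show "\<exists>x\<in>{-1..1}. \<phi> x \<noteq> 0" using \<alpha> eD(5) by (intro bexI[of _ \<alpha>]) (auto simp: \<phi>_def piece3_def)
    fix x assume x: "x \<in> {-1<..<1} - {-\<alpha>, \<alpha>}"
    have dd: "deriv (deriv \<phi>) x = piece3 \<alpha> (\<lambda>x. \<sigma> * ((\<nu>\<^sup>2 - pot \<alpha> P (- x)) * y (- x))) (\<lambda>x. \<nu>\<^sup>2 * e x)
        (\<lambda>x. (\<nu>\<^sup>2 - pot \<alpha> P x) * y x) x"
      unfolding \<phi>_def using x by (intro deriv_deriv) auto
    consider "x < -\<alpha>" | "-\<alpha> < x" "x < \<alpha>" | "\<alpha> < x" using x by fastforce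
    then show "deriv (deriv \<phi>) x + \<Lambda> \<alpha> (2 * ln (cosh p)) * h x \<alpha> * exp (U \<alpha> (2 * ln (cosh p)) x) * \<phi> x + - \<nu>\<^sup>2 * \<phi> x = 0"
    proof cases
      case 1
      then have "h x \<alpha> = 1" "\<bar>x\<bar> = - x" using \<alpha> by (auto simp: h_def)
      then show ?thesis using 1 x U_pot[OF \<alpha> p, of x] \<alpha> unfolding dd
        by (simp add: \<phi>_def piece3_def P_def algebra_simps)
    next
      case 2
      then have "h x \<alpha> = 0" by (auto simp: h_def)
      then show ?thesis using 2 \<alpha> unfolding dd by (simp add: \<phi>_def piece3_def)
    next
      case 3
      then have "h x \<alpha> = 1" "\<bar>x\<bar> = x" using \<alpha> by (auto simp: h_def)
      then show ?thesis using 3 x U_pot[OF \<alpha> p, of x] \<alpha> unfolding dd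
        by (simp add: \<phi>_def piece3_def P_def algebra_simps)
    qed
  qed
qed

text \<open>On \<open>[0,\<alpha>]\<close> the Wronskian of \<open>\<psi>\<close> and
  \<open>e\<close> is constant and zero at \<open>0\<close>, so
  \<open>\<psi>' \<alpha> = \<psi> \<alpha> * g\<close>. If \<open>\<psi> \<alpha> = 0\<close>,
  uniqueness on both sides of \<open>\<alpha>\<close> applies; otherwise division by
  \<open>\<psi> \<alpha>\<close> yields an outer solution.\<close>

lemma half_line:
  assumes \<alpha>: "0 < \<alpha>" "\<alpha> < 1" and e: "core \<alpha> \<nu> \<sigma> g e e'"
    and c: "continuous_on {0..1} \<psi>" "continuous_on {0..1} \<psi>'"
    and d1: "\<And>x. 0 < x \<Longrightarrow> x < 1 \<Longrightarrow> (\<psi> has_real_derivative \<psi>' x) (at x)"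
    and d2: "\<And>x. 0 < x \<Longrightarrow> x < \<alpha> \<Longrightarrow> (\<psi>' has_real_derivative \<nu>\<^sup>2 * \<psi> x) (at x)"
    and d3: "\<And>x. \<alpha> < x \<Longrightarrow> x < 1 \<Longrightarrow> (\<psi>' has_real_derivative (\<nu>\<^sup>2 - pot \<alpha> P x) * \<psi> x) (at x)"
    and bc: "\<psi> 1 = 0" "\<psi>' 0 * e 0 = \<psi> 0 * e' 0"
  shows "(\<forall>x\<in>{0..1}. \<psi> x = 0) \<or> (\<exists>y y'. outer \<alpha> P \<nu> g y y')"
proof (cases "\<psi> \<alpha> = 0")
  have eD: "(e has_real_derivative e' x) (at x)" "(e' has_real_derivative \<nu>\<^sup>2 * e x) (at x)"
     "e \<alpha> = 1" "e' \<alpha> = g" for x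
    using e by (auto simp: core_def)
  have sub: "continuous_on {a..b} \<psi>" "continuous_on {a..b} \<psi>'" if "0 \<le> a" "b \<le> 1" for a b
    using c that by (auto elim!: continuous_on_subset)
  have "\<psi>' \<alpha> * e \<alpha> - \<psi> \<alpha> * e' \<alpha> = \<psi>' 0 * e 0 - \<psi> 0 * e' 0"
  proof (rule DERIV_isconst_end[OF \<alpha>(1), where f = "\<lambda>x. \<psi>' x * e x - \<psi> x * e' x"])
    show "continuous_on {0..\<alpha>} (\<lambda>x. \<psi>' x * e x - \<psi> x * e' x)"
      using \<alpha> by (intro continuous_intros sub DERIV_imp_continuous_on[OF eD(1)] DERIV_imp_continuous_on[OF eD(2)]) auto
    show "((\<lambda>x. \<psi>' x * e x - \<psi> x * e' x) has_real_derivative 0) (at x)" if "0 < x" "x < \<alpha>" for x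
      by (rule derivative_eq_intros d1 d2 eD that less_trans[OF that(2) \<alpha>(2)] refl | simp)+
  qed
  then have g: "\<psi>' \<alpha> = \<psi> \<alpha> * g" using bc eD by simp
  {
    case True
    have "\<psi> x = 0" if "x \<in> {0..1}" for x
    proof (cases "x \<le> \<alpha>")
      case xa: True
      show ?thesis
        by (rule linear_ode_unique[of 0 \<alpha> \<psi> \<psi>' "\<lambda>_. \<nu>\<^sup>2" "\<nu>\<^sup>2"])
          (use True g \<alpha> xa that in \<open>auto intro!: sub d1 d2\<close>)
    next
      case xa: False
      have b: "\<bar>\<nu>\<^sup>2 - pot \<alpha> P x\<bar> \<le> \<nu>\<^sup>2 + 2 * P\<^sup>2" for x
        using pot_bounds[of \<alpha> P x] zero_le_power2[of \<nu>] zero_le_power2[of P] unfolding abs_le_iff by linarith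
      show ?thesis
        by (rule linear_ode_unique[of \<alpha> 1 \<psi> \<psi>' "\<lambda>x. \<nu>\<^sup>2 - pot \<alpha> P x" "\<nu>\<^sup>2 + 2 * P\<^sup>2"])
          (use True g \<alpha> xa that b in \<open>auto intro!: sub d1 d3\<close>)
    qed
    then show ?thesis by blast
  next
    case False
    have "outer \<alpha> P \<nu> g (\<lambda>x. \<psi> x / \<psi> \<alpha>) (\<lambda>x. \<psi>' x / \<psi> \<alpha>)"
      unfolding outer_def
    proof (intro conjI allI impI)
      show "continuous_on {\<alpha>..1} (\<lambda>x. \<psi> x / \<psi> \<alpha>)" "continuous_on {\<alpha>..1} (\<lambda>x. \<psi>' x / \<psi> \<alpha>)"
        using \<alpha> False by (auto intro!: continuous_intros sub)
      fix x assume x: "\<alpha> < x \<and> x < 1"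
      show "((\<lambda>x. \<psi> x / \<psi> \<alpha>) has_real_derivative \<psi>' x / \<psi> \<alpha>) (at x)"
        using x \<alpha> by (intro DERIV_cdivide d1) auto
      show "((\<lambda>x. \<psi>' x / \<psi> \<alpha>) has_real_derivative (\<nu>\<^sup>2 - pot \<alpha> P x) * (\<psi> x / \<psi> \<alpha>)) (at x)"
        by (rule DERIV_cong[OF DERIV_cdivide[OF d3]]) (use x in auto)
    qed (use False bc g in auto)
    then show ?thesis by blast
  }
qed

text \<open>\<open>C1_on\<close> and \<open>C2_on\<close> provide first derivatives by separate
  existential statements. Off \<open>-\<alpha>\<close> and \<open>\<alpha>\<close> the two coincide
  in the open interval, and there \<open>deriv (deriv \<phi>)\<close> is the derivative of
  \<open>\<phi>'\<close>.\<close>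

lemma eigenfunction_derivatives:
  assumes \<alpha>: "0 < \<alpha>" "\<alpha> < 1" and p: "0 < p"
    and eig: "is_eigenvalue \<alpha> (2 * ln (cosh p)) (- \<nu>\<^sup>2)"
  obtains \<phi> \<phi>' where "continuous_on {-1..1} \<phi>" "continuous_on {-1..1} \<phi>'"
    "\<And>x. -1 < x \<Longrightarrow> x < 1 \<Longrightarrow> (\<phi> has_real_derivative \<phi>' x) (at x)"
    "\<And>x. \<bar>x\<bar> < \<alpha> \<Longrightarrow> (\<phi>' has_real_derivative \<nu>\<^sup>2 * \<phi> x) (at x)"
    "\<And>x. \<alpha> < \<bar>x\<bar> \<Longrightarrow> \<bar>x\<bar> < 1 \<Longrightarrow> (\<phi>' has_real_derivative (\<nu>\<^sup>2 - pot \<alpha> (p / (1 - \<alpha>)) \<bar>x\<bar>) * \<phi> x) (at x)"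
    "\<phi> (-1) = 0" "\<phi> 1 = 0" "\<exists>x\<in>{-1..1}. \<phi> x \<noteq> 0"
proof -
  let ?\<beta> = "2 * ln (cosh p)" and ?O = "{-1<..<1} - {-\<alpha>, \<alpha>}" and ?S = "{-1..1} - {-\<alpha>, \<alpha>}"
  obtain \<phi> where \<phi>: "C2_on ?S \<phi>" "C1_on {-1..1} \<phi>" "\<phi> (-1) = 0" "\<phi> 1 = 0" "\<exists>x\<in>{-1..1}. \<phi> x \<noteq> 0"
    "\<And>x. x \<in> ?O \<Longrightarrow> deriv (deriv \<phi>) x + \<Lambda> \<alpha> ?\<beta> * h x \<alpha> * exp (U \<alpha> ?\<beta> x) * \<phi> x + - \<nu>\<^sup>2 * \<phi> x = 0"
    using eig unfolding is_eigenvalue_def by blast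
  obtain \<phi>' where \<phi>': "\<And>x. x \<in> {-1..1} \<Longrightarrow> (\<phi> has_real_derivative \<phi>' x) (at x within {-1..1})"
      "continuous_on {-1..1} \<phi>'"
    using \<phi>(2) unfolding C1_on_def by blast
  obtain f f' where f: "\<And>x. x \<in> ?S \<Longrightarrow> (\<phi> has_real_derivative f x) (at x within ?S)"
      "\<And>x. x \<in> ?S \<Longrightarrow> (f has_real_derivative f' x) (at x within ?S)"
    using \<phi>(1) unfolding C2_on_def C1_on_def by blast
  have oO: "open ?O" by (intro open_Diff open_greaterThanLessThan) auto
  have d1: "(\<phi> has_real_derivative \<phi>' x) (at x)" if "-1 < x" "x < 1" for x
    using \<phi>'(1)[of x] that at_within_interior[of x "{-1..1}"] by (simp add: interior_atLeastAtMost_real)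
  have at: "at x within ?S = at x" if "x \<in> ?O" for x
    by (rule at_within_open_subset[OF that oO]) auto
  have f\<phi>: "f x = \<phi>' x" if "x \<in> ?O" for x
  proof (rule DERIV_unique)
    show "(\<phi> has_real_derivative f x) (at x)" using f(1)[of x] at[OF that] that by simp
    show "(\<phi> has_real_derivative \<phi>' x) (at x)" using d1 that by simp
  qed
  have d2: "(\<phi>' has_real_derivative f' x) (at x)" if "x \<in> ?O" for x
  proof (rule has_field_derivative_transform_within_open[OF _ oO that f\<phi>])
    show "(f has_real_derivative f' x) (at x)" using f(2)[of x] at[OF that] that by simp
  qed
  have "deriv (deriv \<phi>) x = f' x" if x: "x \<in> ?O" for x
  proof -
    have "\<forall>\<^sub>F z in nhds x. z \<in> ?O" by (rule eventually_nhds_in_open[OF oO x])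
    then have "\<forall>\<^sub>F z in nhds x. deriv \<phi> z = \<phi>' z"
      by eventually_elim (auto intro!: DERIV_imp_deriv d1)
    then have "deriv (deriv \<phi>) x = deriv \<phi>' x" by (rule deriv_cong_ev) simp
    then show ?thesis using DERIV_imp_deriv[OF d2[OF x]] by simp
  qed
  then have eq: "f' x = (\<nu>\<^sup>2 - h x \<alpha> * (\<Lambda> \<alpha> ?\<beta> * exp (U \<alpha> ?\<beta> x))) * \<phi> x" if "x \<in> ?O" for x
    using \<phi>(6)[OF that] that by (simp add: algebra_simps)
  show ?thesis
  proof (rule that[of \<phi> \<phi>'])
    show "(\<phi>' has_real_derivative \<nu>\<^sup>2 * \<phi> x) (at x)" if "\<bar>x\<bar> < \<alpha>" for x
    proof -
      have "x \<in> ?O" using that \<alpha> by auto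
      then show ?thesis using d2[of x] eq[of x] that by (simp add: h_def)
    qed
    show "(\<phi>' has_real_derivative (\<nu>\<^sup>2 - pot \<alpha> (p / (1 - \<alpha>)) \<bar>x\<bar>) * \<phi> x) (at x)" if "\<alpha> < \<bar>x\<bar>" "\<bar>x\<bar> < 1" for x
    proof -
      have x: "x \<in> ?O" using that \<alpha> by (auto simp: abs_less_iff)
      then show ?thesis using d2[OF x] eq[OF x] that U_pot[OF \<alpha> p, of x] by (simp add: h_def)
    qed
  qed (use \<phi> \<phi>' d1 C1_on_continuous in auto)
qed

text \<open>For \<open>\<sigma> = 1\<close> and \<open>\<sigma> = -1\<close>,
  \<open>\<phi> x + \<sigma> * \<phi> (- x)\<close> is twice the even and the odd part;
  \<open>half_line\<close> applies to each, and they cannot both vanish.\<close>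

lemma outer_of_eigenvalue:
  assumes \<alpha>: "0 < \<alpha>" "\<alpha> < 1" and p: "0 < p"
    and eig: "is_eigenvalue \<alpha> (2 * ln (cosh p)) (- \<nu>\<^sup>2)"
  shows "(\<exists>y y'. outer \<alpha> (p / (1 - \<alpha>)) \<nu> (\<gamma>\<^sub>e \<alpha> \<nu>) y y') \<or> (\<exists>y y'. outer \<alpha> (p / (1 - \<alpha>)) \<nu> (\<gamma>\<^sub>o \<alpha> \<nu>) y y')"
proof -
  let ?P = "p / (1 - \<alpha>)"
  obtain \<phi> \<phi>' where \<phi>: "continuous_on {-1..1} \<phi>" "continuous_on {-1..1} \<phi>'"
    "\<And>x. -1 < x \<Longrightarrow> x < 1 \<Longrightarrow> (\<phi> has_real_derivative \<phi>' x) (at x)"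
    "\<And>x. \<bar>x\<bar> < \<alpha> \<Longrightarrow> (\<phi>' has_real_derivative \<nu>\<^sup>2 * \<phi> x) (at x)"
    "\<And>x. \<alpha> < \<bar>x\<bar> \<Longrightarrow> \<bar>x\<bar> < 1 \<Longrightarrow> (\<phi>' has_real_derivative (\<nu>\<^sup>2 - pot \<alpha> ?P \<bar>x\<bar>) * \<phi> x) (at x)"
    "\<phi> (-1) = 0" "\<phi> 1 = 0" "\<exists>x\<in>{-1..1}. \<phi> x \<noteq> 0"
    using eigenfunction_derivatives[OF assms] by blast
  have half: "(\<forall>x\<in>{0..1}. \<phi> x + \<sigma> * \<phi> (- x) = 0) \<or> (\<exists>y y'. outer \<alpha> ?P \<nu> g y y')"
    if \<sigma>: "\<sigma> = 1 \<or> \<sigma> = -1" and e: "core \<alpha> \<nu> \<sigma> g e e'" for \<sigma> g e e'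
  proof (rule half_line[OF \<alpha> e, where \<psi>' = "\<lambda>x. \<phi>' x - \<sigma> * \<phi>' (- x)"])
    have cm: "continuous_on {0..1} (\<lambda>x. f (- x))" "continuous_on {0..1} f"
      if "continuous_on {-1..1} f" for f :: "real \<Rightarrow> real"
      by (rule continuous_on_compose2[OF that], auto intro!: continuous_intros)
        (rule continuous_on_subset[OF that], auto)
    show "continuous_on {0..1} (\<lambda>x. \<phi> x + \<sigma> * \<phi> (- x))" "continuous_on {0..1} (\<lambda>x. \<phi>' x - \<sigma> * \<phi>' (- x))"
      by (intro continuous_intros cm \<phi>)+
    have neg: "((\<lambda>x. f (- x)) has_real_derivative - d) (at x)"
      if "(f has_real_derivative d) (at (- x))" for f :: "real \<Rightarrow> real" and d x
      using that by (simp add: DERIV_mirror)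
    fix x :: real
    show "((\<lambda>x. \<phi> x + \<sigma> * \<phi> (- x)) has_real_derivative \<phi>' x - \<sigma> * \<phi>' (- x)) (at x)" if "0 < x" "x < 1"
      by (rule DERIV_cong[OF DERIV_add[OF \<phi>(3) DERIV_cmult[OF neg[OF \<phi>(3)]]]]) (use that in auto)
    show "((\<lambda>x. \<phi>' x - \<sigma> * \<phi>' (- x)) has_real_derivative \<nu>\<^sup>2 * (\<phi> x + \<sigma> * \<phi> (- x))) (at x)" if "0 < x" "x < \<alpha>"
      by (rule DERIV_cong[OF DERIV_diff[OF \<phi>(4) DERIV_cmult[OF neg[OF \<phi>(4)]]]])
        (use that in \<open>auto simp: algebra_simps\<close>)
    show "((\<lambda>x. \<phi>' x - \<sigma> * \<phi>' (- x)) has_real_derivative (\<nu>\<^sup>2 - pot \<alpha> ?P x) * (\<phi> x + \<sigma> * \<phi> (- x))) (at x)"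
      if "\<alpha> < x" "x < 1"
      by (rule DERIV_cong[OF DERIV_diff[OF \<phi>(5) DERIV_cmult[OF neg[OF \<phi>(5)]]]])
        (use that \<alpha> in \<open>auto simp: algebra_simps\<close>)
  next
    show "\<phi> 1 + \<sigma> * \<phi> (- 1) = 0" using \<phi> by simp
    \<comment> \<open>For even parity the slope of the even part and \<open>e' 0\<close> vanish, for
      odd parity the odd part itself and \<open>e 0\<close>.\<close>
    have "e (- 0) = \<sigma> * e 0" "e' (- 0) = - \<sigma> * e' 0" using e unfolding core_def by blast+
    then show "(\<phi>' 0 - \<sigma> * \<phi>' (- 0)) * e 0 = (\<phi> 0 + \<sigma> * \<phi> (- 0)) * e' 0"
      using \<sigma> by auto
  qed
  show ?thesis
  proof (rule ccontr)
    assume neg: "\<not> ?thesis"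
    have e: "\<phi> x + 1 * \<phi> (- x) = 0" and o: "\<phi> x + (-1) * \<phi> (- x) = 0" if "x \<in> {0..1}" for x
      using half[OF _ core_even] half[OF _ core_odd[OF \<alpha>(1)]] neg that by blast+
    have "\<phi> x = 0" if "x \<in> {-1..1}" for x
      using e[of x] o[of x] e[of "- x"] o[of "- x"] that by (cases "x \<ge> 0") auto
    then show False using \<phi>(8) by blast
  qed
qed

subsection \<open>Counting eigenvalues\<close>

text \<open>The slope at \<open>\<alpha>\<close> of the outer solution for \<open>\<nu> = 0\<close>.
  Comparing it with \<open>0\<close> and \<open>1 / \<alpha>\<close>, the slopes of the even and odd
  middle solutions for \<open>\<nu> = 0\<close>, counts the negative eigenvalues.\<close>

definition m\<^sub>0 :: "real \<Rightarrow> real \<Rightarrow> real" where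
  "m\<^sub>0 \<alpha> p = p / (1 - \<alpha>) * (p - 1 / tanh p)"

definition has_outer :: "real \<Rightarrow> real \<Rightarrow> (real \<Rightarrow> real) \<Rightarrow> real \<Rightarrow> bool" where
  "has_outer \<alpha> p \<gamma> \<nu> \<longleftrightarrow> (\<exists>y y'. outer \<alpha> (p / (1 - \<alpha>)) \<nu> (\<gamma> \<nu>) y y')"

locale outer_problem =
  fixes \<alpha> p :: real and \<gamma> :: "real \<Rightarrow> real" and \<sigma> :: real
  assumes \<alpha>: "0 < \<alpha>" "\<alpha> < 1" and p: "0 < p"
    and cont: "continuous_on UNIV \<gamma>" and nonneg: "\<And>\<nu>. 0 \<le> \<nu> \<Longrightarrow> 0 \<le> \<gamma> \<nu>"
    and mono: "\<And>a b. 0 \<le> a \<Longrightarrow> a < b \<Longrightarrow> \<gamma> a < \<gamma> b"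
    and core: "\<And>\<nu>. \<exists>e e'. core \<alpha> \<nu> \<sigma> (\<gamma> \<nu>) e e'"
begin

lemma P: "p / (1 - \<alpha>) > 0" "p = p / (1 - \<alpha>) * (1 - \<alpha>)" using \<alpha> p by auto

lemma global_0: "\<exists>y y'. global_outer \<alpha> (p / (1 - \<alpha>)) 0 (m\<^sub>0 \<alpha> p) y y'"
  using global_outer_0[OF P(1) \<alpha>(2) P(2)] by (simp add: m\<^sub>0_def)

lemma outer_0: "\<exists>y y'. outer \<alpha> (p / (1 - \<alpha>)) 0 (m\<^sub>0 \<alpha> p) y y'"
  using global_0 global_outer_imp_outer by blast

text \<open>The required slope \<open>\<gamma>\<close> increases in \<open>\<nu>\<close>, while the
  outer slope decreases from \<open>m\<^sub>0 \<alpha> p\<close>; a crossing at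
  \<open>\<nu> > 0\<close> needs \<open>\<gamma>\<close> to start below.\<close>

lemma has_outer_imp: "has_outer \<alpha> p \<gamma> \<nu> \<Longrightarrow> 0 < \<nu> \<Longrightarrow> \<gamma> 0 < m\<^sub>0 \<alpha> p"
  unfolding has_outer_def using outer_0 outer_compare(2)[OF _ _ P(1) \<alpha>(2)] mono[of 0 \<nu>]
  by (meson less_trans order_refl)

lemma has_outer_unique: "has_outer \<alpha> p \<gamma> \<nu> \<Longrightarrow> has_outer \<alpha> p \<gamma> \<nu>' \<Longrightarrow> 0 < \<nu> \<Longrightarrow> 0 < \<nu>' \<Longrightarrow> \<nu> = \<nu>'"
proof -
  have "\<not> a < b" if "has_outer \<alpha> p \<gamma> a" "has_outer \<alpha> p \<gamma> b" "0 < a" for a b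
    using that outer_compare(2)[OF _ _ P(1) \<alpha>(2)] mono[of a b]
    unfolding has_outer_def by (meson less_imp_le less_asym)
  then show "has_outer \<alpha> p \<gamma> \<nu> \<Longrightarrow> has_outer \<alpha> p \<gamma> \<nu>' \<Longrightarrow> 0 < \<nu> \<Longrightarrow> 0 < \<nu>' \<Longrightarrow> ?thesis"
    by (meson linorder_neqE_linordered_idom)
qed

lemma has_outer_0: "has_outer \<alpha> p \<gamma> 0 \<longleftrightarrow> m\<^sub>0 \<alpha> p = \<gamma> 0"
  unfolding has_outer_def using outer_0 outer_compare(1)[OF _ _ P(1) \<alpha>(2)] by metis

lemma exists_global: "\<gamma> 0 < m\<^sub>0 \<alpha> p \<Longrightarrow> \<exists>\<nu>>0. \<exists>y y'. global_outer \<alpha> (p / (1 - \<alpha>)) \<nu> (\<gamma> \<nu>) y y'"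
  using outer_exists[OF P(1) \<alpha>(2) P(2) cont nonneg] by (simp add: m\<^sub>0_def)

lemma card_outer:
  "finite {\<nu>. 0 < \<nu> \<and> has_outer \<alpha> p \<gamma> \<nu>}"
  "card {\<nu>. 0 < \<nu> \<and> has_outer \<alpha> p \<gamma> \<nu>} = (if \<gamma> 0 < m\<^sub>0 \<alpha> p then 1 else 0)"
proof -
  have "{\<nu>. 0 < \<nu> \<and> has_outer \<alpha> p \<gamma> \<nu>} = {}" if "\<not> \<gamma> 0 < m\<^sub>0 \<alpha> p"
    using has_outer_imp that by blast
  moreover have "\<exists>\<nu>. {\<nu>. 0 < \<nu> \<and> has_outer \<alpha> p \<gamma> \<nu>} = {\<nu>}" if gt: "\<gamma> 0 < m\<^sub>0 \<alpha> p"
  proof -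
    obtain \<nu> where "\<nu> > 0" "has_outer \<alpha> p \<gamma> \<nu>"
      using exists_global[OF gt] global_outer_imp_outer unfolding has_outer_def by blast
    then show ?thesis using has_outer_unique by (intro exI[of _ \<nu>]) auto
  qed
  ultimately consider "\<not> \<gamma> 0 < m\<^sub>0 \<alpha> p" "{\<nu>. 0 < \<nu> \<and> has_outer \<alpha> p \<gamma> \<nu>} = {}"
    | \<nu> where "\<gamma> 0 < m\<^sub>0 \<alpha> p" "{\<nu>. 0 < \<nu> \<and> has_outer \<alpha> p \<gamma> \<nu>} = {\<nu>}"
    by blast
  then have "finite {\<nu>. 0 < \<nu> \<and> has_outer \<alpha> p \<gamma> \<nu>} \<and>
    card {\<nu>. 0 < \<nu> \<and> has_outer \<alpha> p \<gamma> \<nu>} = (if \<gamma> 0 < m\<^sub>0 \<alpha> p then 1 else 0)"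
  proof cases
    case 1
    show ?thesis unfolding 1(2) using 1(1) by simp
  next
    case 2
    show ?thesis unfolding 2(2) using 2(1) by simp
  qed
  then show "finite {\<nu>. 0 < \<nu> \<and> has_outer \<alpha> p \<gamma> \<nu>}"
    "card {\<nu>. 0 < \<nu> \<and> has_outer \<alpha> p \<gamma> \<nu>} = (if \<gamma> 0 < m\<^sub>0 \<alpha> p then 1 else 0)"
    by blast+
qed

text \<open>\<open>has_outer\<close> gives the equation only on the open interval, too little for
  \<open>eigenvalue_of_outer\<close>. For \<open>\<nu> > 0\<close> an explicit global solution
  exists for some positive \<open>\<nu>'\<close>, and uniqueness identifies \<open>\<nu>'\<close>
  with \<open>\<nu>\<close>.\<close>

lemma eigenvalue:
  assumes "has_outer \<alpha> p \<gamma> \<nu>" "0 \<le> \<nu>"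
  shows "is_eigenvalue \<alpha> (2 * ln (cosh p)) (- \<nu>\<^sup>2)"
proof -
  have "\<exists>y y'. global_outer \<alpha> (p / (1 - \<alpha>)) \<nu> (\<gamma> \<nu>) y y'"
  proof (cases "\<nu> = 0")
    case True
    then show ?thesis using assms(1) has_outer_0 global_0 by simp
  next
    case False
    then have \<nu>: "\<nu> > 0" using assms by simp
    then obtain \<nu>' where \<nu>': "\<nu>' > 0" "\<exists>y y'. global_outer \<alpha> (p / (1 - \<alpha>)) \<nu>' (\<gamma> \<nu>') y y'"
      using exists_global has_outer_imp assms by blast
    then have "has_outer \<alpha> p \<gamma> \<nu>'" using global_outer_imp_outer unfolding has_outer_def by blast
    then show ?thesis using has_outer_unique[OF assms(1)] \<nu> \<nu>' by metis
  qed
  then show ?thesis using core[of \<nu>] eigenvalue_of_outer[OF \<alpha> p] by blast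
qed

end

lemma outer_problems:
  assumes "0 < \<alpha>" "\<alpha> < 1" "0 < p"
  shows "outer_problem \<alpha> p (\<gamma>\<^sub>e \<alpha>) 1" "outer_problem \<alpha> p (\<gamma>\<^sub>o \<alpha>) (-1)"
proof -
  show "outer_problem \<alpha> p (\<gamma>\<^sub>e \<alpha>) 1"
  proof
    show "\<exists>e e'. core \<alpha> \<nu> 1 (\<gamma>\<^sub>e \<alpha> \<nu>) e e'" for \<nu> using core_even by blast
  qed (use assms \<gamma>\<^sub>e_mono \<gamma>_nonneg \<gamma>_continuous in auto)
  show "outer_problem \<alpha> p (\<gamma>\<^sub>o \<alpha>) (-1)"
  proof
    show "\<exists>e e'. core \<alpha> \<nu> (-1) (\<gamma>\<^sub>o \<alpha> \<nu>) e e'" for \<nu> using core_odd[OF assms(1)] by blast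
  qed (use assms \<gamma>\<^sub>o_mono \<gamma>_nonneg \<gamma>_continuous in auto)
qed

lemma eigenvalue_iff:
  assumes "0 < \<alpha>" "\<alpha> < 1" "0 < p" "0 \<le> \<nu>"
  shows "is_eigenvalue \<alpha> (2 * ln (cosh p)) (- \<nu>\<^sup>2) \<longleftrightarrow> has_outer \<alpha> p (\<gamma>\<^sub>e \<alpha>) \<nu> \<or> has_outer \<alpha> p (\<gamma>\<^sub>o \<alpha>) \<nu>"
proof -
  interpret even: outer_problem \<alpha> p "\<gamma>\<^sub>e \<alpha>" 1 by (rule outer_problems[OF assms(1-3)])
  interpret odd: outer_problem \<alpha> p "\<gamma>\<^sub>o \<alpha>" "-1" by (rule outer_problems[OF assms(1-3)])
  show ?thesis
    using outer_of_eigenvalue[OF assms(1-3)] even.eigenvalue odd.eigenvalue assms(4)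
    unfolding has_outer_def by blast
qed

lemma degenerate_iff:
  assumes "0 < \<alpha>" "\<alpha> < 1" "0 < p"
  shows "degenerate \<alpha> (2 * ln (cosh p)) \<longleftrightarrow> m\<^sub>0 \<alpha> p = 0 \<or> m\<^sub>0 \<alpha> p = 1 / \<alpha>"
  using eigenvalue_iff[OF assms, of 0] outer_problem.has_outer_0[OF outer_problems(1)[OF assms]]
    outer_problem.has_outer_0[OF outer_problems(2)[OF assms]]
  by (simp add: degenerate_def \<gamma>_0)

text \<open>The index counts distinct eigenvalues, so the counts of the two parities add up only if
  the families are disjoint: a common \<open>\<nu>\<close> would force \<open>\<gamma>\<^sub>e
  \<alpha> \<nu> = \<gamma>\<^sub>o \<alpha> \<nu>\<close>.\<close>

lemma morse_index_eq:
  assumes "0 < \<alpha>" "\<alpha> < 1" "0 < p"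
  shows "morse_index \<alpha> (2 * ln (cosh p)) =
    enat ((if 0 < m\<^sub>0 \<alpha> p then 1 else 0) + (if 1 / \<alpha> < m\<^sub>0 \<alpha> p then 1 else 0))"
proof -
  interpret even: outer_problem \<alpha> p "\<gamma>\<^sub>e \<alpha>" 1 by (rule outer_problems[OF assms(1-3)])
  interpret odd: outer_problem \<alpha> p "\<gamma>\<^sub>o \<alpha>" "-1" by (rule outer_problems[OF assms(1-3)])
  define Ne where "Ne = {\<nu>. 0 < \<nu> \<and> has_outer \<alpha> p (\<gamma>\<^sub>e \<alpha>) \<nu>}"
  define No where "No = {\<nu>. 0 < \<nu> \<and> has_outer \<alpha> p (\<gamma>\<^sub>o \<alpha>) \<nu>}"
  define E where "E = {\<mu>. \<mu> < 0 \<and> is_eigenvalue \<alpha> (2 * ln (cosh p)) \<mu>}"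
  have "E = (\<lambda>\<nu>. - \<nu>\<^sup>2) ` (Ne \<union> No)"
  proof (intro equalityI subsetI)
    fix \<mu> assume \<mu>: "\<mu> \<in> E"
    define \<nu> where "\<nu> = sqrt (- \<mu>)"
    have \<nu>: "\<nu> > 0" "\<mu> = - \<nu>\<^sup>2" using \<mu> by (auto simp: E_def \<nu>_def)
    then show "\<mu> \<in> (\<lambda>\<nu>. - \<nu>\<^sup>2) ` (Ne \<union> No)"
      using \<mu> eigenvalue_iff[OF assms, of \<nu>] by (intro image_eqI[of _ _ \<nu>]) (auto simp: E_def Ne_def No_def)
  next
    fix \<mu> assume "\<mu> \<in> (\<lambda>\<nu>. - \<nu>\<^sup>2) ` (Ne \<union> No)"
    then show "\<mu> \<in> E" using eigenvalue_iff[OF assms] by (auto simp: E_def Ne_def No_def)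
  qed
  moreover have "inj_on (\<lambda>\<nu>. - \<nu>\<^sup>2) (Ne \<union> No)"
    by (auto simp: inj_on_def Ne_def No_def power2_eq_iff)
  moreover have "Ne \<inter> No = {}"
  proof -
    have False if "\<nu> > 0" "has_outer \<alpha> p (\<gamma>\<^sub>e \<alpha>) \<nu>" "has_outer \<alpha> p (\<gamma>\<^sub>o \<alpha>) \<nu>" for \<nu>
    proof -
      have "\<gamma>\<^sub>e \<alpha> \<nu> = \<gamma>\<^sub>o \<alpha> \<nu>"
        using that outer_compare(1)[OF _ _ even.P(1) assms(2)] unfolding has_outer_def by blast
      then show False using \<gamma>\<^sub>e_less_\<gamma>\<^sub>o[of \<alpha> \<nu>] assms that by simp
    qed
    then show ?thesis by (auto simp: Ne_def No_def)
  qed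
  ultimately have "finite E" "card E = card Ne + card No"
    using even.card_outer(1) odd.card_outer(1)
    by (auto simp: card_image card_Un_disjoint Ne_def[symmetric] No_def[symmetric])
  then show ?thesis
    using even.card_outer(2) odd.card_outer(2)
    unfolding morse_index_def E_def[symmetric] Let_def Ne_def No_def by (simp add: \<gamma>_0)
qed

section \<open>The critical values p1 and p2 of the parameter p\<close>

lemma minus_coth_mono: "0 < p \<Longrightarrow> p < q \<Longrightarrow> p - 1 / tanh p < q - 1 / tanh (q::real)"
  by (intro diff_strict_mono divide_strict_left_mono) auto

lemma m\<^sub>0_sign:
  assumes "\<alpha> < 1" "0 < p1" "p1 * tanh p1 = 1" "0 < p"
  shows "0 < m\<^sub>0 \<alpha> p \<longleftrightarrow> p1 < p" "m\<^sub>0 \<alpha> p = 0 \<longleftrightarrow> p = p1"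
proof -
  have "p1 - 1 / tanh p1 = 0" using assms by (simp add: field_simps)
  then have *: "p - 1 / tanh p > 0 \<longleftrightarrow> p1 < p" "p - 1 / tanh p = 0 \<longleftrightarrow> p = p1"
    using minus_coth_mono[of p p1] minus_coth_mono[of p1 p] assms
    by (cases p p1 rule: linorder_cases; force)+
  have c: "p / (1 - \<alpha>) > 0" using assms by simp
  show "0 < m\<^sub>0 \<alpha> p \<longleftrightarrow> p1 < p"
    unfolding m\<^sub>0_def *(1)[symmetric] using c by (metis mult_pos_pos zero_less_mult_pos)
  show "m\<^sub>0 \<alpha> p = 0 \<longleftrightarrow> p = p1"
    unfolding m\<^sub>0_def *(2)[symmetric] mult_eq_0_iff using c assms by auto
qed

text \<open>From \<open>p1\<close> on, the factors \<open>p / (1 - \<alpha>)\<close> and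
  \<open>p - coth p\<close> are both nonnegative and increasing; before \<open>p1\<close> the second
  is negative.\<close>

lemma m\<^sub>0_mono:
  assumes "\<alpha> < 1" "0 < p1" "p1 * tanh p1 = 1" "p1 \<le> p" "p < q"
  shows "m\<^sub>0 \<alpha> p < m\<^sub>0 \<alpha> q"
proof -
  have "p1 - 1 / tanh p1 = 0" using assms by (simp add: field_simps)
  then have "p - 1 / tanh p \<ge> 0" using minus_coth_mono[of p1 p] assms by (cases "p = p1") auto
  then show ?thesis unfolding m\<^sub>0_def
    using assms minus_coth_mono[of p q] by (intro mult_strict_mono divide_strict_right_mono) auto
qed

lemma m\<^sub>0_root:
  assumes \<alpha>: "0 < \<alpha>" "\<alpha> < 1" and p1: "0 < p1" "p1 * tanh p1 = 1"
  obtains p2 where "p1 < p2" "\<And>p. 0 < p \<Longrightarrow> 1 / \<alpha> < m\<^sub>0 \<alpha> p \<longleftrightarrow> p2 < p"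
    "\<And>p. 0 < p \<Longrightarrow> m\<^sub>0 \<alpha> p = 1 / \<alpha> \<longleftrightarrow> p = p2"
proof -
  \<comment> \<open>Large enough for \<open>b - coth b \<ge> 1 / \<alpha>\<close>, as
    \<open>coth b \<le> coth p1 = p1\<close>, and for
    \<open>b / (1 - \<alpha>) \<ge> 1\<close>.\<close>
  define b where "b = p1 + 1 / \<alpha>"
  have b: "p1 < b" using \<alpha> by (simp add: b_def)
  have "1 / \<alpha> \<le> m\<^sub>0 \<alpha> b"
  proof -
    have "1 / tanh b \<le> 1 / tanh p1" using p1 b by (intro divide_left_mono) auto
    also have "\<dots> = p1" using p1 by (simp add: field_simps)
    finally have 1: "1 / \<alpha> \<le> b - 1 / tanh b" by (simp add: b_def)
    have "1 \<le> b" using \<alpha> p1 by (simp add: b_def add_increasing)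
    then have "1 \<le> b / (1 - \<alpha>)" using \<alpha> by simp
    then have "1 * (1 / \<alpha>) \<le> m\<^sub>0 \<alpha> b" unfolding m\<^sub>0_def using 1 \<alpha> by (intro mult_mono) auto
    then show ?thesis by simp
  qed
  moreover have m1: "m\<^sub>0 \<alpha> p1 = 0" using m\<^sub>0_sign(2)[OF \<alpha>(2) p1 p1(1)] by simp
  moreover have "continuous_on {p1..b} (m\<^sub>0 \<alpha>)"
    unfolding m\<^sub>0_def[abs_def] using \<alpha> p1 by (intro continuous_intros) auto
  ultimately have "\<exists>x\<ge>p1. x \<le> b \<and> m\<^sub>0 \<alpha> x = 1 / \<alpha>"
    using \<alpha> b by (intro IVT') auto
  then obtain p2 where p2: "p1 \<le> p2" "m\<^sub>0 \<alpha> p2 = 1 / \<alpha>" by blast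
  have "p2 \<noteq> p1" using p2 m1 \<alpha> by auto
  have *: "m\<^sub>0 \<alpha> p < 1 / \<alpha>" if "0 < p" "p < p2" for p
  proof (cases "p1 \<le> p")
    case True
    then show ?thesis using m\<^sub>0_mono[OF \<alpha>(2) p1 True that(2)] p2 by simp
  next
    case False
    then have "m\<^sub>0 \<alpha> p \<le> 0" using m\<^sub>0_sign(1)[OF \<alpha>(2) p1 that(1)] by linarith
    also have "0 < 1 / \<alpha>" using \<alpha> by simp
    finally show ?thesis .
  qed
  have **: "1 / \<alpha> < m\<^sub>0 \<alpha> p" if "p2 < p" for p
    using m\<^sub>0_mono[OF \<alpha>(2) p1 p2(1) that] p2 by simp
  show ?thesis
  proof (rule that[of p2])
    show "p1 < p2" using p2 \<open>p2 \<noteq> p1\<close> by simp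
    show "1 / \<alpha> < m\<^sub>0 \<alpha> p \<longleftrightarrow> p2 < p" "m\<^sub>0 \<alpha> p = 1 / \<alpha> \<longleftrightarrow> p = p2" if "0 < p" for p
      using *[OF that] **[of p] p2 by (cases p p2 rule: linorder_cases; force)+
  qed
qed

lemma ln_cosh_less_iff: "0 < p \<Longrightarrow> 0 < q \<Longrightarrow> 2 * ln (cosh p) < 2 * ln (cosh q) \<longleftrightarrow> p < (q::real)"
  by (simp add: cosh_real_nonneg_less_iff)

lemma ln_cosh_surj:
  assumes "\<beta> > (0::real)"
  obtains p where "0 < p" "\<beta> = 2 * ln (cosh p)"
proof (rule that[of "arcosh (exp (\<beta> / 2))"])
  have "cosh (arcosh (exp (\<beta> / 2))) = exp (\<beta> / 2)" using assms by (intro cosh_arcosh_real) simp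
  then show "\<beta> = 2 * ln (cosh (arcosh (exp (\<beta> / 2))))" by simp
  show "0 < arcosh (exp (\<beta> / 2))" using assms by (subst arcosh_real_gt_1_iff) auto
qed

text \<open>Ties the bifurcation to the second degeneracy: the coefficient deciding the sign of
  \<open>br_Z\<close> near \<open>a = 0\<close> vanishes exactly where the even solution has an odd
  kernel function.\<close>

lemma br_Z'_0_m\<^sub>0:
  assumes "0 < \<alpha>" "\<alpha> < 1" "0 < p"
  shows "br_Z' (br_k \<alpha>) p 0 = 2 * \<alpha> * tanh p * (m\<^sub>0 \<alpha> p - 1 / \<alpha>)"
proof -
  have "p * tanh p - 1 = tanh p * (p - 1 / tanh p)" using assms by (simp add: field_simps)
  then have "br_Z' (br_k \<alpha>) p 0 = br_k \<alpha> * p * (tanh p * (p - 1 / tanh p)) - 2 * tanh p"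
    by (simp add: br_Z'_0)
  also have "\<dots> = 2 * \<alpha> * tanh p * m\<^sub>0 \<alpha> p - 2 * tanh p" by (simp add: br_k_def m\<^sub>0_def)
  finally show ?thesis using assms by (simp add: algebra_simps)
qed

theorem theorem1p3:
  fixes \<alpha> :: real
  assumes "0 < \<alpha>" and "\<alpha> < 1"
  shows "\<exists>\<beta>\<^sub>2 > \<beta>\<^sub>1.
    (\<forall>\<beta>. 0 < \<beta> \<and> \<beta> < \<beta>\<^sub>1 \<longrightarrow> morse_index \<alpha> \<beta> = 0 \<and> \<not> degenerate \<alpha> \<beta>) \<and>
    (morse_index \<alpha> \<beta>\<^sub>1 = 0 \<and> degenerate \<alpha> \<beta>\<^sub>1) \<and>
    (\<forall>\<beta>. \<beta>\<^sub>1 < \<beta> \<and> \<beta> < \<beta>\<^sub>2 \<longrightarrow> morse_index \<alpha> \<beta> = 1 \<and> \<not> degenerate \<alpha> \<beta>) \<and>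
    (morse_index \<alpha> \<beta>\<^sub>2 = 1 \<and> degenerate \<alpha> \<beta>\<^sub>2) \<and>
    (\<forall>\<beta>. \<beta> > \<beta>\<^sub>2 \<longrightarrow> morse_index \<alpha> \<beta> = 2 \<and> \<not> degenerate \<alpha> \<beta>) \<and>
    (\<exists>C :: (real \<times> C10) set.
       C \<subseteq> {0<..} \<times> UNIV \<and> connected C \<and> \<not> bounded C \<and>
       (\<Lambda> \<alpha> \<beta>\<^sub>2, U_C10 \<alpha> \<beta>\<^sub>2) \<in> closure C \<and>
       (\<forall>(l, u) \<in> C.
          is_solution \<alpha> l (fun_of u) \<and> is_positive (fun_of u) \<and> \<not> is_even (fun_of u) \<and>
          \<Lambda> \<alpha> (sup_norm (fun_of u)) \<le> l \<and> l < 4 * \<Lambda> \<alpha> (sup_norm (fun_of u))) \<and>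
       (\<exists>(k :: nat \<Rightarrow> real) (v :: nat \<Rightarrow> C10).
          (\<forall>n. (k n, v n) \<in> C) \<and> k \<longlonglongrightarrow> 0 \<and>
          filterlim (\<lambda>n. sup_norm (fun_of (v n))) at_top sequentially))"
proof -
  have \<beta>1: "\<beta>\<^sub>1 > 0 \<and> sqrt (1 - exp (- \<beta>\<^sub>1)) * artanh (sqrt (1 - exp (- \<beta>\<^sub>1))) = 1"
    unfolding \<beta>\<^sub>1_def by (rule theI'[OF \<beta>\<^sub>1_ex1])
  then obtain p1 where p1: "0 < p1" "\<beta>\<^sub>1 = 2 * ln (cosh p1)" using ln_cosh_surj by blast
  have "sqrt (1 - exp (- \<beta>\<^sub>1)) = tanh p1" unfolding p1(2) by (rule artanh_beta[OF p1(1)])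
  then have p1eq: "p1 * tanh p1 = 1"
    using \<beta>1 by (simp add: artanh_tanh_real mult.commute)
  obtain p2 where p2: "p1 < p2" "\<And>p. 0 < p \<Longrightarrow> 1 / \<alpha> < m\<^sub>0 \<alpha> p \<longleftrightarrow> p2 < p"
    "\<And>p. 0 < p \<Longrightarrow> m\<^sub>0 \<alpha> p = 1 / \<alpha> \<longleftrightarrow> p = p2"
    using m\<^sub>0_root[OF assms p1(1) p1eq] by blast
  \<comment> \<open>\<open>tanh < 1\<close> gives \<open>p1 > 1\<close>, so \<open>p2\<close> lies
    beyond the range \<open>p \<le> 1/2\<close> covered by \<open>br_Z_neg_small\<close>.\<close>
  have "p1 * tanh p1 < p1 * 1" using p1 by (intro mult_strict_left_mono tanh_real_lt_1)
  then have half: "1/2 < p2" using p1eq p2(1) by simp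
  define \<beta>2 where "\<beta>2 = 2 * ln (cosh p2)"
  have p20: "0 < p2" using p1 p2 by simp
  have main: "morse_index \<alpha> (2 * ln (cosh p)) = enat ((if p1 < p then 1 else 0) + (if p2 < p then 1 else 0))"
    "degenerate \<alpha> (2 * ln (cosh p)) \<longleftrightarrow> p = p1 \<or> p = p2" if "0 < p" for p
    using morse_index_eq[OF assms that] degenerate_iff[OF assms that] p2(2,3)[OF that]
      m\<^sub>0_sign[OF assms(2) p1(1) p1eq that] by simp_all
  have range: "\<exists>p. 0 < p \<and> \<beta> = 2 * ln (cosh p) \<and> (\<beta> < \<beta>\<^sub>1 \<longleftrightarrow> p < p1) \<and> (\<beta>\<^sub>1 < \<beta> \<longleftrightarrow> p1 < p) \<and>
      (\<beta> < \<beta>2 \<longleftrightarrow> p < p2) \<and> (\<beta>2 < \<beta> \<longleftrightarrow> p2 < p)" if pos: "0 < \<beta>" for \<beta>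
  proof -
    obtain p where "0 < p" "\<beta> = 2 * ln (cosh p)" using ln_cosh_surj[OF pos] by blast
    then show ?thesis
      using p1(1) p20 unfolding \<beta>2_def p1(2) by (intro exI[of _ p]) (simp add: cosh_real_nonneg_less_iff)
  qed
  have \<beta>12: "\<beta>\<^sub>1 < \<beta>2" using ln_cosh_less_iff[OF p1(1) p20] p1 p2 by (simp add: \<beta>2_def)
  show ?thesis
  proof (intro exI[of _ \<beta>2] conjI allI impI)
    show "\<beta>\<^sub>1 < \<beta>2" by (rule \<beta>12)
    show "morse_index \<alpha> \<beta>\<^sub>1 = 0" "degenerate \<alpha> \<beta>\<^sub>1" "morse_index \<alpha> \<beta>2 = 1" "degenerate \<alpha> \<beta>2"
      using main[OF p1(1)] main[OF p20] p1 p2(1) by (auto simp: \<beta>2_def zero_enat_def one_enat_def)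
    fix \<beta> :: real
    show "morse_index \<alpha> \<beta> = 0" "\<not> degenerate \<alpha> \<beta>" if "0 < \<beta> \<and> \<beta> < \<beta>\<^sub>1"
      using range[of \<beta>] main that p2(1) by (auto simp: zero_enat_def)
    show "morse_index \<alpha> \<beta> = 1" "\<not> degenerate \<alpha> \<beta>" if "\<beta>\<^sub>1 < \<beta> \<and> \<beta> < \<beta>2"
      using range[of \<beta>] main that \<beta>1 by (auto simp: one_enat_def)
    show "morse_index \<alpha> \<beta> = 2" "\<not> degenerate \<alpha> \<beta>" if "\<beta>2 < \<beta>"
      using range[of \<beta>] main that \<beta>1 \<beta>12 p2(1) by (auto simp: numeral_eq_enat)
  next
    have "br_Z' (br_k \<alpha>) p 0 < 0" if "0 < p" "p < p2" for p
      using br_Z'_0_m\<^sub>0[OF assms that(1)] p2(2,3)[OF that(1)] that assms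
      by (simp add: mult_less_0_iff)
    moreover have "br_Z' (br_k \<alpha>) p 0 > 0" if "p2 < p" for p
      using br_Z'_0_m\<^sub>0[OF assms, of p] p2(2)[of p] that assms p20 by simp
    ultimately show "\<exists>C :: (real \<times> C10) set.
       C \<subseteq> {0<..} \<times> UNIV \<and> connected C \<and> \<not> bounded C \<and>
       (\<Lambda> \<alpha> \<beta>2, U_C10 \<alpha> \<beta>2) \<in> closure C \<and>
       (\<forall>(l, u) \<in> C.
          is_solution \<alpha> l (fun_of u) \<and> is_positive (fun_of u) \<and> \<not> is_even (fun_of u) \<and>
          \<Lambda> \<alpha> (sup_norm (fun_of u)) \<le> l \<and> l < 4 * \<Lambda> \<alpha> (sup_norm (fun_of u))) \<and>
       (\<exists>(k :: nat \<Rightarrow> real) (v :: nat \<Rightarrow> C10).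
          (\<forall>n. (k n, v n) \<in> C) \<and> k \<longlonglongrightarrow> 0 \<and>
          filterlim (\<lambda>n. sup_norm (fun_of (v n))) at_top sequentially)"
      unfolding \<beta>2_def by (rule branch_exists[OF assms half])
  qed
qed

end
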